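(* Let $K$ be an algebraically closed field, let $Q$ be a finite quiver without oriented cycles, let $L\ge 1$, let $\Lambda = KQ/\langle \text{all paths of length } L+1\rangle$, and let $\mathbf d$ be a dimension vector. For any semisimple sequence $\mathbb S$ with $\underline{\dim}\,\mathbb S=\mathbf d$, the following conditions are equivalent: (1) The closure $\overline{\mathbf{Rep}\,\mathbb S}$ of $\mathbf{Rep}\,\mathbb S$ in $\mathbf{Rep}_{\mathbf d}(\Lambda)$ is an irreducible component of $\mathbf{Rep}_{\mathbf d}(\Lambda)$. (2) $\mathbb S$ occurs as the first entry of a minimal pair $(\mathbb S,\mathbb S^* )$ in $\mathbf{rad\text{-}soc}(\mathbf d)$. Moreover, the situation is symmetric in $\mathbb S$ and $\mathbb S^*$: whenever $(\mathbb S,\mathbb S^* )$ is a minimal element of $\mathbf{rad\text{-}soc}(\mathbf d)$, then $\mathbb S^*$ is the generic socle layering of the modules in $\mathbf{Rep}\,\mathbb S$; conversely, $\mathbb S$ is the generic radical layering of the modules with socle layering $\mathbb S^*$ (so $\mathbb S^*$ determines $\mathbb S$).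
   Context: $J$ is the Jacobson radical of $\Lambda$, so $J^{L+1}=0$. All modules are finitely generated left modules; isomorphic semisimple modules are identified, so a semisimple module is identified with its dimension vector. For a dimension vector $\mathbf d=(d_1,\dots,d_n)$ (where $Q_0=\{e_1,\dots,e_n\}$), $\mathbf{Rep}_{\mathbf d}(\Lambda)$ is the affine variety of all families $(x_\alpha)_{\alpha\in Q_1}$ of matrices, $x_\alpha\in \mathrm{Hom}_K(K^{d_i},K^{d_j})$ for $\alpha:e_i\to e_j$, satisfying the relations of $\Lambda$; the point $x$ encodes a $\Lambda$-module $M_x$ with dimension vector $\mathbf d$. Modules "in" a subset $\mathfrak U$ of $\mathbf{Rep}_{\mathbf d}(\Lambda)$ are the modules encoded by points of $\mathfrak U$. A semisimple sequence is a sequence $\mathbb S=(\mathbb S_0,\dots,\mathbb S_L)$ of semisimple modules; $\underline{\dim}\,\mathbb S=\sum_{l}\underline{\dim}\,\mathbb S_l$. $\mathbf{Seq}(\mathbf d)$ is the (finite) set of semisimple sequences with dimension vector $\mathbf d$, partially ordered by the dominance order: $\mathbb S\le\mathbb S'$ iff $\bigoplus_{0\le j\le l}\mathbb S_j\subseteq\bigoplus_{0\le j\le l}\mathbb S'_j$ (i.e. componentwise inequality of dimension vectors) for all $l\in\{0,\dots,L\}$. The radical layering of $M$ is $\mathbb S(M)=(J^lM/J^{l+1}M)_{0\le l\le L}$. The socle layering is $\mathbb S^*(M)=(\mathrm{soc}_lM/\mathrm{soc}_{l-1}M)_{0\le l\le L}$, where $\mathrm{soc}_lM=\mathrm{ann}_M(J^{l+1})$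 and $\mathrm{soc}_{-1}M=0$. $\mathbf{Rep}\,\mathbb S$ is the subvariety of $\mathbf{Rep}_{\mathbf d}(\Lambda)$ consisting of the points $x$ with $\mathbb S(M_x)=\mathbb S$; it is known to be irreducible (or empty). $\mathbf{rad\text{-}soc}(\mathbf d)\subseteq\mathbf{Seq}(\mathbf d)\times\mathbf{Seq}(\mathbf d)$ is the image of the map $\Theta:\mathbf{Rep}_{\mathbf d}(\Lambda)\to\mathbf{Seq}(\mathbf d)\times\mathbf{Seq}(\mathbf d)$, $x\mapsto(\mathbb S(M_x),\mathbb S^*(M_x))$, with the componentwise dominance order; "minimal" refers to this order. A property holds generically for the modules in an irreducible subvariety $\mathfrak U$ if it holds for all modules in some dense open subset of $\mathfrak U$. Radical and socle layerings are generically constant on irreducible subvarieties; these constant values are the generic radical, resp. socle, layering of the modules in $\mathfrak U$. (By duality, the subvariety of modules with a fixed socle layering is also irreducible or empty.) *)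

theory Defs
  imports
    "HOL-Algebra.QuotRing"
    "HOL-Algebra.Ideal_Product"
    "HOL-Analysis.Abstract_Topology"
    "Graph_Theory.Arc_Walk"
    "Jordan_Normal_Form.VS_Connect"
begin

no_notation Congruence.eq_closure_of (\<open>closure'_of\<index>\<close>)

section \<open>Irreducibility in topological spaces\<close>

definition irreducible_space :: "'x topology \<Rightarrow> bool" where
  "irreducible_space X \<longleftrightarrow> topspace X \<noteq> {} \<and>
     (\<forall>A B. closedin X A \<and> closedin X B \<and> A \<union> B = topspace X \<longrightarrow>
        A = topspace X \<or> B = topspace X)"

definition irreducible_component :: "'x topology \<Rightarrow> 'x set \<Rightarrow> bool" where
  "irreducible_component X C \<longleftrightarrow> C \<subseteq> topspace X \<and> irreducible_space (subtopology X C) \<and>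
     (\<forall>D \<subseteq> topspace X. irreducible_space (subtopology X D) \<and> C \<subseteq> D \<longrightarrow> D = C)"

definition generically :: "'x topology \<Rightarrow> 'x set \<Rightarrow> ('x \<Rightarrow> bool) \<Rightarrow> bool" where
  "generically X U P \<longleftrightarrow>
     (\<exists>V. openin (subtopology X U) V \<and>
          subtopology X U closure_of V = topspace (subtopology X U) \<and> (\<forall>x\<in>V. P x))"


section \<open>The Jacobson radical of a ring\<close>

definition left_ideal :: "'r set \<Rightarrow> ('r, 'm) ring_scheme \<Rightarrow> bool" where
  "left_ideal I R \<longleftrightarrow> additive_subgroup I R \<and> (\<forall>r\<in>carrier R. \<forall>a\<in>I. r \<otimes>\<^bsub>R\<^esub> a \<in> I)"

definition maximal_left_ideal :: "'r set \<Rightarrow> ('r, 'm) ring_scheme \<Rightarrow> bool" where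
  "maximal_left_ideal I R \<longleftrightarrow> left_ideal I R \<and> I \<noteq> carrier R \<and>
     (\<forall>I'. left_ideal I' R \<and> I \<subseteq> I' \<longrightarrow> I' = I \<or> I' = carrier R)"

definition jacobson_radical :: "('r, 'm) ring_scheme \<Rightarrow> 'r set" where
  "jacobson_radical R = carrier R \<inter> \<Inter>{I. maximal_left_ideal I R}"

abbreviation jacobson_power :: "('r, 'm) ring_scheme \<Rightarrow> nat \<Rightarrow> 'r set" where
  "jacobson_power R l \<equiv> jacobson_radical R [^]\<^bsub>ideals_set R\<^esub> l"

text \<open>For a left module \<open>M\<close> and a two-sided ideal \<open>I\<close> of the ring acting on it: the submodule
  \<open>I M\<close> and the annihilator of \<open>I\<close> in \<open>M\<close>.  Only the record type of modules is taken from
  \<^theory>\<open>HOL-Algebra.Module\<close>, since its locale is restricted to commutative rings.\<close>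

inductive_set ideal_smult :: "'r set \<Rightarrow> ('r, 'm) module \<Rightarrow> 'm set"
  for I :: "'r set" and M :: "('r, 'm) module" where
  smult: "a \<in> I \<Longrightarrow> m \<in> carrier M \<Longrightarrow> a \<odot>\<^bsub>M\<^esub> m \<in> ideal_smult I M"
| sum: "m \<in> ideal_smult I M \<Longrightarrow> m' \<in> ideal_smult I M \<Longrightarrow> m \<oplus>\<^bsub>M\<^esub> m' \<in> ideal_smult I M"

definition module_ann :: "'r set \<Rightarrow> ('r, 'm) module \<Rightarrow> 'm set" where
  "module_ann I M = {m \<in> carrier M. \<forall>a\<in>I. a \<odot>\<^bsub>M\<^esub> m = \<zero>\<^bsub>M\<^esub>}"


section \<open>Truncated path algebras\<close>

text \<open>A quiver is a \<^const>\<open>fin_digraph\<close> (loops and multiple arrows are allowed).  A path is a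
  starting vertex together with the list of arrows in the order in which they are traversed;
  the trivial path at \<open>u\<close> is \<open>(u, [])\<close>.\<close>

type_synonym ('v, 'a) quiver = "('v, 'a) pre_digraph"
type_synonym ('v, 'a) qpath = "'v \<times> 'a list"

abbreviation path_end :: "('v, 'a) quiver \<Rightarrow> ('v, 'a) qpath \<Rightarrow> 'v" where
  "path_end Q p \<equiv> pre_digraph.awlast Q (fst p) (snd p)"

definition quiver_paths :: "('v, 'a) quiver \<Rightarrow> ('v, 'a) qpath set" where
  "quiver_paths Q = {(u, p). \<exists>v. pre_digraph.awalk Q u p v}"

definition no_oriented_cycles :: "('v, 'a) quiver \<Rightarrow> bool" where
  "no_oriented_cycles Q \<longleftrightarrow> (\<nexists>u p. p \<noteq> [] \<and> pre_digraph.awalk Q u p u)"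

text \<open>Elements of the path algebra are finitely supported functions on paths.  As modules are left
  modules, the product \<open>q p\<close> of two paths is ``first \<open>p\<close>, then \<open>q\<close>'' (and zero if they cannot be
  concatenated); the multiplication below extends this bilinearly.\<close>

definition path_algebra :: "('v, 'a) quiver \<Rightarrow> (('v, 'a) qpath \<Rightarrow> 'k::field) ring" where
  "path_algebra Q = \<lparr>
     carrier = {f. finite {p. f p \<noteq> 0} \<and> {p. f p \<noteq> 0} \<subseteq> quiver_paths Q},
     mult = (\<lambda>f g (u, p). \<Sum>k\<le>length p.
               f (path_end Q (u, take k p), drop k p) * g (u, take k p)),
     one = (\<lambda>(u, p). if u \<in> verts Q \<and> p = [] then 1 else 0),
     zero = (\<lambda>_. 0),
     add = (\<lambda>f g p. f p + g p)\<rparr>"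

definition trunc_ideal ::
  "('v, 'a) quiver \<Rightarrow> nat \<Rightarrow> (('v, 'a) qpath \<Rightarrow> 'k::field) set" where
  "trunc_ideal Q L = Idl\<^bsub>path_algebra Q\<^esub>
     {(\<lambda>q. if q = p then 1 else 0) | p. p \<in> quiver_paths Q \<and> length (snd p) = L + 1}"

definition trunc_path_algebra ::
  "('v, 'a) quiver \<Rightarrow> nat \<Rightarrow> (('v, 'a) qpath \<Rightarrow> 'k::field) set ring" where
  "trunc_path_algebra Q L = path_algebra Q Quot trunc_ideal Q L"


section \<open>Representations and the modules they encode\<close>

type_synonym ('a, 'k) rep = "'a \<Rightarrow> 'k mat"

definition path_mat ::
  "('v \<Rightarrow> nat) \<Rightarrow> ('a, 'k::field) rep \<Rightarrow> ('v, 'a) qpath \<Rightarrow> 'k mat" where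
  "path_mat d x p = foldl (\<lambda>A a. x a * A) (1\<^sub>m (d (fst p))) (snd p)"

definition rep_variety ::
  "('v, 'a) quiver \<Rightarrow> nat \<Rightarrow> ('v \<Rightarrow> nat) \<Rightarrow> ('a, 'k::field) rep set" where
  "rep_variety Q L d =
     {x \<in> \<Pi>\<^sub>E a\<in>arcs Q. carrier_mat (d (head Q a)) (d (tail Q a)).
        \<forall>p\<in>quiver_paths Q. length (snd p) = L + 1 \<longrightarrow>
          path_mat d x p = 0\<^sub>m (d (path_end Q p)) (d (fst p))}"

definition path_algebra_act ::
  "('v, 'a) quiver \<Rightarrow> ('v \<Rightarrow> nat) \<Rightarrow> ('a, 'k::field) rep \<Rightarrow>
   (('v, 'a) qpath \<Rightarrow> 'k) \<Rightarrow> ('v \<Rightarrow> 'k vec) \<Rightarrow> 'v \<Rightarrow> 'k vec" where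
  "path_algebra_act Q d x f m = (\<lambda>i\<in>verts Q. vec (d i) (\<lambda>r.
     \<Sum>p | f p \<noteq> 0 \<and> path_end Q p = i. f p * (path_mat d x p *\<^sub>v m (fst p)) $ r))"

text \<open>The module \<open>M\<^sub>x\<close> with underlying space \<open>\<Oplus>\<^sub>i K\<^bsup>d i\<^esup>\<close>.  For \<open>x\<close> in the representation
  variety all members of a residue class act in the same way, which makes \<^const>\<open>the_elem\<close> below
  well-defined.  As for \<^const>\<open>module_vec\<close>, the fields \<open>mult\<close> and \<open>one\<close> have no meaning.\<close>

definition rep_module ::
  "('v, 'a) quiver \<Rightarrow> ('v \<Rightarrow> nat) \<Rightarrow> ('a, 'k::field) rep \<Rightarrow>
   ((('v, 'a) qpath \<Rightarrow> 'k) set, 'v \<Rightarrow> 'k vec) module" where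
  "rep_module Q d x = \<lparr>
     carrier = (\<Pi>\<^sub>E i\<in>verts Q. carrier_vec (d i)),
     mult = undefined,
     one = undefined,
     zero = (\<lambda>i\<in>verts Q. 0\<^sub>v (d i)),
     add = (\<lambda>m m'. \<lambda>i\<in>verts Q. m i + m' i),
     smult = (\<lambda>c m. the_elem ((\<lambda>f. path_algebra_act Q d x f m) ` c))\<rparr>"

text \<open>The trivial path \<open>e\<^sub>i\<close> acts on \<open>M\<^sub>x\<close> as the projection to the component at \<open>i\<close>, so for a
  submodule \<open>N\<close> the space \<open>e\<^sub>i N\<close> is identified with \<open>{m i | m. m \<in> N}\<close>.\<close>

definition vertex_dim :: "('v \<Rightarrow> nat) \<Rightarrow> ('v \<Rightarrow> 'k::field vec) set \<Rightarrow> 'v \<Rightarrow> nat" where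
  "vertex_dim d N i =
     vectorspace.dim class_ring (module_vec TYPE('k) (d i)\<lparr>carrier := (\<lambda>m. m i) ` N\<rparr>)"


section \<open>Semisimple sequences, radical and socle layerings\<close>

text \<open>Semisimple modules are identified with their dimension vectors.  A semisimple sequence is
  normalised to be zero beyond layer \<open>L\<close> and outside the vertex set.\<close>

type_synonym 'v semisimple_seq = "nat \<Rightarrow> 'v \<Rightarrow> nat"

definition Seqs :: "('v, 'a) quiver \<Rightarrow> nat \<Rightarrow> ('v \<Rightarrow> nat) \<Rightarrow> 'v semisimple_seq set" where
  "Seqs Q L d = {S. (\<forall>l i. l > L \<or> i \<notin> verts Q \<longrightarrow> S l i = 0) \<and>
                    (\<forall>i\<in>verts Q. (\<Sum>l\<le>L. S l i) = d i)}"

definition dominance_le ::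
  "('v, 'a) quiver \<Rightarrow> nat \<Rightarrow> 'v semisimple_seq \<Rightarrow> 'v semisimple_seq \<Rightarrow> bool" where
  "dominance_le Q L S S' \<longleftrightarrow>
     (\<forall>l\<le>L. \<forall>i\<in>verts Q. (\<Sum>j\<le>l. S j i) \<le> (\<Sum>j\<le>l. S' j i))"

text \<open>\<open>rad_power Q L d x l\<close> is \<open>J\<^sup>l M\<^sub>x\<close>, and \<open>jacobson_ann Q L d x l\<close> is \<open>ann(J\<^sup>l)\<close> in \<open>M\<^sub>x\<close>,
  i.e. \<open>soc\<close> with index \<open>l - 1\<close> (note that \<open>ann(J\<^sup>0) = 0\<close>).\<close>

definition rad_power ::
  "('v, 'a) quiver \<Rightarrow> nat \<Rightarrow> ('v \<Rightarrow> nat) \<Rightarrow> ('a, 'k::field) rep \<Rightarrow> nat \<Rightarrow> ('v \<Rightarrow> 'k vec) set" where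
  "rad_power Q L d x l =
     ideal_smult (jacobson_power (trunc_path_algebra Q L) l) (rep_module Q d x)"

definition jacobson_ann ::
  "('v, 'a) quiver \<Rightarrow> nat \<Rightarrow> ('v \<Rightarrow> nat) \<Rightarrow> ('a, 'k::field) rep \<Rightarrow> nat \<Rightarrow> ('v \<Rightarrow> 'k vec) set" where
  "jacobson_ann Q L d x l =
     module_ann (jacobson_power (trunc_path_algebra Q L) l) (rep_module Q d x)"

text \<open>The dimension vectors of the quotients are differences of dimension vectors; the submodules
  are nested, so the subtraction of natural numbers does not truncate.\<close>

definition radical_layering ::
  "('v, 'a) quiver \<Rightarrow> nat \<Rightarrow> ('v \<Rightarrow> nat) \<Rightarrow> ('a, 'k::field) rep \<Rightarrow> 'v semisimple_seq" where
  "radical_layering Q L d x = (\<lambda>l i. if l \<le> L \<and> i \<in> verts Q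
     then vertex_dim d (rad_power Q L d x l) i - vertex_dim d (rad_power Q L d x (l + 1)) i
     else 0)"

definition socle_layering ::
  "('v, 'a) quiver \<Rightarrow> nat \<Rightarrow> ('v \<Rightarrow> nat) \<Rightarrow> ('a, 'k::field) rep \<Rightarrow> 'v semisimple_seq" where
  "socle_layering Q L d x = (\<lambda>l i. if l \<le> L \<and> i \<in> verts Q
     then vertex_dim d (jacobson_ann Q L d x (l + 1)) i - vertex_dim d (jacobson_ann Q L d x l) i
     else 0)"

definition rad_stratum ::
  "('v, 'a) quiver \<Rightarrow> nat \<Rightarrow> ('v \<Rightarrow> nat) \<Rightarrow> 'v semisimple_seq \<Rightarrow> ('a, 'k::field) rep set" where
  "rad_stratum Q L d S = {x \<in> rep_variety Q L d. radical_layering Q L d x = S}"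

definition soc_stratum ::
  "('v, 'a) quiver \<Rightarrow> nat \<Rightarrow> ('v \<Rightarrow> nat) \<Rightarrow> 'v semisimple_seq \<Rightarrow> ('a, 'k::field) rep set" where
  "soc_stratum Q L d S = {x \<in> rep_variety Q L d. socle_layering Q L d x = S}"

definition rad_soc ::
  "'k::field itself \<Rightarrow> ('v, 'a) quiver \<Rightarrow> nat \<Rightarrow> ('v \<Rightarrow> nat) \<Rightarrow>
   ('v semisimple_seq \<times> 'v semisimple_seq) set" where
  "rad_soc _ Q L d =
     (\<lambda>x :: ('a, 'k) rep. (radical_layering Q L d x, socle_layering Q L d x)) ` rep_variety Q L d"

definition minimal_rad_soc ::
  "'k::field itself \<Rightarrow> ('v, 'a) quiver \<Rightarrow> nat \<Rightarrow> ('v \<Rightarrow> nat) \<Rightarrow>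
   'v semisimple_seq \<Rightarrow> 'v semisimple_seq \<Rightarrow> bool" where
  "minimal_rad_soc K Q L d S S' \<longleftrightarrow> (S, S') \<in> rad_soc K Q L d \<and>
     (\<forall>T T'. (T, T') \<in> rad_soc K Q L d \<and> dominance_le Q L T S \<and> dominance_le Q L T' S' \<longrightarrow>
        (T, T') = (S, S'))"


section \<open>The Zariski topology on the representation variety\<close>

inductive_set rep_polys :: "('v, 'a) quiver \<Rightarrow> ('v \<Rightarrow> nat) \<Rightarrow> (('a, 'k::field) rep \<Rightarrow> 'k) set"
  for Q :: "('v, 'a) quiver" and d :: "'v \<Rightarrow> nat" where
  const: "(\<lambda>_. c) \<in> rep_polys Q d"
| coord: "a \<in> arcs Q \<Longrightarrow> r < d (head Q a) \<Longrightarrow> s < d (tail Q a) \<Longrightarrow>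
            (\<lambda>x. x a $$ (r, s)) \<in> rep_polys Q d"
| add: "f \<in> rep_polys Q d \<Longrightarrow> g \<in> rep_polys Q d \<Longrightarrow> (\<lambda>x. f x + g x) \<in> rep_polys Q d"
| mult: "f \<in> rep_polys Q d \<Longrightarrow> g \<in> rep_polys Q d \<Longrightarrow> (\<lambda>x. f x * g x) \<in> rep_polys Q d"

definition zariski ::
  "('v, 'a) quiver \<Rightarrow> nat \<Rightarrow> ('v \<Rightarrow> nat) \<Rightarrow> ('a, 'k::field) rep topology" where
  "zariski Q L d = topology (\<lambda>U. \<exists>F \<subseteq> rep_polys Q d.
     U = rep_variety Q L d - {x \<in> rep_variety Q L d. \<forall>f\<in>F. f x = 0})"

lemma openin_zariski:
  fixes U :: "('a, 'k::field) rep set"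
  shows "openin (zariski Q L d) U \<longleftrightarrow>
     (\<exists>F \<subseteq> rep_polys Q d. U = rep_variety Q L d - {x \<in> rep_variety Q L d. \<forall>f\<in>F. f x = 0})"
proof -
  define V :: "('a, 'k) rep set" where "V = rep_variety Q L d"
  have "istopology (\<lambda>U :: ('a, 'k) rep set. \<exists>F \<subseteq> rep_polys Q d. U = V - {x \<in> V. \<forall>f\<in>F. f x = 0})"
    (is "istopology ?T")
    unfolding istopology_def
  proof (intro conjI allI impI)
    fix S T assume "?T S" "?T T"
    then obtain F G where F: "F \<subseteq> rep_polys Q d" "S = V - {x \<in> V. \<forall>f\<in>F. f x = 0}"
      and G: "G \<subseteq> rep_polys Q d" "T = V - {x \<in> V. \<forall>f\<in>G. f x = 0}"
      by blast
    define H where "H = (\<lambda>(f, g) x. f x * g x) ` (F \<times> G)"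
    have "S \<inter> T = V - {x \<in> V. \<forall>h\<in>H. h x = 0}"
    proof (rule Set.set_eqI)
      fix x
      have "(\<exists>h\<in>H. h x \<noteq> 0) \<longleftrightarrow> (\<exists>f\<in>F. \<exists>g\<in>G. f x * g x \<noteq> 0)"
        unfolding H_def by simp
      also have "\<dots> \<longleftrightarrow> (\<exists>f\<in>F. f x \<noteq> 0) \<and> (\<exists>g\<in>G. g x \<noteq> 0)"
        by auto
      finally have eq: "(\<exists>h\<in>H. h x \<noteq> 0) \<longleftrightarrow> (\<exists>f\<in>F. f x \<noteq> 0) \<and> (\<exists>g\<in>G. g x \<noteq> 0)" .
      have mem: "x \<in> V - {x \<in> V. \<forall>f\<in>A. f x = 0} \<longleftrightarrow> x \<in> V \<and> (\<exists>f\<in>A. f x \<noteq> 0)" for A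
        by auto
      show "x \<in> S \<inter> T \<longleftrightarrow> x \<in> V - {x \<in> V. \<forall>h\<in>H. h x = 0}"
        unfolding F(2) G(2) Int_iff mem eq by argo
    qed
    moreover have "H \<subseteq> rep_polys Q d"
      using F(1) G(1) unfolding H_def by (auto intro: rep_polys.mult)
    ultimately show "?T (S \<inter> T)" by blast
  next
    fix \<K> assume "\<forall>K\<in>\<K>. ?T K"
    then have "\<exists>F. \<forall>K\<in>\<K>. F K \<subseteq> rep_polys Q d \<and> K = V - {x \<in> V. \<forall>f\<in>F K. f x = 0}"
      by (rule bchoice)
    then obtain F where
      F: "\<forall>K\<in>\<K>. F K \<subseteq> rep_polys Q d \<and> K = V - {x \<in> V. \<forall>f\<in>F K. f x = 0}"
      by (rule exE)
    have mem: "x \<in> K \<longleftrightarrow> x \<in> V \<and> (\<exists>f\<in>F K. f x \<noteq> 0)" if "K \<in> \<K>" for K x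
    proof -
      have "K = V - {x \<in> V. \<forall>f\<in>F K. f x = 0}" by (rule conjunct2[OF bspec[OF F that]])
      then have "x \<in> K \<longleftrightarrow> x \<in> V - {x \<in> V. \<forall>f\<in>F K. f x = 0}" by (rule arg_cong)
      also have "\<dots> \<longleftrightarrow> x \<in> V \<and> (\<exists>f\<in>F K. f x \<noteq> 0)" by auto
      finally show ?thesis .
    qed
    have "\<Union>\<K> = V - {x \<in> V. \<forall>f\<in>(\<Union>K\<in>\<K>. F K). f x = 0}"
      by (rule Set.set_eqI) (auto simp: mem)
    moreover have "(\<Union>K\<in>\<K>. F K) \<subseteq> rep_polys Q d" using F by (intro UN_least) simp
    ultimately show "?T (\<Union>\<K>)" by blast
  qed
  then show ?thesis
    unfolding zariski_def V_def[symmetric] by simp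
qed

lemma topspace_zariski: "topspace (zariski Q L d) = rep_variety Q L d"
proof -
  have "{\<lambda>_. 1} \<subseteq> rep_polys Q d" by (simp add: rep_polys.const)
  then have "openin (zariski Q L d) (rep_variety Q L d)"
    unfolding openin_zariski by (intro exI[of _ "{\<lambda>_. 1}"]) auto
  moreover have "U \<subseteq> rep_variety Q L d" if "openin (zariski Q L d) U" for U
    using that unfolding openin_zariski by blast
  ultimately show ?thesis
    by (meson openin_subset openin_topspace subset_antisym)
qed

end

theory Submission
  imports Defs
begin

text \<open>The two layerings of \<open>M\<^sub>x\<close> are encoded, at each vertex \<open>i\<close>, by the dimensions of \<open>J\<^sup>l M\<^sub>x\<close> and of
  \<open>ann(J\<^sup>l)\<close>.  The Jacobson radical of the truncated path algebra is the arrow ideal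
  (\<open>jacobson_radical_eq\<close>), so these are the span of the images and the intersection of the
  kernels of the path matrices of length \<open>l\<close>.  Going down in the dominance order means larger
  radicals in the first entry and smaller annihilators in the second (\<open>rad_dominance_iff\<close>,
  \<open>soc_dominance_iff\<close>), and both are open conditions on \<open>x\<close>.  Hence the modules lying below a
  given pair form an open set, and the modules over a minimal pair form an open set.

  Strata are irreducible: a radical stratum is an open subset of the set of representations that
  shift some filtration with prescribed dimensions, and any two such representations are joined
  by a polynomial curve obtained by interpolating bases adapted to the filtrations
  (\<open>irreducible_filtered_reps\<close>); socle strata are treated in the same way.  If
  \<open>(S, S')\<close> is minimal, the open set of modules over it is contained in both strata, so it is dense in each of
  them.  This proves the two genericity statements and that \<open>S'\<close> determines \<open>S\<close>.  It also proves
  (2) \<open>\<Longrightarrow>\<close> (1), since an irreducible set containing the stratum is contained in the closure of that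
  open subset.

  For (1) \<open>\<Longrightarrow>\<close> (2), let the closure of the stratum of \<open>S\<close> be a component.  The variety is the
  finite union of the strata, so the stratum contains a point \<open>N\<close> near which all modules lie in its
  closure and therefore have radicals no larger than those of \<open>N\<close>; take \<open>N\<close> with smallest
  annihilators.  Let \<open>M\<close> be a module below \<open>N\<close> in both entries.  The heart of the proof is that
  \<open>M\<close> and \<open>N\<close> then have the same radical dimensions (\<open>rad_dims_rigid\<close>).  As there are no oriented
  cycles, the vertices can be treated in an order in which every vertex comes after its
  predecessors.  At the vertex \<open>i\<close>, the predecessors already have equal radical dimensions, so
  there are isomorphisms \<open>\<phi>\<^sub>a\<close> from the radical filtration of \<open>N\<close> to that of \<open>M\<close> at the starting
  vertices of the arrows \<open>a\<close> into \<open>i\<close>, and since \<open>M\<close> has the smaller annihilators there is an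
  automorphism \<open>\<theta>\<close> of the space at \<open>i\<close> that maps the annihilator filtration of \<open>M\<close> into that of \<open>N\<close>.
  Replace the matrices \<open>N\<^sub>a\<close> of the arrows into \<open>i\<close> by \<open>\<theta> M\<^sub>a \<phi>\<^sub>a\<close> (\<open>deform_one_vertex\<close>).
  The whole line through \<open>N\<close> and the new representation stays in the variety: its
  members shift the filtration that is the radical filtration of \<open>N\<close> at the
  vertices not reachable from \<open>i\<close> and the annihilator filtration of \<open>N\<close> at the others, because
  \<open>J\<^sup>l N \<rightarrow> J\<^sup>l M \<rightarrow> J\<^bsup>l+1\<^esup> M \<subseteq> ann\<^sub>M(J\<^bsup>L-l\<^esup>) \<rightarrow> ann\<^sub>N(J\<^bsup>L-l\<^esup>)\<close>.  At its end the radicals at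
  \<open>i\<close> are at least as large as those of \<open>M\<close>, hence also at general points of the line, and some of
  these lie near \<open>N\<close>, where radicals are no larger than those of \<open>N\<close>.

  So \<open>M\<close> lies in the stratum of \<open>S\<close>, and the choice of \<open>N\<close> forces equality of the socle
  layerings too.\<close>

section \<open>Subspaces of coordinate space and adapted bases\<close>

definition lin_subspace :: "nat \<Rightarrow> 'k::field vec set \<Rightarrow> bool" where
  "lin_subspace n W \<longleftrightarrow> W \<subseteq> carrier_vec n \<and> 0\<^sub>v n \<in> W \<and> (\<forall>v\<in>W. \<forall>w\<in>W. v + w \<in> W) \<and>
     (\<forall>c. \<forall>v\<in>W. c \<cdot>\<^sub>v v \<in> W)"

definition lspan :: "nat \<Rightarrow> 'k::field vec set \<Rightarrow> 'k vec set" where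
  "lspan n G = \<Inter>{W. lin_subspace n W \<and> G \<subseteq> W}"

definition ldim :: "nat \<Rightarrow> 'k::field vec set \<Rightarrow> nat" where
  "ldim n W = vectorspace.dim class_ring (module_vec TYPE('k) n\<lparr>carrier := W\<rparr>)"

text \<open>A basis of \<open>K\<^sup>n\<close>, stored as the columns of an invertible matrix.  Every subspace, and every chain
  of subspaces, is the image under a single frame of the coordinate subspaces of the same
  dimensions; this turns statements on filtrations into statements on matrices.\<close>

definition frame :: "nat \<Rightarrow> 'k::field mat \<Rightarrow> bool" where
  "frame n P \<longleftrightarrow> P \<in> carrier_mat n n \<and> det P \<noteq> 0"

definition coord_space :: "nat \<Rightarrow> nat \<Rightarrow> 'k::field vec set" where
  "coord_space n c = {v \<in> carrier_vec n. \<forall>r<n. c \<le> r \<longrightarrow> v $ r = 0}"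

abbreviation mat_image :: "'k::field mat \<Rightarrow> 'k vec set \<Rightarrow> 'k vec set" where
  "mat_image A W \<equiv> (\<lambda>v. A *\<^sub>v v) ` W"

lemma lin_subspaceD:
  assumes "lin_subspace n W"
  shows "W \<subseteq> carrier_vec n" "0\<^sub>v n \<in> W" "v \<in> W \<Longrightarrow> w \<in> W \<Longrightarrow> v + w \<in> W" "v \<in> W \<Longrightarrow> c \<cdot>\<^sub>v v \<in> W"
    "v \<in> W \<Longrightarrow> v \<in> carrier_vec n"
  using assms unfolding lin_subspace_def by auto

lemma lin_subspace_carrier: "lin_subspace n (carrier_vec n)"
  unfolding lin_subspace_def by auto

lemma lin_subspace_zero: "lin_subspace n {0\<^sub>v n}"
  unfolding lin_subspace_def by auto

lemma lspan_subspace: "G \<subseteq> carrier_vec n \<Longrightarrow> lin_subspace n (lspan n G)"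
  using lin_subspace_carrier[of n] unfolding lspan_def lin_subspace_def by (auto; blast)

lemma lspan_superset: "G \<subseteq> lspan n G"
  unfolding lspan_def by auto

lemma lspan_least: "lin_subspace n W \<Longrightarrow> G \<subseteq> W \<Longrightarrow> lspan n G \<subseteq> W"
  unfolding lspan_def by auto

lemma lin_subspace_coord: "lin_subspace n (coord_space n c)"
  unfolding lin_subspace_def coord_space_def by auto

lemma lin_subspace_image:
  assumes A: "A \<in> carrier_mat m n" and W: "lin_subspace n W"
  shows "lin_subspace m (mat_image A W)"
  unfolding lin_subspace_def
proof (intro conjI ballI allI)
  show "mat_image A W \<subseteq> carrier_vec m" using A lin_subspaceD(5)[OF W] by auto
  have "A *\<^sub>v 0\<^sub>v n = 0\<^sub>v m" using A by (intro eq_vecI) auto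
  then show "0\<^sub>v m \<in> mat_image A W" using lin_subspaceD(2)[OF W] by (metis imageI)
  fix v assume "v \<in> mat_image A W"
  then obtain v' where v: "v' \<in> W" "v = A *\<^sub>v v'" by auto
  note v'c = lin_subspaceD(5)[OF W v(1)]
  show "c \<cdot>\<^sub>v v \<in> mat_image A W" for c
    using mult_mat_vec[OF A v'c, of c] lin_subspaceD(4)[OF W v(1), of c] v(2) by (metis imageI)
  fix w assume "w \<in> mat_image A W"
  then obtain w' where w: "w' \<in> W" "w = A *\<^sub>v w'" by auto
  show "v + w \<in> mat_image A W"
    using mult_add_distrib_mat_vec[OF A v'c lin_subspaceD(5)[OF W w(1)]]
      lin_subspaceD(3)[OF W v(1) w(1)] v(2) w(2) by (metis imageI)
qed

lemma lin_subspace_vimage: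
  assumes A: "A \<in> carrier_mat m n" and W: "lin_subspace m W"
  shows "lin_subspace n {v \<in> carrier_vec n. A *\<^sub>v v \<in> W}"
proof -
  have z: "A *\<^sub>v 0\<^sub>v n = 0\<^sub>v m" using A by (intro eq_vecI) auto
  show ?thesis
    unfolding lin_subspace_def
    using lin_subspaceD[OF W] A
    by (auto simp: z mult_mat_vec[OF A] mult_add_distrib_mat_vec[OF A])
qed

lemma lin_subspace_Inter:
  assumes "\<And>i. i \<in> I \<Longrightarrow> lin_subspace n (W i)"
  shows "lin_subspace n (carrier_vec n \<inter> (\<Inter>i\<in>I. W i))"
  using assms unfolding lin_subspace_def by (auto; blast)

lemma frame_carrier: "frame n P \<Longrightarrow> P \<in> carrier_mat n n"
  unfolding frame_def by auto

lemma frame_one: "frame n (1\<^sub>m n)"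
  unfolding frame_def by auto

lemma frame_mult: "frame n P \<Longrightarrow> frame n Q \<Longrightarrow> frame n (P * Q)"
  unfolding frame_def by (auto simp: det_mult)

lemma frame_inverse:
  assumes "frame n (P :: 'k::field mat)"
  obtains Q where "frame n Q" "P * Q = 1\<^sub>m n" "Q * P = 1\<^sub>m n"
proof -
  have P: "P \<in> carrier_mat n n" and d: "det P \<noteq> 0" using assms unfolding frame_def by auto
  define Q where "Q = (1 / det P) \<cdot>\<^sub>m adj_mat P"
  have a: "adj_mat P \<in> carrier_mat n n" "P * adj_mat P = det P \<cdot>\<^sub>m 1\<^sub>m n" "adj_mat P * P = det P \<cdot>\<^sub>m 1\<^sub>m n"
    using adj_mat[OF P] by auto
  have Q: "Q \<in> carrier_mat n n" unfolding Q_def using a by auto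
  have 1: "P * Q = 1\<^sub>m n" unfolding Q_def using mult_smult_distrib[OF P a(1)] a(2) d by auto
  have 2: "Q * P = 1\<^sub>m n" unfolding Q_def using mult_smult_assoc_mat[OF a(1) P] a(3) d by auto
  have "det Q * det P = 1" using det_mult[OF Q P] 2 by simp
  then have "frame n Q" unfolding frame_def using Q by auto
  then show thesis using that 1 2 by auto
qed

lemma mat_mult_vec_index_sum:
  assumes "A \<in> carrier_mat m n" "v \<in> carrier_vec n" "i < m"
  shows "(A *\<^sub>v v) $ i = (\<Sum>j<n. A $$ (i, j) * v $ j)"
  using assms by (auto simp: mult_mat_vec_def scalar_prod_def atLeast0LessThan)

lemma mat_mult_unit_vec:
  assumes "(A :: 'k::field mat) \<in> carrier_mat m n" "j < n"
  shows "A *\<^sub>v unit_vec n j = col A j"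
proof (rule eq_vecI)
  fix i assume "i < dim_vec (col A j)"
  then have i: "i < m" using assms by auto
  show "(A *\<^sub>v unit_vec n j) $ i = col A j $ i"
    unfolding mat_mult_vec_index_sum[OF assms(1) unit_vec_carrier i] using assms i
    by (simp add: unit_vec_def if_distrib sum.delta cong: if_cong)
qed (use assms in auto)

text \<open>Steinitz exchange: some coordinate of \<open>w\<close> beyond the \<open>k\<close>-th does not vanish; the basis vector of
  that coordinate is replaced by the \<open>k\<close>-th one, which in turn makes room for \<open>w\<close>.\<close>

lemma frame_extend_step:
  assumes P: "frame n (P :: 'k::field mat)" and w: "w \<in> carrier_vec n" and out: "w \<notin> mat_image P (coord_space n k)"
  shows "k < n \<and> (\<exists>P'. frame n P' \<and> (\<forall>r<k. col P' r = col P r) \<and> col P' k = w)"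
proof -
  note Pc = frame_carrier[OF P]
  obtain Q where Q: "frame n Q" "P * Q = 1\<^sub>m n" "Q * P = 1\<^sub>m n" using frame_inverse[OF P] .
  define u where "u = Q *\<^sub>v w"
  have uc: "u \<in> carrier_vec n" unfolding u_def using frame_carrier[OF Q(1)] w by auto
  have Pu: "P *\<^sub>v u = w" unfolding u_def
    using assoc_mult_mat_vec[OF Pc frame_carrier[OF Q(1)] w] Q(2) w by auto
  have "u \<notin> coord_space n k" using out Pu by auto
  then obtain r where r: "r < n" "k \<le> r" "u $ r \<noteq> 0" unfolding coord_space_def using uc by auto
  have kn: "k < n" using r by auto
  \<comment> \<open>the identity with column \<open>k\<close> replaced by \<open>u\<close> and column \<open>r\<close> by the \<open>k\<close>-th unit vector; if
    \<open>r = k\<close> there is only one replacement\<close>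
  define T :: "'k mat" where "T = mat n n (\<lambda>(i,j). (if j = k then u $ i else 0) +
     (if j = r then (if r \<noteq> k \<and> i = k then 1 else 0) else 0) +
     (if j = i then (if i \<noteq> k \<and> i \<noteq> r then 1 else 0) else 0))"
  have Tc: "T \<in> carrier_mat n n" unfolding T_def by auto
  have "det T \<noteq> 0"
  proof
    assume "det T = 0"
    then obtain v where v: "v \<in> carrier_vec n" "v \<noteq> 0\<^sub>v n" "T *\<^sub>v v = 0\<^sub>v n"
      using det_0_iff_vec_prod_zero_field[OF Tc] by auto
    have eq: "u $ i * v $ k + (if r \<noteq> k \<and> i = k then v $ r else 0) +
        (if i \<noteq> k \<and> i \<noteq> r then v $ i else 0) = 0" if i: "i < n" for i
    proof -
      have "0 = (T *\<^sub>v v) $ i" using v(3) i by simp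
      also have "\<dots> = (\<Sum>j<n. T $$ (i, j) * v $ j)" by (rule mat_mult_vec_index_sum[OF Tc v(1) i])
      also have "\<dots> = (\<Sum>j<n. (if j = k then u $ i * v $ j else 0) +
          (if j = r then (if r \<noteq> k \<and> i = k then v $ j else 0) else 0) +
          (if j = i then (if i \<noteq> k \<and> i \<noteq> r then v $ j else 0) else 0))"
        using i by (intro sum.cong) (auto simp: T_def distrib_right)
      also have "\<dots> = u $ i * v $ k + (if r \<noteq> k \<and> i = k then v $ r else 0) +
          (if i \<noteq> k \<and> i \<noteq> r then v $ i else 0)"
        using i r kn by (simp only: sum.distrib sum.delta finite_lessThan) auto
      finally show ?thesis by simp
    qed
    have vk: "v $ k = 0" using eq[OF r(1)] r(3) by (auto split: if_splits)
    have "v $ i = 0" if i: "i < n" for i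
      using eq[OF i] eq[OF kn] vk by (cases "i = k"; cases "i = r") auto
    then have "v = 0\<^sub>v n" using v(1) by (intro eq_vecI) auto
    then show False using v(2) by simp
  qed
  then have T: "frame n T" using Tc unfolding frame_def by auto
  have colT: "col (P * T) j = P *\<^sub>v col T j" if "j < n" for j
    using col_mult2[OF Pc Tc that] .
  have "col (P * T) j = col P j" if j: "j < k" for j
  proof -
    have "col T j = unit_vec n j" using j r kn by (intro eq_vecI) (auto simp: T_def)
    then show ?thesis using colT[of j] j kn Pc by (auto simp: mat_mult_unit_vec)
  qed
  moreover have "col T k = u" using kn r uc by (intro eq_vecI) (auto simp: T_def)
  then have "col (P * T) k = w" using colT[OF kn] Pu by simp
  ultimately show ?thesis using kn frame_mult[OF P T] by blast
qed

lemma frame_extend: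
  assumes P: "frame n (P :: 'k::field mat)" and G: "G \<subseteq> carrier_vec n" and k: "k \<le> n"
  shows "\<exists>P' k'. frame n P' \<and> k \<le> k' \<and> k' \<le> n \<and> (\<forall>r<k. col P' r = col P r) \<and>
    (\<forall>r. k \<le> r \<and> r < k' \<longrightarrow> col P' r \<in> G) \<and> G \<subseteq> mat_image P' (coord_space n k')"
  using P k
proof (induction "n - k" arbitrary: k P rule: less_induct)
  case less
  show ?case
  proof (cases "G \<subseteq> mat_image P (coord_space n k)")
    case True
    then show ?thesis using less.prems by (intro exI[of _ P] exI[of _ k]) auto
  next
    case False
    then obtain w where w: "w \<in> G" "w \<notin> mat_image P (coord_space n k)" by auto
    obtain P1 where kn: "k < n" and P1: "frame n P1" "\<forall>r<k. col P1 r = col P r" "col P1 k = w"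
      using frame_extend_step[OF less.prems(1) _ w(2)] G w(1) by auto
    have "n - Suc k < n - k" using kn by auto
    from less.hyps[OF this P1(1)] kn obtain P' k' where
      *: "frame n P'" "Suc k \<le> k'" "k' \<le> n" "\<forall>r<Suc k. col P' r = col P1 r"
        "\<forall>r. Suc k \<le> r \<and> r < k' \<longrightarrow> col P' r \<in> G" "G \<subseteq> mat_image P' (coord_space n k')"
      by auto
    have "col P' r \<in> G" if "k \<le> r" "r < k'" for r
      using *(4,5) P1(3) w(1) that by (cases "r = k") auto
    then show ?thesis using * P1 by (intro exI[of _ P'] exI[of _ k']) auto
  qed
qed

lemma mat_image_coord_cong:
  assumes "P \<in> carrier_mat m n" "P' \<in> carrier_mat m n" "\<forall>r<k. col P' r = col P r" "c \<le> k" "c \<le> n"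
  shows "mat_image P (coord_space n c) = mat_image P' (coord_space n c)"
proof (rule image_cong[OF refl])
  fix v :: "'a vec" assume v: "v \<in> coord_space n c"
  then have vc: "v \<in> carrier_vec n" unfolding coord_space_def by auto
  show "P *\<^sub>v v = P' *\<^sub>v v"
  proof (rule eq_vecI)
    fix i assume "i < dim_vec (P' *\<^sub>v v)"
    then have i: "i < m" using assms by auto
    have "P $$ (i,j) * v $ j = P' $$ (i,j) * v $ j" if j: "j < n" for j
    proof (cases "j < c")
      case True
      then have "col P' j $ i = col P j $ i" using assms by auto
      then show ?thesis using assms i j by auto
    next
      case False
      then show ?thesis using v j unfolding coord_space_def by auto
    qed
    then show "(P *\<^sub>v v) $ i = (P' *\<^sub>v v) $ i"
      unfolding mat_mult_vec_index_sum[OF assms(1) vc i] mat_mult_vec_index_sum[OF assms(2) vc i]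
      by (intro sum.cong) auto
  qed (use assms in auto)
qed

lemma col_in_image_coord:
  assumes "P \<in> carrier_mat m n" "r < k" "r < n"
  shows "col P r \<in> mat_image P (coord_space n k)"
proof -
  have "unit_vec n r \<in> coord_space n k" using assms unfolding coord_space_def by auto
  then show ?thesis using mat_mult_unit_vec[OF assms(1,3)] by (metis imageI)
qed

lemma image_coord_subset:
  assumes P: "P \<in> carrier_mat m n" and k: "k \<le> n" and W: "lin_subspace m W"
    and "\<forall>r<k. col P r \<in> W"
  shows "mat_image P (coord_space n k) \<subseteq> (W :: 'k::field vec set)"
  using k assms(4)
proof (induction k)
  case 0
  have "v = 0\<^sub>v n" if "v \<in> coord_space n 0" for v :: "'k vec"
    using that unfolding coord_space_def by (intro eq_vecI) auto
  moreover have "P *\<^sub>v 0\<^sub>v n = 0\<^sub>v m" using P by (intro eq_vecI) auto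
  ultimately show ?case using lin_subspaceD(2)[OF W] by auto
next
  case (Suc k)
  show ?case
  proof (rule image_subsetI)
    fix v :: "'k vec" assume v: "v \<in> coord_space n (Suc k)"
    define u where "u = vec n (\<lambda>i. if i = k then 0 else v $ i)"
    have u: "u \<in> coord_space n k" using v unfolding coord_space_def u_def by auto
    have uc: "u \<in> carrier_vec n" unfolding u_def by auto
    have v_eq: "v = u + v $ k \<cdot>\<^sub>v unit_vec n k"
      using v Suc.prems unfolding coord_space_def u_def by (intro eq_vecI) auto
    have "P *\<^sub>v v = P *\<^sub>v u + P *\<^sub>v (v $ k \<cdot>\<^sub>v unit_vec n k)"
      by (subst v_eq, rule mult_add_distrib_mat_vec[OF P uc]) auto
    also have "P *\<^sub>v (v $ k \<cdot>\<^sub>v unit_vec n k) = v $ k \<cdot>\<^sub>v col P k"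
      using mult_mat_vec[OF P unit_vec_carrier] mat_mult_unit_vec[OF P] Suc.prems by auto
    finally have e: "P *\<^sub>v v = P *\<^sub>v u + v $ k \<cdot>\<^sub>v col P k" .
    have "P *\<^sub>v u \<in> W" using Suc u by auto
    moreover have "v $ k \<cdot>\<^sub>v col P k \<in> W" using Suc.prems lin_subspaceD(4)[OF W] by auto
    ultimately show "P *\<^sub>v v \<in> W" using e lin_subspaceD(3)[OF W] by auto
  qed
qed

lemma coord_space_full: "coord_space n n = carrier_vec n"
  unfolding coord_space_def by auto

lemma coord_space_zero: "coord_space n 0 = {0\<^sub>v n}"
  unfolding coord_space_def by (auto intro!: eq_vecI)

lemma coord_space_mono: "c \<le> c' \<Longrightarrow> coord_space n c \<subseteq> coord_space n c'"
  unfolding coord_space_def by auto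

lemma frame_image_full:
  assumes P: "frame n (P :: 'k::field mat)"
  shows "mat_image P (carrier_vec n) = carrier_vec n"
proof -
  obtain Q where Q: "frame n Q" "P * Q = 1\<^sub>m n" using frame_inverse[OF P] .
  note c = frame_carrier[OF P] frame_carrier[OF Q(1)]
  have "v = P *\<^sub>v (Q *\<^sub>v v)" if "v \<in> carrier_vec n" for v
    using assoc_mult_mat_vec[OF c that] Q(2) that by auto
  then show ?thesis using c by (auto intro!: image_eqI mult_mat_vec_carrier[of Q n n])
qed

text \<open>The columns of an invertible matrix are linearly independent, so the first \<open>k\<close> of them form a
  basis of the span.  All other facts on dimensions are derived from this one through frames.\<close>

lemma ldim_frame:
  assumes P: "frame n (P :: 'k::field mat)" and k: "k \<le> n"
  shows "ldim n (mat_image P (coord_space n k)) = k"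
proof -
  interpret vec_space "TYPE('k)" n .
  note Pc = frame_carrier[OF P]
  define W where "W = mat_image P (coord_space n k)"
  define B where "B = (\<lambda>r. col P r) ` {..<k}"
  have det: "det P \<noteq> 0" using P unfolding frame_def by auto
  have inj: "inj_on (\<lambda>r. col P r) {..<k}"
  proof (rule inj_onI, rule ccontr)
    fix r s assume rs: "r \<in> {..<k}" "s \<in> {..<k}" "col P r = col P s" "r \<noteq> s"
    have "det P = 0" by (rule det_identical_columns[OF Pc, of r s]) (use rs k in auto)
    then show False using det by simp
  qed
  have Bsub: "B \<subseteq> set (cols P)" unfolding B_def using k Pc by (auto simp: cols_def)
  have "lin_indpt (set (cols P))" using lin_dep_cols_imp_det_0[OF Pc] det by auto
  then have li: "lin_indpt B" using Bsub supset_ld_is_ld by blast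
  have Bc: "B \<subseteq> carrier_vec n" unfolding B_def using Pc by auto
  have fin: "finite B" unfolding B_def by auto
  have W: "lin_subspace n W" unfolding W_def by (rule lin_subspace_image[OF Pc lin_subspace_coord])
  have "span B = W"
  proof
    show "span B \<subseteq> W"
    proof (rule span_is_subset)
      show "B \<subseteq> W" unfolding B_def W_def using col_in_image_coord[OF Pc] k by auto
      show "LinearCombinations.submodule class_ring W V"
        unfolding LinearCombinations.submodule_def using W by (auto simp: lin_subspace_def module_vec_simps vec_module)
    qed
    have "LinearCombinations.submodule class_ring (span B) V" using span_is_submodule Bc by simp
    then have "lin_subspace n (span B)"
      unfolding LinearCombinations.submodule_def lin_subspace_def by (auto simp: module_vec_simps)
    moreover have "\<forall>r<k. col P r \<in> span B" using in_own_span[of B] Bc unfolding B_def by auto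
    ultimately show "W \<subseteq> span B" unfolding W_def using image_coord_subset[OF Pc k] by auto
  qed
  moreover have "vectorspace.dim class_ring (span_vs B) = card B"
  proof -
    have sub: "LinearCombinations.submodule class_ring (span B) V" using span_is_submodule Bc by simp
    have vs: "vectorspace class_ring (span_vs B)"
      unfolding vectorspace_def using submodule_is_module[OF sub] class_field by blast
    have Bs: "B \<subseteq> span B" using in_own_span Bc by simp
    have "vectorspace.basis class_ring (span_vs B) B"
      unfolding vectorspace.basis_def[OF vs]
      using span_li_not_depend[OF Bs sub] li Bs by simp
    then show ?thesis using vectorspace.dim_basis[OF vs fin] by simp
  qed
  moreover have "card B = k" unfolding B_def using card_image[OF inj] by simp
  ultimately show ?thesis unfolding ldim_def W_def[symmetric] by simp
qed

lemma subspace_frame: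
  assumes W: "lin_subspace n (W :: 'k::field vec set)"
  obtains P where "frame n P" "ldim n W \<le> n" "W = mat_image P (coord_space n (ldim n W))"
proof -
  have Wc: "W \<subseteq> carrier_vec n" using lin_subspaceD(1)[OF W] .
  obtain P k where P: "frame n P" "k \<le> n" "\<forall>r<k. col P r \<in> W" "W \<subseteq> mat_image P (coord_space n k)"
    using frame_extend[OF frame_one Wc, of 0] by auto
  have "W = mat_image P (coord_space n k)"
    using image_coord_subset[OF frame_carrier[OF P(1)] P(2) W P(3)] P(4) by auto
  moreover have "ldim n W = k" using ldim_frame[OF P(1,2)] calculation by simp
  ultimately show thesis using that P by auto
qed

lemma subspace_pair_frame:
  assumes U: "frame n (P :: 'k::field mat)" "k \<le> n" "mat_image P (coord_space n k) \<subseteq> W"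
    and W: "lin_subspace n W"
  obtains P' where "frame n P'" "k \<le> ldim n W" "W = mat_image P' (coord_space n (ldim n W))"
    "\<forall>r<k. col P' r = col P r"
proof -
  have Wc: "W \<subseteq> carrier_vec n" using lin_subspaceD(1)[OF W] .
  obtain P' k' where P': "frame n P'" "k \<le> k'" "k' \<le> n" "\<forall>r<k. col P' r = col P r"
    "\<forall>r. k \<le> r \<and> r < k' \<longrightarrow> col P' r \<in> W" "W \<subseteq> mat_image P' (coord_space n k')"
    using frame_extend[OF U(1) Wc U(2)] by auto
  have "col P' r \<in> W" if "r < k'" for r
  proof (cases "r < k")
    case True
    then show ?thesis using P'(4) U(2,3) col_in_image_coord[OF frame_carrier[OF U(1)], of r k] by auto
  qed (use P'(5) that in auto)
  then have "W = mat_image P' (coord_space n k')"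
    using image_coord_subset[OF frame_carrier[OF P'(1)] P'(3) W] P'(6) by auto
  moreover have "ldim n W = k'" using ldim_frame[OF P'(1,3)] calculation by simp
  ultimately show thesis using that P' by auto
qed

lemma ldim_mono:
  assumes "lin_subspace n U" "lin_subspace n W" "U \<subseteq> W"
  shows "ldim n U \<le> ldim n W"
proof -
  obtain P where P: "frame n P" "ldim n U \<le> n" "U = mat_image P (coord_space n (ldim n U))"
    using subspace_frame[OF assms(1)] .
  have "mat_image P (coord_space n (ldim n U)) \<subseteq> W" using P(3) assms(3) by simp
  from subspace_pair_frame[OF P(1,2) this assms(2)] show ?thesis by metis
qed

lemma ldim_le: "lin_subspace n W \<Longrightarrow> ldim n W \<le> n"
  using subspace_frame by metis

lemma ldim_eq_imp_eq:
  assumes "lin_subspace n U" "lin_subspace n W" "U \<subseteq> W" "ldim n W \<le> ldim n U"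
  shows "U = W"
proof -
  obtain P where P: "frame n P" "ldim n U \<le> n" "U = mat_image P (coord_space n (ldim n U))"
    using subspace_frame[OF assms(1)] .
  have s: "mat_image P (coord_space n (ldim n U)) \<subseteq> W" using P(3) assms(3) by simp
  obtain P' where P': "frame n P'" "ldim n U \<le> ldim n W" "W = mat_image P' (coord_space n (ldim n W))"
      "\<forall>r<ldim n U. col P' r = col P r"
    using subspace_pair_frame[OF P(1,2) s assms(2)] .
  have e: "ldim n W = ldim n U" using assms(4) P'(2) by simp
  show ?thesis
    using mat_image_coord_cong[OF frame_carrier[OF P(1)] frame_carrier[OF P'(1)] P'(4) order_refl P(2)]
      P(3) P'(3) unfolding e by metis
qed

lemma ldim_carrier: "ldim n (carrier_vec n :: 'k::field vec set) = n"
proof -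
  have "mat_image (1\<^sub>m n) (carrier_vec n :: 'k vec set) = carrier_vec n"
    using frame_image_full[OF frame_one] .
  then show ?thesis using ldim_frame[where 'k = 'k, OF frame_one order_refl, of n] unfolding coord_space_full by simp
qed

lemma ldim_zero: "ldim n {0\<^sub>v n :: 'k::field vec} = 0"
proof -
  have "mat_image (1\<^sub>m n) (coord_space n 0 :: 'k vec set) = {0\<^sub>v n}"
    unfolding coord_space_zero by simp
  then show ?thesis using ldim_frame[where 'k = 'k, OF frame_one, of 0 n] by simp
qed

lemma mat_image_mult:
  assumes "A \<in> carrier_mat m n" "B \<in> carrier_mat n k" "W \<subseteq> carrier_vec k"
  shows "mat_image (A * B) W = mat_image A (mat_image B W)"
  using assms assoc_mult_mat_vec[OF assms(1,2)] by (force simp: image_image intro!: image_cong)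

lemma ldim_frame_image:
  assumes P: "frame n P" and W: "lin_subspace n W"
  shows "ldim n (mat_image P W) = ldim n W"
proof -
  obtain R where R: "frame n R" "ldim n W \<le> n" "W = mat_image R (coord_space n (ldim n W))"
    using subspace_frame[OF W] .
  have "mat_image P W = mat_image (P * R) (coord_space n (ldim n W))"
    using mat_image_mult[OF frame_carrier[OF P] frame_carrier[OF R(1)]] R(3)
      lin_subspaceD(1)[OF lin_subspace_coord] by metis
  then show ?thesis using ldim_frame[OF frame_mult[OF P R(1)] R(2)] by simp
qed

lemma increasing_chain_frame:
  assumes "\<And>l. l \<le> m \<Longrightarrow> lin_subspace n (U l :: 'k::field vec set)" "\<And>l. l < m \<Longrightarrow> U l \<subseteq> U (Suc l)"
  shows "\<exists>P. frame n P \<and> (\<forall>l\<le>m. U l = mat_image P (coord_space n (ldim n (U l))))"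
  using assms
proof (induction m)
  case 0
  then show ?case using subspace_frame[of n "U 0"] by (metis le_zero_eq order_refl)
next
  case (Suc m)
  then obtain P where P: "frame n P" "\<forall>l\<le>m. U l = mat_image P (coord_space n (ldim n (U l)))"
    by auto
  have le: "ldim n (U m) \<le> n" by (rule ldim_le[OF Suc.prems(1)]) simp
  have "mat_image P (coord_space n (ldim n (U m))) \<subseteq> U (Suc m)" using P(2) Suc.prems(2) by auto
  from subspace_pair_frame[OF P(1) le this Suc.prems(1)[OF order_refl]] obtain P' where
    P': "frame n P'" "U (Suc m) = mat_image P' (coord_space n (ldim n (U (Suc m))))"
    "\<forall>r<ldim n (U m). col P' r = col P r" by metis
  have "U l = mat_image P' (coord_space n (ldim n (U l)))" if "l \<le> m" for l
  proof -
    have "U l \<subseteq> U m"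
      using that
    proof (induction rule: inc_induct)
      case (step i)
      then show ?case using Suc.prems(2)[of i] by auto
    qed simp
    then have "ldim n (U l) \<le> ldim n (U m)"
      by (intro ldim_mono Suc.prems(1)) (use that in auto)
    then show ?thesis
      using mat_image_coord_cong[OF frame_carrier[OF P(1)] frame_carrier[OF P'(1)] P'(3), of "ldim n (U l)"]
        P(2) that ldim_le[OF Suc.prems(1), of l] by (metis le_SucI)
  qed
  then show ?case using P' by (intro exI[of _ P']) (auto simp: le_Suc_eq)
qed

lemma chain_frame:
  assumes "\<And>l. l \<le> m \<Longrightarrow> lin_subspace n (W l :: 'k::field vec set)" "\<And>l. l < m \<Longrightarrow> W (Suc l) \<subseteq> W l"
  obtains P where "frame n P" "\<And>l. l \<le> m \<Longrightarrow> W l = mat_image P (coord_space n (ldim n (W l)))"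
proof -
  have "\<exists>P. frame n P \<and> (\<forall>l\<le>m. W (m - l) = mat_image P (coord_space n (ldim n (W (m - l)))))"
  proof (rule increasing_chain_frame)
    fix l assume "l < m"
    then have "W (Suc (m - Suc l)) \<subseteq> W (m - Suc l)" by (intro assms(2)) auto
    then show "W (m - l) \<subseteq> W (m - Suc l)" using \<open>l < m\<close> by (simp add: Suc_diff_Suc)
  qed (use assms(1) in auto)
  then obtain P where P: "frame n P" "\<And>l. l \<le> m \<Longrightarrow> W (m - l) = mat_image P (coord_space n (ldim n (W (m - l))))"
    by auto
  have "W l = mat_image P (coord_space n (ldim n (W l)))" if "l \<le> m" for l
    using P(2)[of "m - l"] that by simp
  then show thesis using that P(1) by blast
qed

text \<open>In frames adapted to the two chains both become chains of coordinate subspaces, where inclusion is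
  a comparison of dimensions; so the change of frames does it.  For equal dimensions it is an
  isomorphism of the chains.\<close>

lemma chain_embedding:
  assumes A: "\<And>l. l \<le> m \<Longrightarrow> lin_subspace n (A l :: 'k::field vec set)" "\<And>l. l < m \<Longrightarrow> A (Suc l) \<subseteq> A l"
    and B: "\<And>l. l \<le> m \<Longrightarrow> lin_subspace n (B l :: 'k::field vec set)" "\<And>l. l < m \<Longrightarrow> B (Suc l) \<subseteq> B l"
    and le: "\<And>l. l \<le> m \<Longrightarrow> ldim n (A l) \<le> ldim n (B l)"
  obtains T where "frame n T" "\<And>l. l \<le> m \<Longrightarrow> mat_image T (A l) \<subseteq> B l"
proof -
  obtain P where P: "frame n P" "\<And>l. l \<le> m \<Longrightarrow> A l = mat_image P (coord_space n (ldim n (A l)))"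
    using chain_frame[of m n A] A by blast
  obtain R where R: "frame n R" "\<And>l. l \<le> m \<Longrightarrow> B l = mat_image R (coord_space n (ldim n (B l)))"
    using chain_frame[of m n B] B by blast
  obtain Q where Q: "frame n Q" "P * Q = 1\<^sub>m n" "Q * P = 1\<^sub>m n" using frame_inverse[OF P(1)] .
  note c = frame_carrier[OF P(1)] frame_carrier[OF R(1)] frame_carrier[OF Q(1)]
  have "mat_image (R * Q) (A l) \<subseteq> B l" if l: "l \<le> m" for l
  proof -
    have cc: "coord_space n (ldim n (A l)) \<subseteq> (carrier_vec n :: 'k vec set)"
      unfolding coord_space_def by auto
    have "mat_image (R * Q) (A l) = mat_image (R * Q) (mat_image P (coord_space n (ldim n (A l))))"
      using P(2)[OF l] by simp
    also have "\<dots> = mat_image (R * Q * P) (coord_space n (ldim n (A l)))"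
      using mat_image_mult[OF mult_carrier_mat[OF c(2,3)] c(1) cc] by simp
    also have "R * Q * P = R" using assoc_mult_mat[OF c(2,3,1)] Q(3) c by simp
    also have "mat_image R (coord_space n (ldim n (A l))) \<subseteq> mat_image R (coord_space n (ldim n (B l)))"
      using coord_space_mono[OF le[OF l]] by (rule image_mono)
    finally show ?thesis using R(2)[OF l] by simp
  qed
  then show thesis using that frame_mult[OF R(1) Q(1)] by blast
qed

lemma lspan_frame:
  assumes G: "G \<subseteq> carrier_vec n"
  obtains P k where "frame n P" "k \<le> n" "\<forall>r<k. col P r \<in> G"
    "(G :: 'k::field vec set) \<subseteq> mat_image P (coord_space n k)" "ldim n (lspan n G) = k"
proof -
  obtain P k where P: "frame n P" "k \<le> n" "\<forall>r<k. col P r \<in> G" "G \<subseteq> mat_image P (coord_space n k)"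
    using frame_extend[OF frame_one G, of 0] by auto
  note Pc = frame_carrier[OF P(1)]
  have ls: "lspan n G = mat_image P (coord_space n k)"
  proof
    show "lspan n G \<subseteq> mat_image P (coord_space n k)"
      by (rule lspan_least[OF lin_subspace_image[OF Pc lin_subspace_coord] P(4)])
    show "mat_image P (coord_space n k) \<subseteq> lspan n G"
      by (rule image_coord_subset[OF Pc P(2) lspan_subspace[OF G]]) (use P(3) lspan_superset in blast)
  qed
  have dim: "ldim n (lspan n G) = k" unfolding ls by (rule ldim_frame[OF P(1,2)])
  show thesis using that P dim by blast
qed

text \<open>The point of the right hand side is that \<open>B\<close> is constant: if the members of \<open>G\<close> depend polynomially
  on parameters, it expresses a lower bound on the dimension by the nonvanishing of some polynomial
  out of a fixed family.\<close>

lemma ldim_lspan_ge_iff: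
  assumes G: "G \<subseteq> carrier_vec n"
  shows "c \<le> ldim n (lspan n (G :: 'k::field vec set)) \<longleftrightarrow>
    (\<exists>w B. (\<forall>r<c. w r \<in> G) \<and> B \<in> carrier_mat c n \<and> det (B * mat n c (\<lambda>(i, j). w j $ i)) \<noteq> 0)"
proof
  obtain P k where P: "frame n P" "k \<le> n" "\<forall>r<k. col P r \<in> G" "G \<subseteq> mat_image P (coord_space n k)"
    and dim: "ldim n (lspan n G) = k"
    using lspan_frame[OF G] .
  note Pc = frame_carrier[OF P(1)]
  obtain Q where Q: "frame n Q" "P * Q = 1\<^sub>m n" "Q * P = 1\<^sub>m n" using frame_inverse[OF P(1)] .
  note Qc = frame_carrier[OF Q(1)]
  {
    assume "c \<le> ldim n (lspan n G)"
    then have ck: "c \<le> k" unfolding dim .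
    define B where "B = mat c n (\<lambda>(i, j). Q $$ (i, j))"
    define X where "X = mat n c (\<lambda>(i, j). col P j $ i)"
    have BX: "B * X = 1\<^sub>m c"
    proof (rule eq_matI)
      fix i j assume "i < dim_row (1\<^sub>m c :: 'k mat)" "j < dim_col (1\<^sub>m c :: 'k mat)"
      then have ij: "i < c" "j < c" by auto
      have "(B * X) $$ (i, j) = (Q * P) $$ (i, j)"
        using ij ck P(2) Pc Qc unfolding B_def X_def
        by (auto simp: scalar_prod_def intro!: sum.cong)
      then show "(B * X) $$ (i, j) = 1\<^sub>m c $$ (i, j)" using Q(3) ij ck P(2) by auto
    qed (auto simp: B_def X_def)
    show "\<exists>w B. (\<forall>r<c. w r \<in> G) \<and> B \<in> carrier_mat c n \<and> det (B * mat n c (\<lambda>(i, j). w j $ i)) \<noteq> 0"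
      by (intro exI[of _ "\<lambda>r. col P r"] exI[of _ B])
        (use P(3) ck BX in \<open>auto simp: X_def B_def\<close>)
  next
    assume "\<exists>w B. (\<forall>r<c. w r \<in> G) \<and> B \<in> carrier_mat c n \<and> det (B * mat n c (\<lambda>(i, j). w j $ i)) \<noteq> 0"
    then obtain w B where w: "\<forall>r<c. w r \<in> G" and B: "B \<in> carrier_mat c n"
      and d: "det (B * mat n c (\<lambda>(i, j). w j $ i)) \<noteq> 0" by auto
    define X where "X = mat n c (\<lambda>(i, j). w j $ i)"
    have Xc: "X \<in> carrier_mat n c" unfolding X_def by auto
    show "c \<le> ldim n (lspan n G)"
    proof (rule ccontr)
      assume "\<not> c \<le> ldim n (lspan n G)"
      then have kc: "k < c" unfolding dim by simp
      define Y where "Y = Q * X"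
      have Yc: "Y \<in> carrier_mat n c" unfolding Y_def using Qc Xc by auto
      have Y0: "Y $$ (i, j) = 0" if ij: "k \<le> i" "i < n" "j < c" for i j
      proof -
        have colX: "col X j = w j" using w ij G unfolding X_def by (intro eq_vecI) auto
        obtain v where v: "v \<in> coord_space n k" "w j = P *\<^sub>v v" using w P(4) ij(3) by (metis imageE subsetD)
        have vc: "v \<in> carrier_vec n" using v unfolding coord_space_def by auto
        have "col Y j = Q *\<^sub>v (P *\<^sub>v v)" unfolding Y_def col_mult2[OF Qc Xc ij(3)] colX v(2) ..
        also have "\<dots> = v" using assoc_mult_mat_vec[OF Qc Pc vc] Q(3) vc by simp
        finally have "col Y j $ i = 0" using v(1) ij unfolding coord_space_def by auto
        then show ?thesis using Yc ij by auto
      qed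
      have XPY: "X = P * Y" unfolding Y_def using assoc_mult_mat[OF Pc Qc Xc] Q(2) Xc by simp
      define C where "C = B * P"
      have Cc: "C \<in> carrier_mat c n" unfolding C_def using B Pc by auto
      define C' where "C' = mat c c (\<lambda>(i, j). if j < k then C $$ (i, j) else 0)"
      define Y' where "Y' = mat c c (\<lambda>(i, j). if i < k then Y $$ (i, j) else 0)"
      have "B * X = C' * Y'"
      proof (rule eq_matI)
        fix i j assume "i < dim_row (C' * Y')" "j < dim_col (C' * Y')"
        then have ij: "i < c" "j < c" unfolding C'_def Y'_def by auto
        have "B * X = C * Y" unfolding XPY C_def using assoc_mult_mat[OF B Pc Yc] by simp
        then have "(B * X) $$ (i, j) = (\<Sum>s\<in>{0..<n}. C $$ (i, s) * Y $$ (s, j))"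
          using ij Cc Yc by (auto simp: scalar_prod_def)
        also have "\<dots> = (\<Sum>s\<in>{0..<k}. C $$ (i, s) * Y $$ (s, j))"
          using P(2) Y0 ij by (intro sum.mono_neutral_right) auto
        also have "\<dots> = (\<Sum>s\<in>{0..<c}. C' $$ (i, s) * Y' $$ (s, j))"
          unfolding C'_def Y'_def using kc ij by (intro sum.mono_neutral_cong_left) auto
        also have "\<dots> = (C' * Y') $$ (i, j)" 
          using ij by (auto simp: scalar_prod_def C'_def Y'_def)
        finally show "(B * X) $$ (i, j) = (C' * Y') $$ (i, j)" .
      qed (use B Xc in \<open>auto simp: C'_def Y'_def\<close>)
      moreover have "det Y' = 0"
      proof -
        have c: "Y'\<^sup>T \<in> carrier_mat c c" unfolding Y'_def by auto
        have "Y'\<^sup>T *\<^sub>v unit_vec c k = 0\<^sub>v c"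
          unfolding mat_mult_unit_vec[OF c kc] using kc by (intro eq_vecI) (auto simp: Y'_def)
        then have "det Y'\<^sup>T = 0"
          using det_0_iff_vec_prod_zero_field[OF c] unit_vec_nonzero[OF kc] by (metis unit_vec_carrier)
        then show ?thesis using det_transpose[of Y' c] unfolding Y'_def by auto
      qed
      moreover have "det (C' * Y') = det C' * det Y'"
        by (rule det_mult[of _ c]) (auto simp: C'_def Y'_def)
      ultimately show False using d unfolding X_def[symmetric] by simp
    qed
  }
qed

definition annihilator :: "nat \<Rightarrow> 'k::field vec set \<Rightarrow> 'k vec set" where
  "annihilator n G = {v \<in> carrier_vec n. \<forall>g\<in>G. g \<bullet> v = 0}"

text \<open>If the first \<open>k\<close> columns of the frame \<open>P\<close> are elements of \<open>G\<close> spanning it, the annihilator consists of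
  the \<open>v\<close> for which the first \<open>k\<close> coordinates of \<open>P\<^sup>T v\<close> vanish.\<close>

lemma ldim_annihilator:
  assumes G: "G \<subseteq> carrier_vec n"
  shows "ldim n (annihilator n (G :: 'k::field vec set)) = n - ldim n (lspan n G)"
proof -
  obtain P k where P: "frame n P" "k \<le> n" "\<forall>r<k. col P r \<in> G" "G \<subseteq> mat_image P (coord_space n k)"
    and dim: "ldim n (lspan n G) = k"
    using lspan_frame[OF G] .
  note Pc = frame_carrier[OF P(1)]
  have PT: "frame n P\<^sup>T" using P(1) det_transpose[OF Pc] unfolding frame_def by auto
  obtain Q where Q: "frame n Q" "P\<^sup>T * Q = 1\<^sub>m n" "Q * P\<^sup>T = 1\<^sub>m n" using frame_inverse[OF PT] .
  note c = frame_carrier[OF PT] frame_carrier[OF Q(1)]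
  \<comment> \<open>reversal of the coordinates, which moves the vanishing coordinates to the end\<close>
  define J :: "'k mat" where "J = mat n n (\<lambda>(i, j). if i + j = n - 1 then 1 else 0)"
  have Jc: "J \<in> carrier_mat n n" unfolding J_def by auto
  have Jv: "(J *\<^sub>v v) $ i = v $ (n - 1 - i)" if "v \<in> carrier_vec n" "i < n" for v :: "'k vec" and i
  proof -
    have "(J *\<^sub>v v) $ i = (\<Sum>j<n. if j = n - 1 - i then v $ j else 0)"
      unfolding mat_mult_vec_index_sum[OF Jc that] using that by (intro sum.cong) (auto simp: J_def)
    then show ?thesis using that by (simp add: sum.delta)
  qed
  have JJ: "J *\<^sub>v (J *\<^sub>v v) = v" if v: "v \<in> carrier_vec n" for v :: "'k vec"
  proof (rule eq_vecI)
    fix i assume "i < dim_vec v"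
    then have i: "i < n" using v by auto
    have "(J *\<^sub>v (J *\<^sub>v v)) $ i = (J *\<^sub>v v) $ (n - 1 - i)" using Jv[of "J *\<^sub>v v" i] Jc v i by auto
    also have "\<dots> = v $ i" using Jv[OF v, of "n - 1 - i"] i by auto
    finally show "(J *\<^sub>v (J *\<^sub>v v)) $ i = v $ i" .
  qed (use Jc v in auto)
  have J: "frame n J"
    unfolding frame_def
  proof (intro conjI notI Jc)
    assume "det J = 0"
    then obtain v where v: "v \<in> carrier_vec n" "v \<noteq> 0\<^sub>v n" "J *\<^sub>v v = 0\<^sub>v n"
      using det_0_iff_vec_prod_zero_field[OF Jc] by auto
    have "v = J *\<^sub>v 0\<^sub>v n" using JJ[OF v(1)] v(3) by simp
    also have "\<dots> = 0\<^sub>v n" using Jc by (intro eq_vecI) auto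
    finally show False using v(2) by simp
  qed
  have "annihilator n G = mat_image Q (mat_image J (coord_space n (n - k)))"
  proof (rule Set.set_eqI)
    fix v :: "'k vec"
    have rev: "mat_image J (coord_space n (n - k)) = {u \<in> carrier_vec n. \<forall>r<k. u $ r = 0}"
    proof (rule Set.set_eqI, rule iffI)
      fix u :: "'k vec" assume "u \<in> mat_image J (coord_space n (n - k))"
      then show "u \<in> {u \<in> carrier_vec n. \<forall>r<k. u $ r = 0}"
        using Jc Jv P(2) unfolding coord_space_def by auto
    next
      fix u :: "'k vec" assume u: "u \<in> {u \<in> carrier_vec n. \<forall>r<k. u $ r = 0}"
      then have "J *\<^sub>v u \<in> coord_space n (n - k)"
        using Jc Jv P(2) unfolding coord_space_def by auto
      then show "u \<in> mat_image J (coord_space n (n - k))" using JJ[of u] u by (metis (lifting) imageI mem_Collect_eq)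
    qed
    have "v \<in> annihilator n G \<longleftrightarrow> v \<in> carrier_vec n \<and> (\<forall>r<k. col P r \<bullet> v = 0)"
    proof
      assume "v \<in> annihilator n G"
      then show "v \<in> carrier_vec n \<and> (\<forall>r<k. col P r \<bullet> v = 0)" using P(3) unfolding annihilator_def by auto
    next
      assume v: "v \<in> carrier_vec n \<and> (\<forall>r<k. col P r \<bullet> v = 0)"
      have "lin_subspace n {g \<in> carrier_vec n. g \<bullet> v = 0}"
        unfolding lin_subspace_def using v by (auto simp: add_scalar_prod_distrib[of _ n])
      moreover have "\<forall>r<k. col P r \<in> {g \<in> carrier_vec n. g \<bullet> v = 0}" using v Pc by auto
      ultimately have "mat_image P (coord_space n k) \<subseteq> {g \<in> carrier_vec n. g \<bullet> v = 0}"
        by (rule image_coord_subset[OF Pc P(2)])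
      then have "G \<subseteq> {g \<in> carrier_vec n. g \<bullet> v = 0}" using P(4) by (rule subset_trans[rotated])
      then show "v \<in> annihilator n G" using v unfolding annihilator_def by blast
    qed
    also have "\<dots> \<longleftrightarrow> v \<in> carrier_vec n \<and> P\<^sup>T *\<^sub>v v \<in> {u \<in> carrier_vec n. \<forall>r<k. u $ r = 0}"
      using Pc P(2) by auto
    also have "\<dots> \<longleftrightarrow> v \<in> mat_image Q {u \<in> carrier_vec n. \<forall>r<k. u $ r = 0}"
    proof
      assume v: "v \<in> carrier_vec n \<and> P\<^sup>T *\<^sub>v v \<in> {u \<in> carrier_vec n. \<forall>r<k. u $ r = 0}"
      have "v = Q *\<^sub>v (P\<^sup>T *\<^sub>v v)" using assoc_mult_mat_vec[OF c(2,1), of v] Q(3) v by simp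
      then show "v \<in> mat_image Q {u \<in> carrier_vec n. \<forall>r<k. u $ r = 0}" using v by blast
    next
      assume "v \<in> mat_image Q {u \<in> carrier_vec n. \<forall>r<k. u $ r = 0}"
      then obtain u where u: "u \<in> carrier_vec n" "\<forall>r<k. u $ r = 0" "v = Q *\<^sub>v u" by auto
      have "P\<^sup>T *\<^sub>v v = u" unfolding u(3) using assoc_mult_mat_vec[OF c(1,2) u(1)] Q(2) u(1) by simp
      then show "v \<in> carrier_vec n \<and> P\<^sup>T *\<^sub>v v \<in> {u \<in> carrier_vec n. \<forall>r<k. u $ r = 0}"
        using u c by auto
    qed
    finally show "v \<in> annihilator n G \<longleftrightarrow> v \<in> mat_image Q (mat_image J (coord_space n (n - k)))"
      unfolding rev .
  qed
  then show ?thesis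
    using ldim_frame_image[OF Q(1) lin_subspace_image[OF Jc lin_subspace_coord]]
      ldim_frame[OF J, of "n - k"] dim by simp
qed

section \<open>The truncated path algebra and its radical\<close>

context fin_digraph
begin

lemma quiver_paths_iff: "(u, p) \<in> quiver_paths G \<longleftrightarrow> awalk u p (path_end G (u, p))"
  unfolding quiver_paths_def by auto

lemma path_end_eq: "path_end G (u, p) = (if p = [] then u else head G (last p))"
  by (simp add: awalk_verts_conv)

lemma quiver_paths_append:
  "(u, p @ q) \<in> quiver_paths G \<longleftrightarrow> (u, p) \<in> quiver_paths G \<and> (path_end G (u, p), q) \<in> quiver_paths G"
  unfolding quiver_paths_iff by (simp add: awlast_append)

lemma path_end_append: "path_end G (u, p @ q) = path_end G (path_end G (u, p), q)"
  by (simp add: awlast_append)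

lemma quiver_paths_Nil: "(u, []) \<in> quiver_paths G \<longleftrightarrow> u \<in> verts G"
  unfolding quiver_paths_iff by (simp add: awalk_def)

lemma quiver_paths_snoc:
  "(u, p @ [a]) \<in> quiver_paths G \<longleftrightarrow> (u, p) \<in> quiver_paths G \<and> a \<in> arcs G \<and> tail G a = path_end G (u, p)"
  unfolding quiver_paths_iff by (auto simp: awalk_def awlast_append intro: awlast_in_verts)

lemma quiver_paths_Cons:
  "(u, a # p) \<in> quiver_paths G \<longleftrightarrow> a \<in> arcs G \<and> tail G a = u \<and> (head G a, p) \<in> quiver_paths G"
  unfolding quiver_paths_iff by (auto simp: awalk_def intro: awlast_in_verts)

lemma quiver_pathsD:
  assumes "(u, p) \<in> quiver_paths G"
  shows "u \<in> verts G" "set p \<subseteq> arcs G" "path_end G (u, p) \<in> verts G"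
  using assms unfolding quiver_paths_iff by (auto simp: awalk_def intro: awlast_in_verts)

abbreviation PA :: "(('a, 'b) qpath \<Rightarrow> 'k::field) ring" where "PA \<equiv> path_algebra G"

definition single_path :: "('a, 'b) qpath \<Rightarrow> 'k \<Rightarrow> ('a, 'b) qpath \<Rightarrow> 'k::field" where
  "single_path p c = (\<lambda>q. if q = p then c else 0)"

lemma PA_carrier: "f \<in> carrier PA \<longleftrightarrow> finite {p. f p \<noteq> 0} \<and> {p. f p \<noteq> 0} \<subseteq> quiver_paths G"
  unfolding path_algebra_def by simp

lemma PA_mult: "(f \<otimes>\<^bsub>PA\<^esub> g) (u, p) =
    (\<Sum>k\<le>length p. f (path_end G (u, take k p), drop k p) * g (u, take k p))"
  unfolding path_algebra_def by simp

lemma PA_add: "f \<oplus>\<^bsub>PA\<^esub> g = (\<lambda>p. f p + g p)"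
  unfolding path_algebra_def by simp

lemma PA_zero: "\<zero>\<^bsub>PA\<^esub> = (\<lambda>_. 0)"
  unfolding path_algebra_def by simp

lemma PA_one: "\<one>\<^bsub>PA\<^esub> = (\<lambda>(u, p). if u \<in> verts G \<and> p = [] then 1 else 0)"
  unfolding path_algebra_def by simp

lemma PA_mult_support:
  assumes "(f \<otimes>\<^bsub>PA\<^esub> g) (u, p) \<noteq> 0"
  obtains q r where "p = q @ r" "f (path_end G (u, q), r) \<noteq> 0" "g (u, q) \<noteq> 0"
proof -
  obtain k where "k \<le> length p" "f (path_end G (u, take k p), drop k p) * g (u, take k p) \<noteq> 0"
    using assms unfolding PA_mult by (meson sum.not_neutral_contains_not_neutral atMost_iff)
  then show thesis using that[of "take k p" "drop k p"] by auto
qed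

lemma PA_mult_closed:
  assumes f: "f \<in> carrier PA" and g: "g \<in> carrier PA"
  shows "f \<otimes>\<^bsub>PA\<^esub> g \<in> carrier PA"
proof -
  have "{p. (f \<otimes>\<^bsub>PA\<^esub> g) p \<noteq> 0} \<subseteq> (\<lambda>((v, r), (u, q)). (u, q @ r)) ` ({p. f p \<noteq> 0} \<times> {p. g p \<noteq> 0})"
  proof
    fix x assume x: "x \<in> {p. (f \<otimes>\<^bsub>PA\<^esub> g) p \<noteq> 0}"
    obtain u p where [simp]: "x = (u, p)" by force
    obtain q r where "p = q @ r" "f (path_end G (u, q), r) \<noteq> 0" "g (u, q) \<noteq> 0"
      using PA_mult_support[of f g u p] x by auto
    then show "x \<in> (\<lambda>((v, r), (u, q)). (u, q @ r)) ` ({p. f p \<noteq> 0} \<times> {p. g p \<noteq> 0})"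
      by (intro image_eqI[of _ _ "((path_end G (u, q), r), (u, q))"]) auto
  qed
  moreover have "{p. (f \<otimes>\<^bsub>PA\<^esub> g) p \<noteq> 0} \<subseteq> quiver_paths G"
  proof
    fix x assume x: "x \<in> {p. (f \<otimes>\<^bsub>PA\<^esub> g) p \<noteq> 0}"
    obtain u p where [simp]: "x = (u, p)" by force
    obtain q r where "p = q @ r" "f (path_end G (u, q), r) \<noteq> 0" "g (u, q) \<noteq> 0"
      using PA_mult_support[of f g u p] x by auto
    then show "x \<in> quiver_paths G" using f g unfolding PA_carrier by (auto simp: quiver_paths_append)
  qed
  ultimately show ?thesis
    using f g unfolding PA_carrier by (meson finite_SigmaI finite_imageI finite_subset)
qed

lemma PA_mult_assoc: "(f \<otimes>\<^bsub>PA\<^esub> g) \<otimes>\<^bsub>PA\<^esub> h = f \<otimes>\<^bsub>PA\<^esub> (g \<otimes>\<^bsub>PA\<^esub> h)"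
proof
  fix x :: "('a, 'b) qpath"
  obtain u p where [simp]: "x = (u, p)" by force
  define n where "n = length p"
  define e where "e k = path_end G (u, take k p)" for k
  \<comment> \<open>the path \<open>p\<close> is cut at the positions \<open>k \<le> m\<close>\<close>
  define F where "F k m = f (e m, drop m p) * g (e k, drop k (take m p)) * h (u, take k p)" for k m
  have e_add: "path_end G (e k, take j (drop k p)) = e (k + j)" for k j
    unfolding e_def take_add path_end_append ..
  have "((f \<otimes>\<^bsub>PA\<^esub> g) \<otimes>\<^bsub>PA\<^esub> h) x = (\<Sum>k\<le>n. \<Sum>j\<le>n - k. F k (k + j))"
  proof -
    have "(f \<otimes>\<^bsub>PA\<^esub> g) (e k, drop k p) * h (u, take k p) = (\<Sum>j\<le>n - k. F k (k + j))" for k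
      unfolding PA_mult e_add sum_distrib_right F_def n_def
      by (rule sum.cong) (auto simp: take_drop add.commute mult.assoc)
    then show ?thesis unfolding \<open>x = (u, p)\<close> PA_mult[of "f \<otimes>\<^bsub>PA\<^esub> g"] e_def n_def by simp
  qed
  also have "\<dots> = (\<Sum>(k, j)\<in>Sigma {..n} (\<lambda>k. {..n - k}). F k (k + j))"
    by (rule sum.Sigma) auto
  also have "\<dots> = (\<Sum>(m, k)\<in>Sigma {..n} (\<lambda>m. {..m}). F k m)"
    by (rule sum.reindex_bij_witness[of _ "\<lambda>(m, k). (k, m - k)" "\<lambda>(k, j). (k + j, k)"]) auto
  also have "\<dots> = (\<Sum>m\<le>n. \<Sum>k\<le>m. F k m)"
    by (rule sum.Sigma[symmetric]) auto
  also have "\<dots> = (\<Sum>m\<le>n. f (e m, drop m p) * (g \<otimes>\<^bsub>PA\<^esub> h) (u, take m p))"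
  proof (rule sum.cong[OF refl])
    fix m assume "m \<in> {..n}"
    then have m: "min (length p) m = m" unfolding n_def by auto
    show "(\<Sum>k\<le>m. F k m) = f (e m, drop m p) * (g \<otimes>\<^bsub>PA\<^esub> h) (u, take m p)"
    proof -
      have "k \<le> m \<Longrightarrow> take k (take m p) = take k p" for k by (simp add: min_absorb1)
      then show ?thesis
        unfolding PA_mult F_def sum_distrib_left length_take m
        by (intro sum.cong refl) (auto simp: e_def mult.assoc simp del: take_take)
    qed
  qed
  also have "\<dots> = (f \<otimes>\<^bsub>PA\<^esub> (g \<otimes>\<^bsub>PA\<^esub> h)) x"
    unfolding n_def by (simp add: PA_mult[of f "g \<otimes>\<^bsub>PA\<^esub> h"] e_def)
  finally show "((f \<otimes>\<^bsub>PA\<^esub> g) \<otimes>\<^bsub>PA\<^esub> h) x = (f \<otimes>\<^bsub>PA\<^esub> (g \<otimes>\<^bsub>PA\<^esub> h)) x" .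
qed

lemma PA_one_closed: "(\<one>\<^bsub>PA\<^esub> :: ('a, 'b) qpath \<Rightarrow> 'k::field) \<in> carrier PA"
proof -
  have "{p. (\<one>\<^bsub>PA\<^esub> :: ('a, 'b) qpath \<Rightarrow> 'k) p \<noteq> 0} \<subseteq> (\<lambda>u. (u, [])) ` verts G" unfolding PA_one by (auto split: if_splits)
  then show ?thesis unfolding PA_carrier
    using finite_verts quiver_paths_Nil by (auto intro: finite_subset)
qed

lemma PA_l_one:
  assumes f: "f \<in> carrier PA"
  shows "\<one>\<^bsub>PA\<^esub> \<otimes>\<^bsub>PA\<^esub> f = f"
proof
  fix x :: "('a, 'b) qpath"
  obtain u p where [simp]: "x = (u, p)" by force
  have "(\<one>\<^bsub>PA\<^esub> \<otimes>\<^bsub>PA\<^esub> f) x = (\<Sum>k\<le>length p. if k = length p then (if path_end G (u, p) \<in> verts G then f (u, p) else 0) else 0)"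
    unfolding \<open>x = (u, p)\<close> PA_mult PA_one by (rule sum.cong) auto
  also have "\<dots> = (if path_end G (u, p) \<in> verts G then f (u, p) else 0)" by simp
  also have "\<dots> = f x" using f quiver_pathsD(3)[of u p] unfolding PA_carrier by auto
  finally show "(\<one>\<^bsub>PA\<^esub> \<otimes>\<^bsub>PA\<^esub> f) x = f x" .
qed

lemma PA_r_one:
  assumes f: "f \<in> carrier PA"
  shows "f \<otimes>\<^bsub>PA\<^esub> \<one>\<^bsub>PA\<^esub> = f"
proof
  fix x :: "('a, 'b) qpath"
  obtain u p where [simp]: "x = (u, p)" by force
  have "(f \<otimes>\<^bsub>PA\<^esub> \<one>\<^bsub>PA\<^esub>) x = (\<Sum>k\<le>length p. if k = 0 then (if u \<in> verts G then f (u, p) else 0) else 0)"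
    unfolding \<open>x = (u, p)\<close> PA_mult PA_one by (rule sum.cong) auto
  also have "\<dots> = (if u \<in> verts G then f (u, p) else 0)" by simp
  also have "\<dots> = f x" using f quiver_pathsD(1)[of u p] unfolding PA_carrier by auto
  finally show "(f \<otimes>\<^bsub>PA\<^esub> \<one>\<^bsub>PA\<^esub>) x = f x" .
qed

lemma PA_add_closed:
  assumes "f \<in> carrier PA" "g \<in> carrier PA"
  shows "f \<oplus>\<^bsub>PA\<^esub> g \<in> carrier PA"
proof -
  have "{p. f p + g p \<noteq> 0} \<subseteq> {p. f p \<noteq> 0} \<union> {p. g p \<noteq> 0}" by auto
  then show ?thesis
    using assms unfolding PA_carrier PA_add by (auto intro: finite_subset)
qed

lemma ring_PA: "ring (PA :: (('a, 'b) qpath \<Rightarrow> 'k::field) ring)"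
proof (rule ringI)
  show "abelian_group (PA :: (('a, 'b) qpath \<Rightarrow> 'k) ring)"
  proof (rule abelian_groupI)
    fix f :: "('a, 'b) qpath \<Rightarrow> 'k" assume f: "f \<in> carrier PA"
    show "\<exists>g\<in>carrier PA. g \<oplus>\<^bsub>PA\<^esub> f = \<zero>\<^bsub>PA\<^esub>"
      using f by (intro bexI[of _ "\<lambda>p. - f p"]) (auto simp: PA_add PA_zero PA_carrier)
  next
    show "(\<zero>\<^bsub>PA\<^esub> :: ('a, 'b) qpath \<Rightarrow> 'k) \<in> carrier PA" by (simp add: PA_carrier PA_zero)
  qed (auto simp: PA_add_closed, auto simp: PA_add PA_zero fun_eq_iff algebra_simps)
  show "Group.monoid (PA :: (('a, 'b) qpath \<Rightarrow> 'k) ring)"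
    by (rule monoidI) (auto simp: PA_mult_closed PA_one_closed PA_mult_assoc PA_l_one PA_r_one)
  fix f g h :: "('a, 'b) qpath \<Rightarrow> 'k"
  show "(f \<oplus>\<^bsub>PA\<^esub> g) \<otimes>\<^bsub>PA\<^esub> h = f \<otimes>\<^bsub>PA\<^esub> h \<oplus>\<^bsub>PA\<^esub> g \<otimes>\<^bsub>PA\<^esub> h"
    by (rule ext) (auto simp: PA_add PA_mult sum.distrib algebra_simps split: prod.splits)
  show "h \<otimes>\<^bsub>PA\<^esub> (f \<oplus>\<^bsub>PA\<^esub> g) = h \<otimes>\<^bsub>PA\<^esub> f \<oplus>\<^bsub>PA\<^esub> h \<otimes>\<^bsub>PA\<^esub> g"
    by (rule ext) (auto simp: PA_add PA_mult sum.distrib algebra_simps split: prod.splits)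
qed

lemma PA_minus:
  assumes "f \<in> carrier PA"
  shows "\<ominus>\<^bsub>PA\<^esub> f = (\<lambda>p. - f p)"
proof -
  interpret ring "PA :: (('a, 'b) qpath \<Rightarrow> 'k::field) ring" by (rule ring_PA)
  have "(\<lambda>p. - f p) \<in> carrier PA" using assms unfolding PA_carrier by simp
  moreover have "(\<lambda>p. - f p) \<oplus>\<^bsub>PA\<^esub> f = \<zero>\<^bsub>PA\<^esub>" unfolding PA_add PA_zero by auto
  ultimately show ?thesis using minus_equality assms by blast
qed

definition len_ideal :: "nat \<Rightarrow> (('a, 'b) qpath \<Rightarrow> 'k::field) set" where
  "len_ideal l = {f \<in> carrier PA. \<forall>p. f p \<noteq> 0 \<longrightarrow> l \<le> length (snd p)}"

lemma len_ideal_carrier: "f \<in> len_ideal l \<Longrightarrow> f \<in> carrier PA"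
  unfolding len_ideal_def by simp

lemma len_ideal_0: "len_ideal 0 = carrier PA"
  unfolding len_ideal_def by simp

lemma len_ideal_mono: "l \<le> m \<Longrightarrow> len_ideal m \<subseteq> len_ideal l"
  unfolding len_ideal_def by (auto intro: order_trans)

lemma len_ideal_mult:
  assumes "f \<in> len_ideal l" "g \<in> len_ideal m"
  shows "f \<otimes>\<^bsub>PA\<^esub> g \<in> len_ideal (l + m)"
proof -
  have "l + m \<le> length p" if nz: "(f \<otimes>\<^bsub>PA\<^esub> g) (u, p) \<noteq> 0" for u p
  proof -
    obtain q r where "p = q @ r" "f (path_end G (u, q), r) \<noteq> 0" "g (u, q) \<noteq> 0"
      using PA_mult_support nz by blast
    then show ?thesis using assms unfolding len_ideal_def by (fastforce)
  qed
  then show ?thesis using assms PA_mult_closed unfolding len_ideal_def by auto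
qed

lemma len_ideal_add:
  assumes "f \<in> len_ideal l" "g \<in> len_ideal l"
  shows "f \<oplus>\<^bsub>PA\<^esub> g \<in> len_ideal l"
proof -
  have "f p + g p \<noteq> 0 \<Longrightarrow> f p \<noteq> 0 \<or> g p \<noteq> 0" for p by auto
  then show ?thesis using assms PA_add_closed[of f g] unfolding len_ideal_def PA_add mem_Collect_eq by metis
qed

lemma ideal_len_ideal: "ideal (len_ideal l :: (('a, 'b) qpath \<Rightarrow> 'k::field) set) PA"
proof (rule idealI[OF ring_PA])
  interpret ring "PA :: (('a, 'b) qpath \<Rightarrow> 'k) ring" by (rule ring_PA)
  show "subgroup (len_ideal l :: (('a, 'b) qpath \<Rightarrow> 'k) set) (add_monoid PA)"
  proof (rule add.subgroupI)
    show "len_ideal l \<subseteq> carrier PA" unfolding len_ideal_def by auto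
    have "(\<lambda>_. 0 :: 'k) \<in> len_ideal l" unfolding len_ideal_def PA_carrier by auto
    then show "(len_ideal l :: (('a, 'b) qpath \<Rightarrow> 'k) set) \<noteq> {}" by auto
    fix f :: "('a, 'b) qpath \<Rightarrow> 'k" assume f: "f \<in> len_ideal l"
    show "\<ominus>\<^bsub>PA\<^esub> f \<in> len_ideal l"
      using f unfolding PA_minus[OF len_ideal_carrier[OF f]] by (auto simp: len_ideal_def PA_carrier)
  qed (simp add: len_ideal_add)
  fix f g :: "('a, 'b) qpath \<Rightarrow> 'k" assume fg: "f \<in> len_ideal l" "g \<in> carrier PA"
  show "g \<otimes>\<^bsub>PA\<^esub> f \<in> len_ideal l" using len_ideal_mult[of g 0 f l] fg by (simp add: len_ideal_0)
  show "f \<otimes>\<^bsub>PA\<^esub> g \<in> len_ideal l" using len_ideal_mult[of f l g 0] fg by (simp add: len_ideal_0)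
qed

lemma single_mult:
  assumes "(u, p @ q) \<in> quiver_paths G"
  shows "single_path (path_end G (u, p), q) c \<otimes>\<^bsub>PA\<^esub> single_path (u, p) c' = single_path (u, p @ q) (c * c')"
proof
  fix x :: "('a, 'b) qpath"
  obtain v r where x: "x = (v, r)" by force
  have "(single_path (path_end G (u, p), q) c \<otimes>\<^bsub>PA\<^esub> single_path (u, p) c') x =
    (\<Sum>k\<le>length r. if k = length p then (if x = (u, p @ q) then c * c' else 0) else 0)"
    unfolding x PA_mult
  proof (rule sum.cong[OF refl])
    fix k assume "k \<in> {..length r}"
    then have k: "k \<le> length r" by simp
    show "single_path (path_end G (u, p), q) c (path_end G (v, take k r), drop k r) *
        single_path (u, p) c' (v, take k r) =
      (if k = length p then (if (v, r) = (u, p @ q) then c * c' else 0) else 0)"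
    proof (cases "v = u \<and> take k r = p")
      case True
      then have "k = length p" using k by auto
      moreover have "drop k r = q \<longleftrightarrow> r = p @ q"
        using True append_take_drop_id[of k r] by (metis same_append_eq)
      ultimately show ?thesis using True by (auto simp: single_path_def)
    next
      case False
      then have "single_path (u, p) c' (v, take k r) = 0" by (auto simp: single_path_def)
      moreover have "\<not> (k = length p \<and> (v, r) = (u, p @ q))" using False by auto
      ultimately show ?thesis by auto
    qed
  qed
  also have "\<dots> = single_path (u, p @ q) (c * c') x" by (auto simp: x single_path_def)
  finally show "(single_path (path_end G (u, p), q) c \<otimes>\<^bsub>PA\<^esub> single_path (u, p) c') x = single_path (u, p @ q) (c * c') x" .
qed

lemma single_in_len_ideal:
  "p \<in> quiver_paths G \<Longrightarrow> l \<le> length (snd p) \<Longrightarrow> single_path p c \<in> len_ideal l"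
  unfolding len_ideal_def PA_carrier single_path_def by auto

text \<open>Reduces additive statements on elements of the path algebra to multiples of single paths: \<open>A\<close> is
  taken as the set of elements satisfying the statement.\<close>

lemma finite_support_closure:
  assumes fin: "finite {p. f p \<noteq> (0 :: 'k::field)}"
    and zero: "(\<lambda>_. 0) \<in> A" and add: "\<And>g h. g \<in> A \<Longrightarrow> h \<in> A \<Longrightarrow> (\<lambda>p. g p + h p) \<in> A"
    and single: "\<And>p. f p \<noteq> 0 \<Longrightarrow> single_path p (f p) \<in> A"
  shows "f \<in> A"
proof -
  have "(\<lambda>q. if q \<in> F then f q else 0) \<in> A" if "finite F" "F \<subseteq> {p. f p \<noteq> 0}" for F
    using that
  proof (induction F)
    case (insert p F)
    have "(\<lambda>q. if q \<in> insert p F then f q else 0) =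
        (\<lambda>q. single_path p (f p) q + (if q \<in> F then f q else 0))"
      using insert.hyps by (auto simp: single_path_def)
    then show ?case using add[OF single[of p]] insert by auto
  qed (use zero in auto)
  note sums = this
  have "(\<lambda>q. if q \<in> {p. f p \<noteq> 0} then f q else 0) = f" by auto
  then show ?thesis using sums[OF fin order_refl] by (simp only:)
qed

text \<open>A path of length at least \<open>L + 1\<close> is a left multiple of its initial part of length \<open>L + 1\<close>.\<close>

lemma trunc_ideal_eq: "trunc_ideal G L = (len_ideal (L + 1) :: (('a, 'b) qpath \<Rightarrow> 'k::field) set)"
proof -
  interpret ring "PA :: (('a, 'b) qpath \<Rightarrow> 'k) ring" by (rule ring_PA)
  define S :: "(('a, 'b) qpath \<Rightarrow> 'k) set" where "S = {single_path p 1 | p. p \<in> quiver_paths G \<and> length (snd p) = L + 1}"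
  have Sc: "S \<subseteq> len_ideal (L + 1)" unfolding S_def by (auto intro!: single_in_len_ideal)
  have Scarr: "S \<subseteq> carrier PA" using Sc len_ideal_carrier by blast
  have ideal: "ideal (Idl\<^bsub>PA\<^esub> S) PA" by (rule genideal_ideal[OF Scarr])
  then interpret I: ideal "Idl\<^bsub>PA\<^esub> S" PA .
  have "f \<in> Idl\<^bsub>PA\<^esub> S" if f: "f \<in> len_ideal (L + 1)" for f
  proof (rule finite_support_closure)
    show "finite {p. f p \<noteq> 0}" using len_ideal_carrier[OF f] unfolding PA_carrier by auto
    show "(\<lambda>_. 0) \<in> Idl\<^bsub>PA\<^esub> S" using I.zero_closed unfolding PA_zero .
    show "(\<lambda>p. g p + h p) \<in> Idl\<^bsub>PA\<^esub> S" if "g \<in> Idl\<^bsub>PA\<^esub> S" "h \<in> Idl\<^bsub>PA\<^esub> S" for g h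
      using I.a_closed[OF that] unfolding PA_add .
    fix x assume fx: "f x \<noteq> 0"
    obtain u p where x: "x = (u, p)" by force
    have len: "L + 1 \<le> length p" using f fx x unfolding len_ideal_def by force
    have px: "(u, p) \<in> quiver_paths G" using f fx x unfolding len_ideal_def PA_carrier by auto
    define q r where "q = take (L + 1) p" and "r = drop (L + 1) p"
    have pqr: "p = q @ r" unfolding q_def r_def by simp
    have q: "(u, q) \<in> quiver_paths G" "(path_end G (u, q), r) \<in> quiver_paths G"
      using px unfolding pqr quiver_paths_append by auto
    have "length q = L + 1" unfolding q_def using len by simp
    then have "single_path (u, q) 1 \<in> S" unfolding S_def mem_Collect_eq
      using q by (intro exI[of _ "(u, q)"]) simp
    then have "single_path (u, q) 1 \<in> Idl\<^bsub>PA\<^esub> S" using genideal_self[OF Scarr] by auto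
    moreover have "single_path (path_end G (u, q), r) (f x) \<in> carrier PA"
      using single_in_len_ideal[OF q(2), of 0] by (simp add: len_ideal_0)
    ultimately have "single_path (path_end G (u, q), r) (f x) \<otimes>\<^bsub>PA\<^esub> single_path (u, q) 1 \<in> Idl\<^bsub>PA\<^esub> S"
      by (rule I.I_l_closed)
    then show "single_path x (f x) \<in> Idl\<^bsub>PA\<^esub> S"
      using single_mult[of u q r "f x" 1] px unfolding x pqr by (simp del: awalk_verts_conv)
  qed
  moreover have "Idl\<^bsub>PA\<^esub> S \<subseteq> len_ideal (L + 1)" by (rule genideal_minimal[OF ideal_len_ideal Sc])
  ultimately show ?thesis unfolding trunc_ideal_def S_def[unfolded single_path_def, symmetric] by auto
qed

abbreviation TA :: "nat \<Rightarrow> (('a, 'b) qpath \<Rightarrow> 'k::field) set ring" where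
  "TA L \<equiv> trunc_path_algebra G L"

definition residue :: "nat \<Rightarrow> (('a, 'b) qpath \<Rightarrow> 'k::field) \<Rightarrow> (('a, 'b) qpath \<Rightarrow> 'k) set" where
  "residue L f = trunc_ideal G L +>\<^bsub>PA\<^esub> f"

definition arrow_power :: "nat \<Rightarrow> nat \<Rightarrow> (('a, 'b) qpath \<Rightarrow> 'k::field) set set" where
  "arrow_power L l = residue L ` len_ideal l"

lemma ideal_trunc: "ideal (trunc_ideal G L :: (('a, 'b) qpath \<Rightarrow> 'k::field) set) PA"
  unfolding trunc_ideal_eq by (rule ideal_len_ideal)

lemma residue_hom: "ring_hom_ring (PA :: (('a, 'b) qpath \<Rightarrow> 'k::field) ring) (TA L) (residue L)"
  using ideal.rcos_ring_hom_ring[OF ideal_trunc, of L]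
  unfolding trunc_path_algebra_def residue_def[abs_def] .

lemma ring_TA: "ring (TA L :: (('a, 'b) qpath \<Rightarrow> 'k::field) set ring)"
  using ideal.quotient_is_ring[OF ideal_trunc] unfolding trunc_path_algebra_def .

lemma TA_carrier: "carrier (TA L) = residue L ` carrier (PA :: (('a, 'b) qpath \<Rightarrow> 'k::field) ring)"
  unfolding trunc_path_algebra_def FactRing_def residue_def[abs_def] A_RCOSETS_def' by auto

lemma residue_eq_iff:
  assumes "f \<in> carrier PA" "g \<in> carrier PA"
  shows "residue L f = residue L g \<longleftrightarrow> (\<lambda>p. f p - g p) \<in> (len_ideal (L + 1) :: (('a, 'b) qpath \<Rightarrow> 'k::field) set)"
proof -
  interpret I: ideal "trunc_ideal G L :: (('a, 'b) qpath \<Rightarrow> 'k) set" PA by (rule ideal_trunc)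
  have "f \<ominus>\<^bsub>PA\<^esub> g = (\<lambda>p. f p - g p)"
    unfolding a_minus_def PA_minus[OF assms(2)] PA_add by simp
  then show ?thesis
    using I.quotient_eq_iff_same_a_r_cos[OF ideal_trunc assms]
    unfolding residue_def trunc_ideal_eq by simp
qed

lemma ideal_arrow_power: "ideal (arrow_power L l :: (('a, 'b) qpath \<Rightarrow> 'k::field) set set) (TA L)"
  using ring.ring_ideal_imp_quot_ideal[OF ring_PA ideal_trunc ideal_len_ideal]
  unfolding trunc_path_algebra_def arrow_power_def residue_def[abs_def] .

lemma arrow_power_0: "arrow_power L 0 = carrier (TA L)"
  unfolding arrow_power_def len_ideal_0 TA_carrier ..

lemma arrow_power_mono: "l \<le> m \<Longrightarrow> arrow_power L m \<subseteq> arrow_power L l"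
  unfolding arrow_power_def using len_ideal_mono by blast

lemma arrow_power_vanish: "arrow_power L (L + 1) = {\<zero>\<^bsub>TA L\<^esub> :: (('a, 'b) qpath \<Rightarrow> 'k::field) set}"
proof -
  interpret h: ring_hom_ring "PA :: (('a, 'b) qpath \<Rightarrow> 'k) ring" "TA L" "residue L" by (rule residue_hom)
  have "residue L f = \<zero>\<^bsub>TA L\<^esub>" if f: "f \<in> len_ideal (L + 1)" for f :: "('a, 'b) qpath \<Rightarrow> 'k"
  proof -
    have "residue L f = residue L \<zero>\<^bsub>PA\<^esub>"
      using residue_eq_iff[OF len_ideal_carrier[OF f] h.R.zero_closed] f unfolding PA_zero by simp
    then show ?thesis by simp
  qed
  moreover have "\<zero>\<^bsub>TA L\<^esub> \<in> (arrow_power L (L + 1) :: (('a, 'b) qpath \<Rightarrow> 'k) set set)"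
    using additive_subgroup.zero_closed[OF ideal.axioms(1)[OF ideal_arrow_power]] .
  ultimately show ?thesis unfolding arrow_power_def by auto
qed

lemma arrow_power_mult:
  assumes "a \<in> arrow_power L l" "b \<in> (arrow_power L m :: (('a, 'b) qpath \<Rightarrow> 'k::field) set set)"
  shows "a \<otimes>\<^bsub>TA L\<^esub> b \<in> arrow_power L (l + m)"
proof -
  interpret h: ring_hom_ring "PA :: (('a, 'b) qpath \<Rightarrow> 'k) ring" "TA L" "residue L" by (rule residue_hom)
  obtain f g where fg: "f \<in> len_ideal l" "g \<in> len_ideal m" "a = residue L f" "b = residue L g"
    using assms unfolding arrow_power_def by auto
  then have "a \<otimes>\<^bsub>TA L\<^esub> b = residue L (f \<otimes>\<^bsub>PA\<^esub> g)"
    using h.hom_mult len_ideal_carrier by metis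
  then show ?thesis using len_ideal_mult[OF fg(1,2)] unfolding arrow_power_def by auto
qed

text \<open>The arrow ideal \<open>A\<close> is nilpotent.  If \<open>A\<^sup>l\<close> were not contained in \<open>M\<close>, then \<open>M + A\<^sup>l\<close> would be the whole
  ring and \<open>1 = m + b\<close> with \<open>m \<in> M\<close> and \<open>b \<in> A\<^sup>l\<close>.  Every \<open>c \<in> A\<^sup>l\<close> is then \<open>c m + c b\<close>, and
  \<open>c b \<in> A\<^bsup>2l\<^esup> \<subseteq> A\<^bsup>l+1\<^esup>\<close> belongs to \<open>M\<close> by downward induction on \<open>l\<close>.\<close>

lemma arrow_power_le_maximal:
  assumes M: "maximal_left_ideal M (TA L :: (('a, 'b) qpath \<Rightarrow> 'k::field) set ring)"
    and l: "1 \<le> l" "l \<le> L + 1"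
  shows "arrow_power L l \<subseteq> M"
  using l(2) l(1)
proof (induction rule: inc_induct)
  case base
  have "additive_subgroup M (TA L)" using M unfolding maximal_left_ideal_def left_ideal_def by auto
  then show ?case unfolding arrow_power_vanish using additive_subgroup.zero_closed by auto
next
  case (step l)
  let ?A = "TA L :: (('a, 'b) qpath \<Rightarrow> 'k) set ring"
  interpret ring "TA L :: (('a, 'b) qpath \<Rightarrow> 'k) set ring" by (rule ring_TA)
  have lM: "left_ideal M ?A" and maxM: "\<And>I. left_ideal I ?A \<Longrightarrow> M \<subseteq> I \<Longrightarrow> I = M \<or> I = carrier ?A"
    using M unfolding maximal_left_ideal_def by auto
  have aM: "additive_subgroup M ?A" and clM: "\<And>r a. r \<in> carrier ?A \<Longrightarrow> a \<in> M \<Longrightarrow> r \<otimes>\<^bsub>?A\<^esub> a \<in> M"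
    using lM unfolding left_ideal_def by auto
  interpret M: additive_subgroup M "TA L" by (rule aM)
  interpret B: ideal "arrow_power L l" "TA L :: (('a, 'b) qpath \<Rightarrow> 'k) set ring" by (rule ideal_arrow_power)
  define N where "N = M <+>\<^bsub>?A\<^esub> arrow_power L l"
  have N_iff: "x \<in> N \<longleftrightarrow> (\<exists>m\<in>M. \<exists>b\<in>arrow_power L l. x = m \<oplus>\<^bsub>?A\<^esub> b)" for x
    unfolding N_def set_add_def' by auto
  have "left_ideal N ?A"
    unfolding left_ideal_def
  proof (intro conjI ballI)
    show "additive_subgroup N ?A"
      unfolding N_def by (rule add_additive_subgroups[OF aM B.is_additive_subgroup])
    fix r x assume r: "r \<in> carrier ?A" and "x \<in> N"
    then obtain m b where mb: "m \<in> M" "b \<in> arrow_power L l" "x = m \<oplus>\<^bsub>?A\<^esub> b" unfolding N_iff by auto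
    have "r \<otimes>\<^bsub>?A\<^esub> x = r \<otimes>\<^bsub>?A\<^esub> m \<oplus>\<^bsub>?A\<^esub> r \<otimes>\<^bsub>?A\<^esub> b"
      unfolding mb(3) using r mb(1,2) by (intro r_distr) auto
    then show "r \<otimes>\<^bsub>?A\<^esub> x \<in> N" unfolding N_iff using clM[OF r mb(1)] B.I_l_closed[OF mb(2) r] by blast
  qed
  moreover have "M \<subseteq> N"
  proof
    fix m assume "m \<in> M"
    then have "m = m \<oplus>\<^bsub>?A\<^esub> \<zero>\<^bsub>?A\<^esub>" by simp
    then show "m \<in> N" unfolding N_iff using \<open>m \<in> M\<close> B.zero_closed by blast
  qed
  ultimately consider "N = M" | "N = carrier ?A" using maxM by blast
  then show ?case
  proof cases
    case 1
    have "b \<in> N" if b: "b \<in> arrow_power L l" for b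
    proof -
      have "b = \<zero>\<^bsub>?A\<^esub> \<oplus>\<^bsub>?A\<^esub> b" using b by simp
      then show ?thesis unfolding N_iff using b M.zero_closed by blast
    qed
    then show ?thesis using 1 by auto
  next
    case 2
    then have "\<one>\<^bsub>?A\<^esub> \<in> N" by simp
    then obtain m b where mb: "m \<in> M" "b \<in> arrow_power L l" "\<one>\<^bsub>?A\<^esub> = m \<oplus>\<^bsub>?A\<^esub> b" unfolding N_iff by auto
    show ?thesis
    proof
      fix c :: "(('a, 'b) qpath \<Rightarrow> 'k) set" assume c: "c \<in> arrow_power L l"
      have cc: "c \<in> carrier ?A" using c by auto
      have "c = c \<otimes>\<^bsub>?A\<^esub> (m \<oplus>\<^bsub>?A\<^esub> b)" using cc mb(3) r_one by metis
      also have "\<dots> = c \<otimes>\<^bsub>?A\<^esub> m \<oplus>\<^bsub>?A\<^esub> c \<otimes>\<^bsub>?A\<^esub> b" using cc mb(1,2) by (intro r_distr) auto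
      finally have eq: "c = c \<otimes>\<^bsub>?A\<^esub> m \<oplus>\<^bsub>?A\<^esub> c \<otimes>\<^bsub>?A\<^esub> b" .
      have "c \<otimes>\<^bsub>?A\<^esub> b \<in> arrow_power L (l + l)" by (rule arrow_power_mult[OF c mb(2)])
      also have "\<dots> \<subseteq> arrow_power L (Suc l)" using step.prems by (intro arrow_power_mono) auto
      also have "\<dots> \<subseteq> M" using step.IH by simp
      finally show "c \<in> M" using eq M.a_closed[OF clM[OF cc mb(1)]] by metis
    qed
  qed
qed

text \<open>This left ideal is the kernel of a ring homomorphism onto the field, the coefficient of the
  trivial path at \<open>u\<close>; the corresponding simple module is the one at the vertex \<open>u\<close>.\<close>

lemma vertex_maximal:
  assumes u: "u \<in> verts G"
  shows "maximal_left_ideal (residue L ` {f \<in> carrier PA. f (u, []) = 0}) (TA L :: (('a, 'b) qpath \<Rightarrow> 'k::field) set ring)"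
proof -
  let ?A = "TA L :: (('a, 'b) qpath \<Rightarrow> 'k) set ring"
  interpret h: ring_hom_ring "PA :: (('a, 'b) qpath \<Rightarrow> 'k) ring" "TA L" "residue L" by (rule residue_hom)
  define Z where "Z = {f :: ('a, 'b) qpath \<Rightarrow> 'k. f \<in> carrier PA \<and> f (u, []) = 0}"
  define M where "M = residue L ` Z"
  have Zc: "Z \<subseteq> carrier PA" unfolding Z_def by auto
  have res_cong: "f (u, []) = g (u, [])" if "f \<in> carrier PA" "g \<in> carrier PA" "residue L f = residue L g"
    for f g :: "('a, 'b) qpath \<Rightarrow> 'k"
  proof (rule ccontr)
    assume "f (u, []) \<noteq> g (u, [])"
    moreover have "(\<lambda>p. f p - g p) \<in> len_ideal (L + 1)" using residue_eq_iff that by blast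
    ultimately show False unfolding len_ideal_def by force
  qed
  have left_mult: "(r \<otimes>\<^bsub>PA\<^esub> f) (u, []) = r (u, []) * f (u, [])" for r f :: "('a, 'b) qpath \<Rightarrow> 'k"
    unfolding PA_mult by simp
  have left: "left_ideal M ?A"
    unfolding left_ideal_def
  proof (intro conjI ballI)
    have sub: "subgroup Z (add_monoid PA)"
    proof (rule h.R.add.subgroupI)
      have "(\<lambda>_. 0 :: 'k) \<in> Z" unfolding Z_def PA_carrier by auto
      then show "Z \<noteq> {}" by auto
      fix f g assume f: "f \<in> Z" 
      then have fc: "f \<in> carrier PA" using Zc by auto
      show "\<ominus>\<^bsub>PA\<^esub> f \<in> Z"
        using f unfolding PA_minus[OF fc] by (auto simp: Z_def PA_carrier)
      assume g: "g \<in> Z"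
      show "f \<oplus>\<^bsub>PA\<^esub> g \<in> Z" using f g h.R.a_closed[of f g] unfolding Z_def by (auto simp: PA_add)
    qed (rule Zc)
    show "additive_subgroup M ?A"
      unfolding M_def using h.img_is_add_subgroup[OF sub] by (rule additive_subgroup.intro)
    fix r a assume "r \<in> carrier ?A" "a \<in> M"
    then obtain f g where fg: "f \<in> carrier PA" "r = residue L f" "g \<in> Z" "a = residue L g"
      unfolding M_def TA_carrier by auto
    then have "r \<otimes>\<^bsub>?A\<^esub> a = residue L (f \<otimes>\<^bsub>PA\<^esub> g)" using h.hom_mult Zc by auto
    moreover have "f \<otimes>\<^bsub>PA\<^esub> g \<in> Z" using fg h.R.m_closed[of f g] unfolding Z_def by (simp add: left_mult)
    ultimately show "r \<otimes>\<^bsub>?A\<^esub> a \<in> M" unfolding M_def by auto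
  qed
  moreover have "M \<noteq> carrier ?A"
  proof
    assume "M = carrier ?A"
    then have "\<one>\<^bsub>?A\<^esub> \<in> M" by simp
    then obtain f where f: "f \<in> Z" "residue L \<one>\<^bsub>PA\<^esub> = residue L f" unfolding M_def using h.hom_one by auto
    have "(\<one>\<^bsub>PA\<^esub> :: ('a, 'b) qpath \<Rightarrow> 'k) (u, []) = f (u, [])"
      by (rule res_cong) (use f Zc in auto)
    then show False using f u unfolding Z_def PA_one by simp
  qed
  moreover have "I = M \<or> I = carrier ?A" if I: "left_ideal I ?A" "M \<subseteq> I" for I
  proof (rule disjCI)
    interpret I: additive_subgroup I "TA L" using I unfolding left_ideal_def by auto
    have clI: "\<And>r a. r \<in> carrier ?A \<Longrightarrow> a \<in> I \<Longrightarrow> r \<otimes>\<^bsub>?A\<^esub> a \<in> I"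
      using I unfolding left_ideal_def by auto
    assume "I \<noteq> carrier ?A"
    show "I = M"
    proof (rule ccontr)
      assume "I \<noteq> M"
      then obtain a where a: "a \<in> I" "a \<notin> M" using I(2) by auto
      then obtain f where f: "f \<in> carrier PA" "a = residue L f" using I.a_subset unfolding TA_carrier by auto
      have nz: "f (u, []) \<noteq> 0" using a(2) f unfolding M_def Z_def by auto
      define c where "c = single_path (u, []) (inverse (f (u, [])))"
      have cc: "c \<in> carrier PA" using single_in_len_ideal[of "(u, [])" 0] quiver_paths_Nil u
        unfolding c_def by (simp add: len_ideal_0)
      define g where "g = c \<otimes>\<^bsub>PA\<^esub> f"
      have gc: "g \<in> carrier PA" unfolding g_def using cc f by simp
      have gu: "g (u, []) = 1" unfolding g_def left_mult using nz by (simp add: c_def single_path_def)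
      have gI: "residue L g \<in> I" unfolding g_def using clI[OF _ a(1)] f cc h.hom_mult by auto
      define k where "k = \<one>\<^bsub>PA\<^esub> \<ominus>\<^bsub>PA\<^esub> g"
      have k_eq: "k = (\<lambda>p. \<one>\<^bsub>PA\<^esub> p - g p)" unfolding k_def a_minus_def PA_minus[OF gc] PA_add by simp
      have "k \<in> carrier PA" unfolding k_def using gc by simp
      then have "k \<in> Z" unfolding Z_def using gu u by (simp add: k_eq PA_one)
      then have kI: "residue L k \<in> I" using I(2) unfolding M_def by auto
      have "\<one>\<^bsub>PA\<^esub> = k \<oplus>\<^bsub>PA\<^esub> g" unfolding k_eq PA_add by auto
      then have "\<one>\<^bsub>?A\<^esub> = residue L k \<oplus>\<^bsub>?A\<^esub> residue L g"
        using h.hom_add[of k g] h.hom_one \<open>k \<in> Z\<close> Zc gc by auto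
      then have one: "\<one>\<^bsub>?A\<^esub> \<in> I" using kI gI I.a_closed by metis
      have "carrier ?A \<subseteq> I" using clI[OF _ one] by auto
      then show False using I.a_subset \<open>I \<noteq> carrier ?A\<close> by auto
    qed
  qed
  ultimately show ?thesis unfolding maximal_left_ideal_def M_def Z_def by blast
qed

lemma jacobson_radical_eq: "jacobson_radical (TA L :: (('a, 'b) qpath \<Rightarrow> 'k::field) set ring) = arrow_power L 1"
proof
  show "arrow_power L 1 \<subseteq> jacobson_radical (TA L :: (('a, 'b) qpath \<Rightarrow> 'k) set ring)"
    unfolding jacobson_radical_def
    using arrow_power_le_maximal[of _ L 1] arrow_power_mono[of 0 1 L] arrow_power_0 by auto
  show "jacobson_radical (TA L :: (('a, 'b) qpath \<Rightarrow> 'k) set ring) \<subseteq> arrow_power L 1"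
  proof
    fix a assume a: "a \<in> jacobson_radical (TA L :: (('a, 'b) qpath \<Rightarrow> 'k) set ring)"
    then obtain f where f: "f \<in> carrier PA" "a = residue L f" unfolding jacobson_radical_def TA_carrier by auto
    have "f (u, []) = 0" if u: "u \<in> verts G" for u
    proof -
      have "a \<in> residue L ` {f \<in> carrier PA. f (u, []) = 0}"
        using a vertex_maximal[OF u, of L] unfolding jacobson_radical_def by blast
      then obtain g where g: "g \<in> carrier PA" "g (u, []) = 0" "residue L f = residue L g" using f by auto
      have "(\<lambda>p. f p - g p) \<in> len_ideal (L + 1)" using residue_eq_iff f(1) g(1,3) by blast
      then have "f (u, []) - g (u, []) \<noteq> 0 \<longrightarrow> L + 1 \<le> length (snd (u, [] :: 'b list))"
        unfolding len_ideal_def by blast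
      then show ?thesis using g(2) by simp
    qed
    then have "f \<in> len_ideal 1"
      using f(1) quiver_paths_Nil unfolding len_ideal_def PA_carrier
      by (auto simp: Suc_le_eq)
    then show "a \<in> arrow_power L 1" unfolding arrow_power_def f(2) by auto
  qed
qed

text \<open>A path of length at least \<open>l + 1\<close> is the product of a path of length at least \<open>l\<close> and its first arrow.\<close>

lemma jacobson_power_eq: "jacobson_power (TA L :: (('a, 'b) qpath \<Rightarrow> 'k::field) set ring) l = arrow_power L l"
proof (induction l)
  case 0
  then show ?case unfolding arrow_power_0 by (simp add: ideals_set_def)
next
  case (Suc l)
  let ?A = "TA L :: (('a, 'b) qpath \<Rightarrow> 'k) set ring"
  interpret h: ring_hom_ring "PA :: (('a, 'b) qpath \<Rightarrow> 'k) ring" "TA L" "residue L" by (rule residue_hom)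
  interpret B: ideal "arrow_power L (Suc l)" ?A by (rule ideal_arrow_power)
  have "jacobson_power ?A (Suc l) = ideal_prod ?A (arrow_power L l) (arrow_power L 1)"
    using Suc unfolding jacobson_radical_eq by (simp add: nat_pow_def ideals_set_def)
  also have "\<dots> = arrow_power L (Suc l)"
  proof
    show "ideal_prod ?A (arrow_power L l) (arrow_power L 1) \<subseteq> arrow_power L (Suc l)"
    proof
      fix a assume "a \<in> ideal_prod ?A (arrow_power L l) (arrow_power L 1)"
      then show "a \<in> arrow_power L (Suc l)"
      proof induction
        case (prod i j)
        then show ?case using arrow_power_mult[of i L l j 1] by simp
      qed (rule B.a_closed)
    qed
    interpret P: ideal "ideal_prod ?A (arrow_power L l) (arrow_power L 1)" ?A
      by (rule ring.ideal_prod_is_ideal[OF ring_TA ideal_arrow_power ideal_arrow_power])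
    define A where "A = {f \<in> carrier PA. residue L f \<in> ideal_prod ?A (arrow_power L l) (arrow_power L 1)}"
    have "f \<in> A" if f: "f \<in> len_ideal (Suc l)" for f
    proof (rule finite_support_closure)
      show "finite {p. f p \<noteq> 0}" using len_ideal_carrier[OF f] unfolding PA_carrier by auto
      have "residue L \<zero>\<^bsub>PA\<^esub> \<in> ideal_prod ?A (arrow_power L l) (arrow_power L 1)" using P.zero_closed by simp
      then show "(\<lambda>_. 0) \<in> A" unfolding A_def PA_zero[symmetric] by simp
      fix g k assume gk: "g \<in> A" "k \<in> A"
      then have "residue L (g \<oplus>\<^bsub>PA\<^esub> k) \<in> ideal_prod ?A (arrow_power L l) (arrow_power L 1)"
        unfolding A_def using P.a_closed h.hom_add by auto
      then show "(\<lambda>p. g p + k p) \<in> A" unfolding A_def PA_add[symmetric] using gk by (auto simp: A_def)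
    next
      fix x assume fx: "f x \<noteq> 0"
      obtain u p where x: "x = (u, p)" by force
      have len: "Suc l \<le> length p" using f fx x unfolding len_ideal_def by force
      have px: "(u, p) \<in> quiver_paths G" using f fx x unfolding len_ideal_def PA_carrier by auto
      define q r where "q = take 1 p" and "r = drop 1 p"
      have pqr: "p = q @ r" unfolding q_def r_def by simp
      have lens: "1 \<le> length q" "l \<le> length r" unfolding q_def r_def using len by auto
      have q: "(u, q) \<in> quiver_paths G" "(path_end G (u, q), r) \<in> quiver_paths G"
        using px unfolding pqr quiver_paths_append by auto
      have 1: "single_path (u, q) 1 \<in> len_ideal 1" by (rule single_in_len_ideal[OF q(1)]) (use lens in simp)
      have 2: "single_path (path_end G (u, q), r) (f x) \<in> len_ideal l"
        by (rule single_in_len_ideal[OF q(2)]) (use lens in simp)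
      have e: "single_path x (f x) = single_path (path_end G (u, q), r) (f x) \<otimes>\<^bsub>PA\<^esub> single_path (u, q) 1"
        using single_mult[of u q r "f x" 1] px unfolding x pqr by simp
      have "residue L (single_path (path_end G (u, q), r) (f x)) \<otimes>\<^bsub>?A\<^esub> residue L (single_path (u, q) 1)
          \<in> ideal_prod ?A (arrow_power L l) (arrow_power L 1)"
        using 1 2 unfolding arrow_power_def by (intro ideal_prod.prod imageI)
      then show "single_path x (f x) \<in> A"
        unfolding A_def e using len_ideal_carrier[OF 1] len_ideal_carrier[OF 2] h.hom_mult by auto
    qed
    then show "arrow_power L (Suc l) \<subseteq> ideal_prod ?A (arrow_power L l) (arrow_power L 1)"
      unfolding arrow_power_def[of L "Suc l"] A_def by auto
  qed
  finally show ?case .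
qed

section \<open>Radical and socle spaces of a representation\<close>

definition rep_space :: "('a \<Rightarrow> nat) \<Rightarrow> ('b, 'k::field) rep set" where
  "rep_space d = (\<Pi>\<^sub>E a\<in>arcs G. carrier_mat (d (head G a)) (d (tail G a)))"

text \<open>The components of \<open>J\<^sup>l M\<^sub>x\<close> and of \<open>ann(J\<^sup>l)\<close> at the vertex \<open>i\<close> in terms of matrices; that these are the
  right spaces is shown in \<open>rad_power_eq\<close> and \<open>jacobson_ann_eq\<close>.  Note that \<open>soc_space d x l\<close> is the
  socle with index \<open>l - 1\<close>.\<close>

definition rad_space :: "('a \<Rightarrow> nat) \<Rightarrow> ('b, 'k::field) rep \<Rightarrow> nat \<Rightarrow> 'a \<Rightarrow> 'k vec set" where
  "rad_space d x l i = lspan (d i) {col (path_mat d x p) r | p r. p \<in> quiver_paths G \<and>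
     length (snd p) = l \<and> path_end G p = i \<and> r < d (fst p)}"

definition soc_space :: "('a \<Rightarrow> nat) \<Rightarrow> ('b, 'k::field) rep \<Rightarrow> nat \<Rightarrow> 'a \<Rightarrow> 'k vec set" where
  "soc_space d x l i = {v \<in> carrier_vec (d i). \<forall>p. (i, p) \<in> quiver_paths G \<and> length p = l \<longrightarrow>
     path_mat d x (i, p) *\<^sub>v v = 0\<^sub>v (d (path_end G (i, p)))}"

lemma soc_spaceI:
  assumes "v \<in> carrier_vec (d i)"
    and "\<And>p. (i, p) \<in> quiver_paths G \<Longrightarrow> length p = l \<Longrightarrow> path_mat d x (i, p) *\<^sub>v v = 0\<^sub>v (d (path_end G (i, p)))"
  shows "v \<in> soc_space d x l i"
  using assms unfolding soc_space_def by auto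

lemma rep_spaceD: "x \<in> rep_space d \<Longrightarrow> a \<in> arcs G \<Longrightarrow> x a \<in> carrier_mat (d (head G a)) (d (tail G a))"
  unfolding rep_space_def by auto

lemma rep_variety_iff: "x \<in> rep_variety G L d \<longleftrightarrow> x \<in> rep_space d \<and>
    (\<forall>p\<in>quiver_paths G. length (snd p) = L + 1 \<longrightarrow> path_mat d x p = 0\<^sub>m (d (path_end G p)) (d (fst p)))"
  unfolding rep_variety_def rep_space_def by auto

lemma path_mat_Nil: "path_mat d x (u, []) = 1\<^sub>m (d u)"
  unfolding path_mat_def by simp

lemma path_mat_snoc: "path_mat d x (u, p @ [a]) = x a * path_mat d x (u, p)"
  unfolding path_mat_def by simp

lemma path_mat_carrier:
  assumes x: "x \<in> rep_space d" and p: "(u, p) \<in> quiver_paths G"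
  shows "path_mat d x (u, p) \<in> carrier_mat (d (path_end G (u, p))) (d u)"
  using p
proof (induction p rule: rev_induct)
  case (snoc a p)
  then have "(u, p) \<in> quiver_paths G" "a \<in> arcs G" "tail G a = path_end G (u, p)"
    unfolding quiver_paths_snoc by auto
  then show ?case using snoc.IH rep_spaceD[OF x, of a] unfolding path_mat_snoc path_end_eq by simp
qed (simp add: path_mat_Nil)

lemma path_mat_append:
  assumes x: "x \<in> rep_space d" and p: "(u, p @ q) \<in> quiver_paths G"
  shows "path_mat d x (u, p @ q) = path_mat d x (path_end G (u, p), q) * path_mat d x (u, p)"
  using p
proof (induction q rule: rev_induct)
  case Nil
  then show ?case using path_mat_carrier[OF x, of u p] by (simp add: path_mat_Nil)
next
  case (snoc a q)
  have pq: "(u, p @ q) \<in> quiver_paths G" and a: "a \<in> arcs G" "tail G a = path_end G (u, p @ q)"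
    using snoc.prems quiver_paths_snoc[of u "p @ q" a] by auto
  have p: "(u, p) \<in> quiver_paths G" "(path_end G (u, p), q) \<in> quiver_paths G"
    using pq unfolding quiver_paths_append by auto
  have xa: "x a \<in> carrier_mat (d (head G a)) (d (path_end G (path_end G (u, p), q)))"
    using rep_spaceD[OF x a(1)] unfolding a(2) path_end_append .
  have "path_mat d x (u, (p @ q) @ [a]) = x a * (path_mat d x (path_end G (u, p), q) * path_mat d x (u, p))"
    unfolding path_mat_snoc snoc.IH[OF pq] ..
  also have "\<dots> = x a * path_mat d x (path_end G (u, p), q) * path_mat d x (u, p)"
    by (rule assoc_mult_mat[OF xa path_mat_carrier[OF x p(2)] path_mat_carrier[OF x p(1)], symmetric])
  also have "x a * path_mat d x (path_end G (u, p), q) = path_mat d x (path_end G (u, p), q @ [a])"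
    unfolding path_mat_snoc ..
  finally show ?case by simp
qed

lemma path_mat_append_vec:
  assumes x: "x \<in> rep_space d" and p: "(u, p @ q) \<in> quiver_paths G" and v: "v \<in> carrier_vec (d u)"
  shows "path_mat d x (u, p @ q) *\<^sub>v v = path_mat d x (path_end G (u, p), q) *\<^sub>v (path_mat d x (u, p) *\<^sub>v v)"
proof -
  have p': "(u, p) \<in> quiver_paths G" "(path_end G (u, p), q) \<in> quiver_paths G"
    using p unfolding quiver_paths_append by auto
  show ?thesis unfolding path_mat_append[OF x p]
    by (rule assoc_mult_mat_vec[OF path_mat_carrier[OF x p'(2)] path_mat_carrier[OF x p'(1)] v])
qed

lemma mat_vec_in_subspace:
  assumes A: "A \<in> carrier_mat m n" and W: "lin_subspace m W" and cols: "\<And>r. r < n \<Longrightarrow> col A r \<in> W"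
    and v: "v \<in> carrier_vec n"
  shows "A *\<^sub>v v \<in> W"
  using image_coord_subset[OF A order_refl W] cols v unfolding coord_space_full by blast

lemma rad_gens_carrier:
  assumes x: "x \<in> rep_space d"
  shows "{col (path_mat d x p) r | p r. p \<in> quiver_paths G \<and>
     length (snd p) = l \<and> path_end G p = i \<and> r < d (fst p)} \<subseteq> carrier_vec (d i)"
proof
  fix v assume "v \<in> {col (path_mat d x p) r | p r. p \<in> quiver_paths G \<and>
     length (snd p) = l \<and> path_end G p = i \<and> r < d (fst p)}"
  then obtain u p r where "(u, p) \<in> quiver_paths G" "path_end G (u, p) = i" "v = col (path_mat d x (u, p)) r" by auto
  then show "v \<in> carrier_vec (d i)" using path_mat_carrier[OF x, of u p] by (intro carrier_vecI) simp
qed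

lemma rad_space_subspace: "x \<in> rep_space d \<Longrightarrow> lin_subspace (d i) (rad_space d x l i)"
  unfolding rad_space_def by (rule lspan_subspace[OF rad_gens_carrier])

lemma rad_space_least:
  assumes x: "x \<in> rep_space d" and W: "lin_subspace (d i) W"
    and gen: "\<And>u p v. (u, p) \<in> quiver_paths G \<Longrightarrow> length p = l \<Longrightarrow> path_end G (u, p) = i \<Longrightarrow>
      v \<in> carrier_vec (d u) \<Longrightarrow> path_mat d x (u, p) *\<^sub>v v \<in> W"
  shows "rad_space d x l i \<subseteq> W"
  unfolding rad_space_def
proof (rule lspan_least[OF W], rule subsetI)
  fix v assume "v \<in> {col (path_mat d x p) r | p r. p \<in> quiver_paths G \<and>
     length (snd p) = l \<and> path_end G p = i \<and> r < d (fst p)}"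
  then obtain u p r where p: "(u, p) \<in> quiver_paths G" "length p = l" "path_end G (u, p) = i" "r < d u"
    "v = col (path_mat d x (u, p)) r" by auto
  then show "v \<in> W"
    using gen[OF p(1-3), of "unit_vec (d u) r"] mat_mult_unit_vec[OF path_mat_carrier[OF x p(1)] p(4)] by simp
qed

lemma path_mat_in_rad_space:
  assumes x: "x \<in> rep_space d" and p: "(u, p) \<in> quiver_paths G" and v: "v \<in> carrier_vec (d u)"
  shows "path_mat d x (u, p) *\<^sub>v v \<in> rad_space d x (length p) (path_end G (u, p))"
proof (rule mat_vec_in_subspace[OF path_mat_carrier[OF x p] rad_space_subspace[OF x] _ v])
  fix r assume "r < d u"
  then show "col (path_mat d x (u, p)) r \<in> rad_space d x (length p) (path_end G (u, p))"
    unfolding rad_space_def using p by (intro subsetD[OF lspan_superset]) fastforce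
qed

lemma rad_space_0:
  assumes x: "x \<in> rep_space d" and i: "i \<in> verts G"
  shows "rad_space d x 0 i = carrier_vec (d i)"
proof
  show "rad_space d x 0 i \<subseteq> carrier_vec (d i)" using lin_subspaceD(1)[OF rad_space_subspace[OF x]] .
  show "carrier_vec (d i) \<subseteq> rad_space d x 0 i"
  proof
    fix v :: "'c vec" assume v: "v \<in> carrier_vec (d i)"
    show "v \<in> rad_space d x 0 i"
      using path_mat_in_rad_space[OF x _ v, of "[]"] v i quiver_paths_Nil[of i] by (simp add: path_mat_Nil)
  qed
qed

lemma rad_space_step:
  assumes x: "x \<in> rep_space d" and a: "a \<in> arcs G" and v: "v \<in> rad_space d x l (tail G a)"
  shows "x a *\<^sub>v v \<in> rad_space d x (Suc l) (head G a)"
proof -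
  note xa = rep_spaceD[OF x a]
  have "rad_space d x l (tail G a) \<subseteq> {v \<in> carrier_vec (d (tail G a)). x a *\<^sub>v v \<in> rad_space d x (Suc l) (head G a)}"
  proof (rule rad_space_least[OF x lin_subspace_vimage[OF xa rad_space_subspace[OF x]]])
    fix u p and v :: "'c vec" assume p: "(u, p) \<in> quiver_paths G" "length p = l" "path_end G (u, p) = tail G a"
      and v: "v \<in> carrier_vec (d u)"
    have pa: "(u, p @ [a]) \<in> quiver_paths G" unfolding quiver_paths_snoc using p a by simp
    note pm = path_mat_carrier[OF x p(1), unfolded p(3)]
    have "path_mat d x (u, p @ [a]) *\<^sub>v v = x a *\<^sub>v (path_mat d x (u, p) *\<^sub>v v)"
      unfolding path_mat_snoc by (rule assoc_mult_mat_vec[OF xa pm v])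
    moreover have "path_end G (u, p @ [a]) = head G a" unfolding path_end_eq by simp
    ultimately have "x a *\<^sub>v (path_mat d x (u, p) *\<^sub>v v) \<in> rad_space d x (Suc l) (head G a)"
      using path_mat_in_rad_space[OF x pa v] p(2) by simp
    then show "path_mat d x (u, p) *\<^sub>v v \<in> {v \<in> carrier_vec (d (tail G a)). x a *\<^sub>v v \<in> rad_space d x (Suc l) (head G a)}"
      using mult_mat_vec_carrier[OF pm v] by simp
  qed
  then show ?thesis using v by auto
qed

lemma rad_space_Suc_least:
  assumes x: "x \<in> rep_space d" and W: "lin_subspace (d i) W"
    and gen: "\<And>a v. a \<in> arcs G \<Longrightarrow> head G a = i \<Longrightarrow> v \<in> rad_space d x l (tail G a) \<Longrightarrow> x a *\<^sub>v v \<in> W"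
  shows "rad_space d x (Suc l) i \<subseteq> W"
proof (rule rad_space_least[OF x W])
  fix u p and v :: "'c vec" assume p: "(u, p) \<in> quiver_paths G" "length p = Suc l" "path_end G (u, p) = i"
    and v: "v \<in> carrier_vec (d u)"
  obtain q a where q: "p = q @ [a]" using p(2) by (cases p rule: rev_cases) auto
  have qa: "(u, q) \<in> quiver_paths G" "a \<in> arcs G" "tail G a = path_end G (u, q)" "head G a = i" "length q = l"
    using p unfolding q quiver_paths_snoc path_end_eq by auto
  have "path_mat d x (u, p) *\<^sub>v v = x a *\<^sub>v (path_mat d x (u, q) *\<^sub>v v)"
    unfolding q path_mat_snoc
    by (rule assoc_mult_mat_vec[OF _ path_mat_carrier[OF x qa(1)] v]) (use rep_spaceD[OF x qa(2)] qa(3) in simp)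
  then show "path_mat d x (u, p) *\<^sub>v v \<in> W"
    using gen[OF qa(2,4)] path_mat_in_rad_space[OF x qa(1) v] qa(3,5) by simp
qed

lemma soc_space_subspace:
  assumes x: "x \<in> rep_space d"
  shows "lin_subspace (d i) (soc_space d x l i)"
proof -
  have "lin_subspace (d i) (carrier_vec (d i) \<inter>
    (\<Inter>p\<in>{p. (i, p) \<in> quiver_paths G \<and> length p = l}. {v \<in> carrier_vec (d i). path_mat d x (i, p) *\<^sub>v v \<in> {0\<^sub>v (d (path_end G (i, p)))}}))"
    by (rule lin_subspace_Inter, rule lin_subspace_vimage[OF _ lin_subspace_zero])
      (use path_mat_carrier[OF x] in auto)
  moreover have "carrier_vec (d i) \<inter>
    (\<Inter>p\<in>{p. (i, p) \<in> quiver_paths G \<and> length p = l}. {v \<in> carrier_vec (d i). path_mat d x (i, p) *\<^sub>v v \<in> {0\<^sub>v (d (path_end G (i, p)))}})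
    = soc_space d x l i" unfolding soc_space_def by auto
  ultimately show ?thesis by simp
qed

lemma soc_space_0: "soc_space d x 0 i = {0\<^sub>v (d i)}" if "i \<in> verts G"
  unfolding soc_space_def using that quiver_paths_Nil by (auto simp: path_mat_Nil)

lemma soc_space_step:
  assumes x: "x \<in> rep_space d" and a: "a \<in> arcs G" and v: "v \<in> soc_space d x (Suc l) (tail G a)"
  shows "x a *\<^sub>v v \<in> soc_space d x l (head G a)"
proof -
  note xa = rep_spaceD[OF x a]
  have vc: "v \<in> carrier_vec (d (tail G a))" using v unfolding soc_space_def by simp
  have pm1: "path_mat d x (tail G a, [a]) = x a" using path_mat_snoc[of d x "tail G a" "[]" a] xa by (simp add: path_mat_Nil)
  show ?thesis
  proof (rule soc_spaceI)
    show "x a *\<^sub>v v \<in> carrier_vec (d (head G a))" using xa vc by auto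
    fix p assume p: "(head G a, p) \<in> quiver_paths G" "length p = l"
    have ap: "(tail G a, [a] @ p) \<in> quiver_paths G" using p(1) a by (simp add: quiver_paths_Cons)
    have e: "path_end G (tail G a, [a] @ p) = path_end G (head G a, p)" unfolding path_end_append by simp
    have "path_mat d x (tail G a, [a] @ p) *\<^sub>v v = 0\<^sub>v (d (path_end G (tail G a, [a] @ p)))"
      using v ap p(2) unfolding soc_space_def by auto
    then show "path_mat d x (head G a, p) *\<^sub>v (x a *\<^sub>v v) = 0\<^sub>v (d (path_end G (head G a, p)))"
      unfolding path_mat_append_vec[OF x ap vc] e pm1 by simp
  qed
qed

text \<open>The radical filtration and the annihilator filtration are extremal among the graded filtrations
  that every arrow shifts by one: a filtration of this kind contains the radical filtration
  if it starts with the whole module (\<open>shifts_rad_space\<close>), and is contained in the annihilator filtration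
  if it ends with zero (\<open>shifts_soc_space\<close>).  If it does both within \<open>L + 1\<close> steps, the
  relations of the algebra hold (\<open>shifts_rep_variety\<close>).  This is how membership in the variety is
  checked for representations that are constructed below.\<close>

definition shifts :: "('a \<Rightarrow> nat) \<Rightarrow> ('b, 'k::field) rep \<Rightarrow> (nat \<Rightarrow> 'a \<Rightarrow> 'k vec set) \<Rightarrow> bool" where
  "shifts d x E \<longleftrightarrow> (\<forall>l. \<forall>a\<in>arcs G. \<forall>v\<in>E l (tail G a). x a *\<^sub>v v \<in> E (Suc l) (head G a))"

lemma shifts_path:
  assumes x: "x \<in> rep_space d" and E: "shifts d x E" "\<And>l i. i \<in> verts G \<Longrightarrow> E l i \<subseteq> carrier_vec (d i)"
    and p: "(u, p) \<in> quiver_paths G" and v: "v \<in> E l u"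
  shows "path_mat d x (u, p) *\<^sub>v v \<in> E (l + length p) (path_end G (u, p))"
  using p
proof (induction p rule: rev_induct)
  case Nil
  then have "v \<in> carrier_vec (d u)" using E(2) v quiver_paths_Nil by blast
  then show ?case using v by (simp add: path_mat_Nil)
next
  case (snoc a p)
  then have pa: "(u, p) \<in> quiver_paths G" "a \<in> arcs G" "tail G a = path_end G (u, p)"
    unfolding quiver_paths_snoc by auto
  have vc: "v \<in> carrier_vec (d u)" using E(2) v quiver_pathsD(1)[OF pa(1)] by blast
  have "path_mat d x (u, p @ [a]) *\<^sub>v v = x a *\<^sub>v (path_mat d x (u, p) *\<^sub>v v)"
    unfolding path_mat_snoc
    by (rule assoc_mult_mat_vec[OF _ path_mat_carrier[OF x pa(1)] vc]) (use rep_spaceD[OF x pa(2)] pa(3) in simp)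
  then show ?case using E(1) pa snoc.IH[OF pa(1)] unfolding shifts_def path_end_eq by (auto split: if_splits)
qed

lemma shifts_rad_space:
  assumes x: "x \<in> rep_space d" and E: "shifts d x E" "\<And>l i. i \<in> verts G \<Longrightarrow> lin_subspace (d i) (E l i)"
    and full: "\<And>i. i \<in> verts G \<Longrightarrow> E 0 i = carrier_vec (d i)" and i: "i \<in> verts G"
  shows "rad_space d x l i \<subseteq> E l i"
proof (rule rad_space_least[OF x E(2)[OF i]])
  fix u p and v :: "'c vec" assume p: "(u, p) \<in> quiver_paths G" "length p = l" "path_end G (u, p) = i" "v \<in> carrier_vec (d u)"
  have "path_mat d x (u, p) *\<^sub>v v \<in> E (0 + length p) (path_end G (u, p))"
    by (rule shifts_path[OF x E(1) lin_subspaceD(1)[OF E(2)] p(1)]) (use full quiver_pathsD(1)[OF p(1)] p(4) in auto)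
  then show "path_mat d x (u, p) *\<^sub>v v \<in> E l i" using p by simp
qed

lemma shifts_soc_space:
  assumes x: "x \<in> rep_space d" and E: "shifts d x E" "\<And>l i. i \<in> verts G \<Longrightarrow> lin_subspace (d i) (E l i)"
    and vanish: "\<And>i. i \<in> verts G \<Longrightarrow> E m i = {0\<^sub>v (d i)}" and i: "i \<in> verts G" and l: "l \<le> m"
  shows "E l i \<subseteq> soc_space d x (m - l) i"
proof
  fix v assume v: "v \<in> E l i"
  show "v \<in> soc_space d x (m - l) i"
  proof (rule soc_spaceI)
    show "v \<in> carrier_vec (d i)" using lin_subspaceD(5)[OF E(2)[OF i] v] .
    fix p assume p: "(i, p) \<in> quiver_paths G" "length p = m - l"
    have "path_mat d x (i, p) *\<^sub>v v \<in> E (l + length p) (path_end G (i, p))"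
      by (rule shifts_path[OF x E(1) lin_subspaceD(1)[OF E(2)] p(1) v])
    then show "path_mat d x (i, p) *\<^sub>v v = 0\<^sub>v (d (path_end G (i, p)))"
      using p l vanish quiver_pathsD(3)[OF p(1)] by simp
  qed
qed

lemma mat_eq_zeroI:
  assumes "A \<in> carrier_mat m n" "\<And>v. v \<in> carrier_vec n \<Longrightarrow> A *\<^sub>v v = 0\<^sub>v m"
  shows "A = (0\<^sub>m m n :: 'k::field mat)"
proof (rule mat_col_eqI)
  fix j assume "j < dim_col (0\<^sub>m m n :: 'k mat)"
  then have j: "j < n" by simp
  have "col A j = 0\<^sub>v m" using mat_mult_unit_vec[OF assms(1) j] assms(2)[of "unit_vec n j"] by simp
  then show "col A j = col (0\<^sub>m m n) j" using j by (intro eq_vecI) auto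
qed (use assms in auto)

lemma shifts_rep_variety:
  assumes x: "x \<in> rep_space d" and E: "shifts d x E" "\<And>l i. i \<in> verts G \<Longrightarrow> lin_subspace (d i) (E l i)"
    and full: "\<And>i. i \<in> verts G \<Longrightarrow> E 0 i = carrier_vec (d i)"
    and vanish: "\<And>i. i \<in> verts G \<Longrightarrow> E (L + 1) i = {0\<^sub>v (d i)}"
  shows "x \<in> rep_variety G L d"
  unfolding rep_variety_iff
proof (intro conjI ballI impI x)
  fix p assume p: "p \<in> quiver_paths G" "length (snd p) = L + 1"
  obtain u q where [simp]: "p = (u, q)" by force
  show "path_mat d x p = 0\<^sub>m (d (path_end G p)) (d (fst p))"
  proof (rule mat_eq_zeroI)
    show "path_mat d x p \<in> carrier_mat (d (path_end G p)) (d (fst p))" using path_mat_carrier[OF x] p(1) by simp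
    fix v :: "'c vec" assume v: "v \<in> carrier_vec (d (fst p))"
    have "path_mat d x (u, q) *\<^sub>v v \<in> E (0 + length q) (path_end G (u, q))"
      by (rule shifts_path[OF x E(1) lin_subspaceD(1)[OF E(2)]]) (use p v full quiver_pathsD(1) in auto)
    then show "path_mat d x p *\<^sub>v v = 0\<^sub>v (d (path_end G p))"
      using vanish quiver_pathsD(3) p by simp
  qed
qed

lemma rad_space_shifts: "x \<in> rep_space d \<Longrightarrow> shifts d x (rad_space d x)"
  unfolding shifts_def using rad_space_step by blast

lemma rad_space_vanish:
  assumes x: "x \<in> rep_variety G L d" and i: "i \<in> verts G" and l: "L < l"
  shows "rad_space d x l i = {0\<^sub>v (d i)}"
proof -
  have x': "x \<in> rep_space d" using x unfolding rep_variety_iff by auto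
  have "rad_space d x l i \<subseteq> {0\<^sub>v (d i)}"
  proof (rule rad_space_least[OF x' lin_subspace_zero])
    fix u p and v :: "'c vec" assume p: "(u, p) \<in> quiver_paths G" "length p = l" "path_end G (u, p) = i" "v \<in> carrier_vec (d u)"
    define q r where "q = take (L + 1) p" and "r = drop (L + 1) p"
    have qr: "p = q @ r" "length q = L + 1" unfolding q_def r_def using p l by auto
    note pq = p(1)[unfolded qr(1)]
    then have q: "(u, q) \<in> quiver_paths G" "(path_end G (u, q), r) \<in> quiver_paths G"
      unfolding quiver_paths_append by auto
    have "path_mat d x (u, q) = 0\<^sub>m (d (path_end G (u, q))) (d u)"
      using x q(1) qr(2) unfolding rep_variety_iff by force
    then have "path_mat d x (u, q) *\<^sub>v v = 0\<^sub>v (d (path_end G (u, q)))" using p(4) by (intro eq_vecI) auto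
    then have "path_mat d x (u, p) *\<^sub>v v = path_mat d x (path_end G (u, q), r) *\<^sub>v 0\<^sub>v (d (path_end G (u, q)))"
      using path_mat_append_vec[OF x' pq p(4)] qr(1) by simp
    also have "\<dots> = 0\<^sub>v (d (path_end G (path_end G (u, q), r)))"
      using path_mat_carrier[OF x' q(2)] by (intro eq_vecI) auto
    also have "path_end G (path_end G (u, q), r) = i" using p(3) unfolding qr(1) path_end_append .
    finally show "path_mat d x (u, p) *\<^sub>v v \<in> {0\<^sub>v (d i)}" by simp
  qed
  then show ?thesis using lin_subspaceD(2)[OF rad_space_subspace[OF x']] by auto
qed

lemma rad_space_mono:
  assumes x: "x \<in> rep_space d" and i: "i \<in> verts G" and l: "l \<le> m"
  shows "rad_space d x m i \<subseteq> rad_space d x l i"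
proof (rule rad_space_least[OF x rad_space_subspace[OF x]])
  fix u p and v :: "'c vec" assume p: "(u, p) \<in> quiver_paths G" "length p = m" "path_end G (u, p) = i" "v \<in> carrier_vec (d u)"
  define q r where "q = take (m - l) p" and "r = drop (m - l) p"
  have qr: "p = q @ r" "length r = l" unfolding q_def r_def using p l by auto
  note pq = p(1)[unfolded qr(1)]
  then have q: "(u, q) \<in> quiver_paths G" "(path_end G (u, q), r) \<in> quiver_paths G"
    unfolding quiver_paths_append by auto
  have "path_mat d x (u, p) *\<^sub>v v = path_mat d x (path_end G (u, q), r) *\<^sub>v (path_mat d x (u, q) *\<^sub>v v)"
    using path_mat_append_vec[OF x pq p(4)] qr(1) by simp
  moreover have "path_end G (path_end G (u, q), r) = i" using p(3) unfolding qr(1) path_end_append .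
  moreover have "path_mat d x (path_end G (u, q), r) *\<^sub>v (path_mat d x (u, q) *\<^sub>v v)
      \<in> rad_space d x (length r) (path_end G (path_end G (u, q), r))"
    by (rule path_mat_in_rad_space[OF x q(2) mult_mat_vec_carrier[OF path_mat_carrier[OF x q(1)] p(4)]])
  ultimately show "path_mat d x (u, p) *\<^sub>v v \<in> rad_space d x l i" using qr(2) by (simp only:)
qed

lemma soc_space_mono:
  assumes x: "x \<in> rep_space d" and l: "l \<le> m"
  shows "soc_space d x l i \<subseteq> soc_space d x m i"
proof
  fix v assume v: "v \<in> soc_space d x l i"
  then have vc: "v \<in> carrier_vec (d i)" unfolding soc_space_def by simp
  show "v \<in> soc_space d x m i"
  proof (rule soc_spaceI)
    show "v \<in> carrier_vec (d i)" by (rule vc)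
    fix p assume p: "(i, p) \<in> quiver_paths G" "length p = m"
    define q r where "q = take l p" and "r = drop l p"
    have qr: "p = q @ r" "length q = l" unfolding q_def r_def using p l by auto
    note pq = p(1)[unfolded qr(1)]
    then have q: "(i, q) \<in> quiver_paths G" "(path_end G (i, q), r) \<in> quiver_paths G"
      unfolding quiver_paths_append by auto
    have "path_mat d x (i, q) *\<^sub>v v = 0\<^sub>v (d (path_end G (i, q)))"
      using v q(1) qr(2) unfolding soc_space_def by auto
    then have "path_mat d x (i, p) *\<^sub>v v = path_mat d x (path_end G (i, q), r) *\<^sub>v 0\<^sub>v (d (path_end G (i, q)))"
      using path_mat_append_vec[OF x pq vc] qr(1) by simp
    also have "\<dots> = 0\<^sub>v (d (path_end G (path_end G (i, q), r)))"
      using path_mat_carrier[OF x q(2)] by (intro eq_vecI) auto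
    also have "path_end G (path_end G (i, q), r) = path_end G (i, p)" unfolding qr(1) path_end_append ..
    finally show "path_mat d x (i, p) *\<^sub>v v = 0\<^sub>v (d (path_end G (i, p)))" .
  qed
qed

lemma soc_space_full:
  assumes x: "x \<in> rep_variety G L d" and l: "L < l"
  shows "soc_space d x l i = carrier_vec (d i)"
proof -
  have x': "x \<in> rep_space d" using x unfolding rep_variety_iff by auto
  have "v \<in> soc_space d x (L + 1) i" if "v \<in> carrier_vec (d i)" for v
  proof (rule soc_spaceI)
    show "v \<in> carrier_vec (d i)" by (rule that)
    fix p assume "(i, p) \<in> quiver_paths G" "length p = L + 1"
    then have "path_mat d x (i, p) = 0\<^sub>m (d (path_end G (i, p))) (d i)"
      using x unfolding rep_variety_iff by force
    then show "path_mat d x (i, p) *\<^sub>v v = 0\<^sub>v (d (path_end G (i, p)))"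
      using that by (intro eq_vecI) auto
  qed
  then show ?thesis using soc_space_mono[OF x', of "L + 1" l i] l unfolding soc_space_def by auto
qed

section \<open>The layerings of the module of a representation\<close>

abbreviation rep_carrier :: "('a \<Rightarrow> nat) \<Rightarrow> ('a \<Rightarrow> 'k::field vec) set" where
  "rep_carrier d \<equiv> (\<Pi>\<^sub>E i\<in>verts G. carrier_vec (d i))"

lemma rep_module_sel:
  "carrier (rep_module G d x) = rep_carrier d"
  "\<zero>\<^bsub>rep_module G d x\<^esub> = (\<lambda>i\<in>verts G. 0\<^sub>v (d i))"
  "m \<oplus>\<^bsub>rep_module G d x\<^esub> m' = (\<lambda>i\<in>verts G. m i + m' i)"
  "c \<odot>\<^bsub>rep_module G d x\<^esub> m = the_elem ((\<lambda>f. path_algebra_act G d x f m) ` c)"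
  unfolding rep_module_def by simp_all

lemma act_index:
  assumes F: "finite F" "{p. f p \<noteq> 0} \<subseteq> F" and i: "i \<in> verts G" "r < d i"
  shows "path_algebra_act G d x f m i $ r =
    (\<Sum>p\<in>F. if path_end G p = i then f p * (path_mat d x p *\<^sub>v m (fst p)) $ r else 0)"
proof -
  have "path_algebra_act G d x f m i $ r =
    (\<Sum>p | f p \<noteq> 0 \<and> path_end G p = i. f p * (path_mat d x p *\<^sub>v m (fst p)) $ r)"
    using i unfolding path_algebra_act_def by simp
  also have "\<dots> = (\<Sum>p\<in>F. if path_end G p = i then f p * (path_mat d x p *\<^sub>v m (fst p)) $ r else 0)"
    using F by (intro sum.mono_neutral_cong_left) auto
  finally show ?thesis .
qed

lemma act_carrier: "path_algebra_act G d x f m \<in> rep_carrier d"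
  unfolding path_algebra_act_def by (auto simp: PiE_def)

lemma act_vec: "i \<in> verts G \<Longrightarrow> path_algebra_act G d x f m i \<in> carrier_vec (d i)"
  unfolding path_algebra_act_def by simp

lemma act_add:
  assumes f: "f \<in> carrier PA" and g: "g \<in> carrier PA" and i: "i \<in> verts G"
  shows "path_algebra_act G d x (\<lambda>p. f p + g p) m i = path_algebra_act G d x f m i + path_algebra_act G d x g m i"
proof (rule eq_vecI)
  fix r assume "r < dim_vec (path_algebra_act G d x f m i + path_algebra_act G d x g m i)"
  then have r: "r < d i" using act_vec[OF i, of d x g m] by auto
  define F where "F = {p. f p \<noteq> 0} \<union> {p. g p \<noteq> 0}"
  have F: "finite F" "{p. f p \<noteq> 0} \<subseteq> F" "{p. g p \<noteq> 0} \<subseteq> F" "{p. f p + g p \<noteq> 0} \<subseteq> F"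
    unfolding F_def using f g unfolding PA_carrier by auto
  show "path_algebra_act G d x (\<lambda>p. f p + g p) m i $ r =
      (path_algebra_act G d x f m i + path_algebra_act G d x g m i) $ r"
    using act_vec[OF i, of d x g m] r
    by (simp add: act_index[where d = d, OF F(1,2) i r] act_index[where d = d, OF F(1,3) i r] act_index[where d = d, OF F(1,4) i r]
        sum.distrib[symmetric] distrib_right if_distrib cong: if_cong)
qed (simp add: act_vec[OF i, THEN carrier_vecD])

lemma act_single:
  assumes x: "x \<in> rep_space d" and p: "p \<in> quiver_paths G" and m: "m \<in> rep_carrier d" and i: "i \<in> verts G"
  shows "path_algebra_act G d x (single_path p c) m i =
    (if path_end G p = i then c \<cdot>\<^sub>v (path_mat d x p *\<^sub>v m (fst p)) else 0\<^sub>v (d i))"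
proof (rule eq_vecI)
  obtain u q where [simp]: "p = (u, q)" by force
  have pm: "path_mat d x p \<in> carrier_mat (d (path_end G p)) (d (fst p))" using path_mat_carrier[OF x] p by simp
  fix r assume "r < dim_vec (if path_end G p = i then c \<cdot>\<^sub>v (path_mat d x p *\<^sub>v m (fst p)) else 0\<^sub>v (d i))"
  then have r: "r < d i" using pm by (auto split: if_splits)
  have "path_algebra_act G d x (single_path p c) m i $ r =
    (\<Sum>p'\<in>{p}. if path_end G p' = i then single_path p c p' * (path_mat d x p' *\<^sub>v m (fst p')) $ r else 0)"
    by (rule act_index[where d = d, OF _ _ i r]) (auto simp: single_path_def)
  then show "path_algebra_act G d x (single_path p c) m i $ r =
      (if path_end G p = i then c \<cdot>\<^sub>v (path_mat d x p *\<^sub>v m (fst p)) else 0\<^sub>v (d i)) $ r"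
    using pm r by (auto simp: single_path_def)
next
  have pm: "path_mat d x p \<in> carrier_mat (d (path_end G p)) (d (fst p))"
    using path_mat_carrier[OF x, of "fst p" "snd p"] p by simp
  show "dim_vec (path_algebra_act G d x (single_path p c) m i) =
      dim_vec (if path_end G p = i then c \<cdot>\<^sub>v (path_mat d x p *\<^sub>v m (fst p)) else 0\<^sub>v (d i))"
    using pm by (auto simp: act_vec[OF i, THEN carrier_vecD])
qed

lemma len_idealD:
  assumes "f \<in> len_ideal l" "f (u, p) \<noteq> 0"
  shows "(u, p) \<in> quiver_paths G" "l \<le> length p"
  using assms unfolding len_ideal_def PA_carrier by force+

lemma act_zero: "i \<in> verts G \<Longrightarrow> path_algebra_act G d x (\<lambda>_. 0) m i = 0\<^sub>v (d i)"
  unfolding path_algebra_act_def by (auto intro!: eq_vecI)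

text \<open>The action is additive in \<open>f\<close>, and a multiple of a single path acts through its path matrix.\<close>

lemma act_in_subspace:
  assumes x: "x \<in> rep_space d" and f: "f \<in> carrier PA" and m: "m \<in> rep_carrier d" and i: "i \<in> verts G"
    and W: "lin_subspace (d i) W"
    and gen: "\<And>p. f p \<noteq> 0 \<Longrightarrow> path_end G p = i \<Longrightarrow> path_mat d x p *\<^sub>v m (fst p) \<in> W"
  shows "path_algebra_act G d x f m i \<in> W"
proof -
  define A where "A = {g \<in> carrier PA. path_algebra_act G d x g m i \<in> W}"
  have "f \<in> A"
  proof (rule finite_support_closure)
    show "finite {p. f p \<noteq> 0}" using f unfolding PA_carrier by simp
    show "(\<lambda>_. 0) \<in> A" unfolding A_def using lin_subspaceD(2)[OF W] by (simp add: act_zero[OF i] PA_carrier)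
    fix g h assume gh: "g \<in> A" "h \<in> A"
    then have "(\<lambda>p. g p + h p) \<in> carrier PA" using PA_add_closed[of g h] unfolding A_def PA_add by simp
    then show "(\<lambda>p. g p + h p) \<in> A"
      using gh lin_subspaceD(3)[OF W] unfolding A_def by (simp add: act_add[OF _ _ i])
  next
    fix p assume p: "f p \<noteq> 0"
    then have pq: "p \<in> quiver_paths G" using f unfolding PA_carrier by auto
    show "single_path p (f p) \<in> A"
      unfolding A_def mem_Collect_eq act_single[OF x pq m i]
      using single_in_len_ideal[OF pq, of 0] gen[OF p] lin_subspaceD(2,4)[OF W] by (auto simp: len_ideal_0)
  qed
  then show ?thesis unfolding A_def by simp
qed

text \<open>The residue class may be replaced by any representative, as paths longer than \<open>L\<close> act as zero.\<close>

lemma smult_residue: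
  assumes x: "x \<in> rep_variety G L d" and f: "f \<in> carrier PA" and m: "m \<in> rep_carrier d"
  shows "residue L f \<odot>\<^bsub>rep_module G d x\<^esub> m = path_algebra_act G d x f m"
proof -
  interpret I: ideal "trunc_ideal G L :: (('a, 'b) qpath \<Rightarrow> 'c) set" PA by (rule ideal_trunc)
  have x': "x \<in> rep_space d" using x unfolding rep_variety_iff by simp
  have vanish: "path_algebra_act G d x h m i = 0\<^sub>v (d i)" if h: "h \<in> len_ideal (L + 1)" and i: "i \<in> verts G" for h i
  proof -
    have "path_algebra_act G d x h m i \<in> {0\<^sub>v (d i)}"
    proof (rule act_in_subspace[OF x' len_ideal_carrier[OF h] m i lin_subspace_zero])
      fix p assume p: "h p \<noteq> 0" "path_end G p = i"
      obtain u q where [simp]: "p = (u, q)" by force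
      have pq: "(u, q) \<in> quiver_paths G" "L < length q"
        using len_idealD[OF h, of u q] p(1) by auto
      have mu: "m u \<in> carrier_vec (d u)" using m quiver_pathsD(1)[OF pq(1)] by auto
      show "path_mat d x p *\<^sub>v m (fst p) \<in> {0\<^sub>v (d i)}"
        using path_mat_in_rad_space[OF x' pq(1) mu] rad_space_vanish[OF x i pq(2)] p(2) by simp
    qed
    then show ?thesis by simp
  qed
  have "the_elem ((\<lambda>f. path_algebra_act G d x f m) ` residue L f) = path_algebra_act G d x f m"
  proof (rule the_elem_image_unique)
    show "residue L f \<noteq> {}" using I.a_rcos_self[OF f] unfolding residue_def by (metis empty_iff)
    fix g assume "g \<in> residue L f"
    then obtain h where h: "h \<in> len_ideal (L + 1)" "g = (\<lambda>p. h p + f p)"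
      unfolding residue_def a_r_coset_def' trunc_ideal_eq PA_add by (elim UN_E) simp
    show "path_algebra_act G d x g m = path_algebra_act G d x f m"
    proof (rule PiE_ext[OF act_carrier act_carrier])
      fix i assume i: "i \<in> verts G"
      show "path_algebra_act G d x g m i = path_algebra_act G d x f m i"
        unfolding h(2) act_add[OF len_ideal_carrier[OF h(1)] f i] vanish[OF h(1) i]
        by (rule left_zero_vec[OF act_vec[OF i]])
    qed
  qed
  then show ?thesis unfolding rep_module_sel .
qed

text \<open>For the inclusion of the right hand side, \<open>m\<close> is the sum of its components at the vertices, and a
  component that is the image of \<open>v\<close> under a path \<open>p\<close> is obtained by letting \<open>p\<close> act on \<open>v\<close>.\<close>

lemma rad_power_eq:
  assumes x: "x \<in> rep_variety G L d"
  shows "rad_power G L d x l = {m \<in> rep_carrier d. \<forall>i\<in>verts G. m i \<in> rad_space d x l i}"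
proof -
  have x': "x \<in> rep_space d" using x unfolding rep_variety_iff by simp
  define N where "N = rad_power G L d x l"
  have N_eq: "N = ideal_smult (arrow_power L l) (rep_module G d x)"
    unfolding N_def rad_power_def jacobson_power_eq ..
  have add: "(\<lambda>i\<in>verts G. m i + m' i) \<in> N" if "m \<in> N" "m' \<in> N" for m m'
    using ideal_smult.sum[OF that[unfolded N_eq]] unfolding N_eq rep_module_sel .
  have act: "path_algebra_act G d x f m \<in> N" if f: "f \<in> len_ideal l" and m: "m \<in> rep_carrier d" for f m
  proof -
    have "residue L f \<odot>\<^bsub>rep_module G d x\<^esub> m \<in> N" unfolding N_eq
      by (rule ideal_smult.smult) (use f m in \<open>auto simp: arrow_power_def rep_module_sel(1)\<close>)
    then show ?thesis unfolding smult_residue[OF x len_ideal_carrier[OF f] m] .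
  qed
  show ?thesis unfolding N_def[symmetric]
  proof
    show "N \<subseteq> {m \<in> rep_carrier d. \<forall>i\<in>verts G. m i \<in> rad_space d x l i}"
    proof
      fix m assume "m \<in> N"
      then show "m \<in> {m \<in> rep_carrier d. \<forall>i\<in>verts G. m i \<in> rad_space d x l i}"
        unfolding N_eq
      proof induction
        case (smult a m)
        obtain f where f: "f \<in> len_ideal l" "a = residue L f" using smult(1) unfolding arrow_power_def by auto
        have m: "m \<in> rep_carrier d" using smult(2) unfolding rep_module_sel .
        have "path_algebra_act G d x f m i \<in> rad_space d x l i" if i: "i \<in> verts G" for i
        proof (rule act_in_subspace[OF x' len_ideal_carrier[OF f(1)] m i rad_space_subspace[OF x']])
          fix p assume p: "f p \<noteq> 0" "path_end G p = i"
          obtain u q where [simp]: "p = (u, q)" by force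
          have pq: "(u, q) \<in> quiver_paths G" "l \<le> length q"
            using len_idealD[OF f(1), of u q] p(1) by auto
          have mu: "m u \<in> carrier_vec (d u)" using m quiver_pathsD(1)[OF pq(1)] by auto
          show "path_mat d x p *\<^sub>v m (fst p) \<in> rad_space d x l i"
            using path_mat_in_rad_space[OF x' pq(1) mu] rad_space_mono[OF x' i pq(2)] p(2) by auto
        qed
        then show ?case using act_carrier
          unfolding f(2) smult_residue[OF x len_ideal_carrier[OF f(1)] m] by blast
      next
        case (sum m m')
        have "(\<lambda>i\<in>verts G. m i + m' i) \<in> rep_carrier d"
          by (rule PiE_I) (use sum.IH in \<open>auto intro!: add_carrier_vec\<close>)
        moreover have "\<forall>i\<in>verts G. (\<lambda>i\<in>verts G. m i + m' i) i \<in> rad_space d x l i"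
          using lin_subspaceD(3)[OF rad_space_subspace[OF x']] sum.IH by simp
        ultimately show ?case unfolding rep_module_sel by blast
      qed
    qed
    show "{m \<in> rep_carrier d. \<forall>i\<in>verts G. m i \<in> rad_space d x l i} \<subseteq> N"
    proof
      fix m assume m: "m \<in> {m \<in> rep_carrier d. \<forall>i\<in>verts G. m i \<in> rad_space d x l i}"
      \<comment> \<open>the element concentrated at the vertex \<open>i\<close> with value \<open>v\<close>\<close>
      define pt :: "'a \<Rightarrow> 'c vec \<Rightarrow> 'a \<Rightarrow> 'c vec"
        where "pt i v = (\<lambda>j\<in>verts G. if j = i then v else 0\<^sub>v (d j))" for i v
      have pt_carrier: "pt i v \<in> rep_carrier d" if "v \<in> carrier_vec (d i)" for i v
        unfolding pt_def using that by (auto simp: PiE_def)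
      have zero: "(\<lambda>i\<in>verts G. 0\<^sub>v (d i)) \<in> N"
      proof -
        have "path_algebra_act G d x (\<lambda>_. 0) m = (\<lambda>i\<in>verts G. 0\<^sub>v (d i))"
          unfolding path_algebra_act_def by (auto intro!: restrict_ext eq_vecI)
        moreover have "(\<lambda>_. 0 :: 'c) \<in> len_ideal l" unfolding len_ideal_def PA_carrier by simp
        ultimately show ?thesis using act[of "\<lambda>_. 0" m] m by auto
      qed
      have mi: "pt i (m i) \<in> N" if i: "i \<in> verts G" for i
      proof -
        \<comment> \<open>\<open>J\<^sup>l M\<close> is generated by sums only, so closure under scalars is built into the predicate\<close>
        define W where "W = {w \<in> carrier_vec (d i). \<forall>c. pt i (c \<cdot>\<^sub>v w) \<in> N}"
        have "rad_space d x l i \<subseteq> W"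
        proof (rule rad_space_least[OF x'])
          show "lin_subspace (d i) W"
            unfolding lin_subspace_def
          proof (intro conjI ballI allI)
            show "W \<subseteq> carrier_vec (d i)" unfolding W_def by auto
            have "pt i (0\<^sub>v (d i)) = (\<lambda>i\<in>verts G. 0\<^sub>v (d i))" unfolding pt_def by auto
            moreover have "c \<cdot>\<^sub>v 0\<^sub>v (d i) = (0\<^sub>v (d i) :: 'c vec)" for c by (intro eq_vecI) auto
            ultimately show "0\<^sub>v (d i) \<in> W" unfolding W_def using zero by simp
            fix v assume v: "v \<in> W"
            show "c \<cdot>\<^sub>v v \<in> W" for c using v unfolding W_def by (simp add: smult_smult_assoc)
            fix w assume w: "w \<in> W"
            have "pt i (c \<cdot>\<^sub>v (v + w)) \<in> N" for c
            proof -
              have "pt i (c \<cdot>\<^sub>v (v + w)) = (\<lambda>j\<in>verts G. pt i (c \<cdot>\<^sub>v v) j + pt i (c \<cdot>\<^sub>v w) j)"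
                unfolding pt_def using v w unfolding W_def by (auto intro!: restrict_ext smult_add_distrib_vec[of _ "d i"])
              then show ?thesis using add[of "pt i (c \<cdot>\<^sub>v v)" "pt i (c \<cdot>\<^sub>v w)"] v w unfolding W_def by simp
            qed
            then show "v + w \<in> W" using v w unfolding W_def by simp
          qed
          fix u p and v :: "'c vec" assume p: "(u, p) \<in> quiver_paths G" "length p = l" "path_end G (u, p) = i" "v \<in> carrier_vec (d u)"
          have pm: "path_mat d x (u, p) *\<^sub>v v \<in> carrier_vec (d i)"
            using mult_mat_vec_carrier[OF path_mat_carrier[OF x' p(1)] p(4)] p(3) by simp
          have "pt i (c \<cdot>\<^sub>v (path_mat d x (u, p) *\<^sub>v v)) \<in> N" for c
          proof -
            have "path_algebra_act G d x (single_path (u, p) c) (pt u v) = pt i (c \<cdot>\<^sub>v (path_mat d x (u, p) *\<^sub>v v))"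
            proof (rule PiE_ext[OF act_carrier pt_carrier])
              show "c \<cdot>\<^sub>v (path_mat d x (u, p) *\<^sub>v v) \<in> carrier_vec (d i)" using pm by simp
              fix j assume j: "j \<in> verts G"
              have "pt u v u = v" unfolding pt_def using quiver_pathsD(1)[OF p(1)] by simp
              then show "path_algebra_act G d x (single_path (u, p) c) (pt u v) j = pt i (c \<cdot>\<^sub>v (path_mat d x (u, p) *\<^sub>v v)) j"
                unfolding act_single[OF x' p(1) pt_carrier[OF p(4)] j] using p(3) j by (auto simp: pt_def)
            qed
            then show ?thesis
              using act[OF single_in_len_ideal[OF p(1), of l c] pt_carrier[OF p(4)]] p(2) by simp
          qed
          then show "path_mat d x (u, p) *\<^sub>v v \<in> W" unfolding W_def using pm by simp
        qed
        then have "m i \<in> W" using m i by auto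
        then have "pt i (1 \<cdot>\<^sub>v m i) \<in> N" unfolding W_def by blast
        then show ?thesis by simp
      qed
      have "(\<lambda>j\<in>verts G. if j \<in> F then m j else 0\<^sub>v (d j)) \<in> N" if "finite F" "F \<subseteq> verts G" for F
        using that
      proof (induction F)
        case empty
        then show ?case using zero by (simp only: empty_iff if_False)
      next
        case (insert i F)
        have "(\<lambda>j\<in>verts G. if j \<in> insert i F then m j else 0\<^sub>v (d j)) =
          (\<lambda>j\<in>verts G. pt i (m i) j + (\<lambda>j\<in>verts G. if j \<in> F then m j else 0\<^sub>v (d j)) j)"
        proof (rule restrict_ext)
          fix j assume j: "j \<in> verts G"
          then have "m j \<in> carrier_vec (d j)" using m by auto
          then show "(if j \<in> insert i F then m j else 0\<^sub>v (d j)) =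
              pt i (m i) j + (\<lambda>j\<in>verts G. if j \<in> F then m j else 0\<^sub>v (d j)) j"
            unfolding pt_def using insert.hyps j by auto
        qed
        moreover have "i \<in> verts G" "F \<subseteq> verts G" using insert.prems by auto
        ultimately show ?case using add[OF mi insert.IH] by (simp only:)
      qed
      from this[OF finite_verts order_refl]
      have "(\<lambda>j\<in>verts G. if j \<in> verts G then m j else 0\<^sub>v (d j)) \<in> N" .
      moreover have "(\<lambda>j\<in>verts G. if j \<in> verts G then m j else 0\<^sub>v (d j)) = m"
        using m by (auto simp: PiE_def extensional_def fun_eq_iff)
      ultimately show "m \<in> N" by simp
    qed
  qed
qed

lemma jacobson_ann_eq:
  assumes x: "x \<in> rep_variety G L d"
  shows "jacobson_ann G L d x l = {m \<in> rep_carrier d. \<forall>i\<in>verts G. m i \<in> soc_space d x l i}"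
proof -
  have x': "x \<in> rep_space d" using x unfolding rep_variety_iff by simp
  have "(\<forall>a\<in>arrow_power L l. a \<odot>\<^bsub>rep_module G d x\<^esub> m = (\<lambda>i\<in>verts G. 0\<^sub>v (d i))) \<longleftrightarrow>
      (\<forall>i\<in>verts G. m i \<in> soc_space d x l i)" if m: "m \<in> rep_carrier d" for m
  proof
    assume ann: "\<forall>a\<in>arrow_power L l. a \<odot>\<^bsub>rep_module G d x\<^esub> m = (\<lambda>i\<in>verts G. 0\<^sub>v (d i))"
    show "\<forall>i\<in>verts G. m i \<in> soc_space d x l i"
    proof
      fix i assume i: "i \<in> verts G"
      show "m i \<in> soc_space d x l i"
      proof (rule soc_spaceI)
        show mi: "m i \<in> carrier_vec (d i)" using m i by auto
        fix p assume p: "(i, p) \<in> quiver_paths G" "length p = l"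
        note s = single_in_len_ideal[OF p(1), of l 1]
        note e = quiver_pathsD(3)[OF p(1)]
        have "residue L (single_path (i, p) 1) \<odot>\<^bsub>rep_module G d x\<^esub> m = (\<lambda>i\<in>verts G. 0\<^sub>v (d i))"
          using ann s p(2) unfolding arrow_power_def by auto
        then have "path_algebra_act G d x (single_path (i, p) 1) m (path_end G (i, p)) = 0\<^sub>v (d (path_end G (i, p)))"
          using smult_residue[OF x len_ideal_carrier[OF s] m] p(2) e by simp
        then show "path_mat d x (i, p) *\<^sub>v m i = 0\<^sub>v (d (path_end G (i, p)))"
          unfolding act_single[OF x' p(1) m e] by simp
      qed
    qed
  next
    assume soc: "\<forall>i\<in>verts G. m i \<in> soc_space d x l i"
    show "\<forall>a\<in>arrow_power L l. a \<odot>\<^bsub>rep_module G d x\<^esub> m = (\<lambda>i\<in>verts G. 0\<^sub>v (d i))"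
    proof
      fix a :: "(('a, 'b) qpath \<Rightarrow> 'c) set" assume "a \<in> arrow_power L l"
      then obtain f where f: "f \<in> len_ideal l" "a = residue L f" unfolding arrow_power_def by auto
      have "path_algebra_act G d x f m i \<in> {0\<^sub>v (d i)}" if i: "i \<in> verts G" for i
      proof (rule act_in_subspace[OF x' len_ideal_carrier[OF f(1)] m i lin_subspace_zero])
        fix p assume p: "f p \<noteq> 0" "path_end G p = i"
        obtain u q where [simp]: "p = (u, q)" by force
        have pq: "(u, q) \<in> quiver_paths G" "l \<le> length q"
          using len_idealD[OF f(1), of u q] p(1) by auto
        have "m u \<in> soc_space d x (length q) u"
          using soc quiver_pathsD(1)[OF pq(1)] soc_space_mono[OF x' pq(2)] by blast
        then show "path_mat d x p *\<^sub>v m (fst p) \<in> {0\<^sub>v (d i)}"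
          using pq(1) p(2) unfolding soc_space_def by auto
      qed
      then have "path_algebra_act G d x f m = (\<lambda>i\<in>verts G. 0\<^sub>v (d i))"
        using act_carrier[of d x f m] by (auto simp: PiE_def extensional_def fun_eq_iff)
      then show "a \<odot>\<^bsub>rep_module G d x\<^esub> m = (\<lambda>i\<in>verts G. 0\<^sub>v (d i))"
        unfolding f(2) smult_residue[OF x len_ideal_carrier[OF f(1)] m] .
    qed
  qed
  then show ?thesis
    unfolding jacobson_ann_def module_ann_def jacobson_power_eq rep_module_sel(1,2) by blast
qed

lemma vertex_dim_graded:
  assumes W: "\<And>j. j \<in> verts G \<Longrightarrow> lin_subspace (d j) (W j)" and i: "i \<in> verts G"
  shows "vertex_dim d {m \<in> rep_carrier d. \<forall>j\<in>verts G. m j \<in> W j} i = ldim (d i) (W i)"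
proof -
  have "(\<lambda>m. m i) ` {m \<in> rep_carrier d. \<forall>j\<in>verts G. m j \<in> W j} = W i"
  proof
    show "W i \<subseteq> (\<lambda>m. m i) ` {m \<in> rep_carrier d. \<forall>j\<in>verts G. m j \<in> W j}"
    proof
      fix w assume w: "w \<in> W i"
      show "w \<in> (\<lambda>m. m i) ` {m \<in> rep_carrier d. \<forall>j\<in>verts G. m j \<in> W j}"
        by (rule image_eqI[of _ _ "\<lambda>j\<in>verts G. if j = i then w else 0\<^sub>v (d j)"])
          (use w i lin_subspaceD(2,5)[OF W] in auto)
    qed
  qed (use i in auto)
  then show ?thesis unfolding vertex_dim_def ldim_def by simp
qed

definition rad_dim :: "('a \<Rightarrow> nat) \<Rightarrow> ('b, 'k::field) rep \<Rightarrow> nat \<Rightarrow> 'a \<Rightarrow> nat" where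
  "rad_dim d x l i = ldim (d i) (rad_space d x l i)"

definition soc_dim :: "('a \<Rightarrow> nat) \<Rightarrow> ('b, 'k::field) rep \<Rightarrow> nat \<Rightarrow> 'a \<Rightarrow> nat" where
  "soc_dim d x l i = ldim (d i) (soc_space d x l i)"

lemma radical_layering_eq:
  assumes x: "x \<in> rep_variety G L d"
  shows "radical_layering G L d x =
    (\<lambda>l i. if l \<le> L \<and> i \<in> verts G then rad_dim d x l i - rad_dim d x (l + 1) i else 0)"
proof -
  have x': "x \<in> rep_space d" using x unfolding rep_variety_iff by simp
  show ?thesis
    unfolding radical_layering_def rad_power_eq[OF x] rad_dim_def
    using vertex_dim_graded[of d "rad_space d x l" for l, OF rad_space_subspace[OF x']] by (auto simp: fun_eq_iff)
qed

lemma socle_layering_eq: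
  assumes x: "x \<in> rep_variety G L d"
  shows "socle_layering G L d x =
    (\<lambda>l i. if l \<le> L \<and> i \<in> verts G then soc_dim d x (l + 1) i - soc_dim d x l i else 0)"
proof -
  have x': "x \<in> rep_space d" using x unfolding rep_variety_iff by simp
  show ?thesis
    unfolding socle_layering_def jacobson_ann_eq[OF x] soc_dim_def
    using vertex_dim_graded[of d "soc_space d x l" for l, OF soc_space_subspace[OF x']] by (auto simp: fun_eq_iff)
qed

section \<open>Dominance order and dimensions\<close>

lemma rep_variety_space: "x \<in> rep_variety G L d \<Longrightarrow> x \<in> rep_space d"
  unfolding rep_variety_iff by simp

lemma rad_dim_mono: "x \<in> rep_space d \<Longrightarrow> i \<in> verts G \<Longrightarrow> l \<le> m \<Longrightarrow> rad_dim d x m i \<le> rad_dim d x l i"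
  unfolding rad_dim_def by (intro ldim_mono rad_space_subspace rad_space_mono)

lemma soc_dim_mono: "x \<in> rep_space d \<Longrightarrow> l \<le> m \<Longrightarrow> soc_dim d x l i \<le> soc_dim d x m i"
  unfolding soc_dim_def by (intro ldim_mono soc_space_subspace soc_space_mono)

lemma rad_dim_0: "x \<in> rep_space d \<Longrightarrow> i \<in> verts G \<Longrightarrow> rad_dim d x 0 i = d i"
  unfolding rad_dim_def by (simp add: rad_space_0 ldim_carrier)

lemma soc_dim_0: "i \<in> verts G \<Longrightarrow> soc_dim d x 0 i = 0"
  unfolding soc_dim_def by (simp add: soc_space_0 ldim_zero)

lemma rad_dim_vanish: "x \<in> rep_variety G L d \<Longrightarrow> i \<in> verts G \<Longrightarrow> L < l \<Longrightarrow> rad_dim d x l i = 0"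
  unfolding rad_dim_def by (simp add: rad_space_vanish ldim_zero)

lemma soc_dim_full: "x \<in> rep_variety G L d \<Longrightarrow> L < l \<Longrightarrow> soc_dim d x l i = d i"
  unfolding soc_dim_def by (simp add: soc_space_full ldim_carrier)

lemma radical_layering_sum:
  assumes x: "x \<in> rep_variety G L d" and i: "i \<in> verts G" and l: "l \<le> L"
  shows "(\<Sum>j\<le>l. radical_layering G L d x j i) = d i - rad_dim d x (Suc l) i"
  using l
proof (induction l)
  case 0
  then show ?case using i rad_dim_0[OF rep_variety_space[OF x] i] by (simp add: radical_layering_eq[OF x])
next
  case (Suc l)
  have "rad_dim d x (Suc (Suc l)) i \<le> rad_dim d x (Suc l) i" "rad_dim d x (Suc l) i \<le> d i"
    using rad_dim_mono[OF rep_variety_space[OF x] i] rad_dim_0[OF rep_variety_space[OF x] i]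
    by (auto, metis le0)
  then show ?case using Suc i by (simp add: radical_layering_eq[OF x])
qed

lemma socle_layering_sum:
  assumes x: "x \<in> rep_variety G L d" and i: "i \<in> verts G" and l: "l \<le> L"
  shows "(\<Sum>j\<le>l. socle_layering G L d x j i) = soc_dim d x (Suc l) i"
  using l
proof (induction l)
  case 0
  then show ?case using i soc_dim_0[OF i, of d x] by (simp add: socle_layering_eq[OF x])
next
  case (Suc l)
  have "soc_dim d x (Suc l) i \<le> soc_dim d x (Suc (Suc l)) i"
    using soc_dim_mono[OF rep_variety_space[OF x]] by auto
  then show ?case using Suc i by (simp add: socle_layering_eq[OF x])
qed

lemma radical_layering_Seqs:
  assumes x: "x \<in> rep_variety G L d"
  shows "radical_layering G L d x \<in> Seqs G L d"
proof -
  have "(\<Sum>l\<le>L. radical_layering G L d x l i) = d i" if "i \<in> verts G" for i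
    using radical_layering_sum[OF x that order_refl] rad_dim_vanish[OF x that] by simp
  then show ?thesis unfolding Seqs_def by (auto simp: radical_layering_eq[OF x])
qed

lemma finite_Seqs: "finite (Seqs G L d)"
proof -
  define B where "B = Max (insert 0 (d ` verts G))"
  have "Seqs G L d \<subseteq> (\<lambda>f l i. if l \<le> L \<and> i \<in> verts G then f (l, i) else 0) ` (({..L} \<times> verts G) \<rightarrow>\<^sub>E {..B})"
  proof
    fix S assume S: "S \<in> Seqs G L d"
    have "S l i \<le> B" if "l \<le> L" "i \<in> verts G" for l i
    proof -
      have "S l i \<le> (\<Sum>l\<le>L. S l i)" by (rule member_le_sum) (use that in auto)
      also have "\<dots> = d i" using S that unfolding Seqs_def by auto
      also have "\<dots> \<le> B" unfolding B_def using that by (intro Max_ge) (use finite_verts in auto)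
      finally show ?thesis .
    qed
    then show "S \<in> (\<lambda>f l i. if l \<le> L \<and> i \<in> verts G then f (l, i) else 0) ` (({..L} \<times> verts G) \<rightarrow>\<^sub>E {..B})"
      using S by (intro image_eqI[of _ _ "restrict (\<lambda>(l, i). S l i) ({..L} \<times> verts G)"])
        (auto simp: fun_eq_iff Seqs_def)
  qed
  moreover have "finite (({..L} \<times> verts G) \<rightarrow>\<^sub>E {..B})" using finite_verts by (intro finite_PiE) auto
  ultimately show ?thesis by (meson finite_surj)
qed

text \<open>The partial sums of the radical layering are the codimensions of the radicals, so the order is
  reversed.\<close>

lemma rad_dominance_iff:
  assumes x: "x \<in> rep_variety G L d" and y: "y \<in> rep_variety G L d"
  shows "dominance_le G L (radical_layering G L d x) (radical_layering G L d y) \<longleftrightarrow>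
    (\<forall>l. \<forall>i\<in>verts G. rad_dim d y l i \<le> rad_dim d x l i)"
proof -
  note x' = rep_variety_space[OF x] and y' = rep_variety_space[OF y]
  have le: "rad_dim d x l i \<le> d i" "rad_dim d y l i \<le> d i" if "i \<in> verts G" for l i
    using rad_dim_mono[OF x' that le0, of l] rad_dim_mono[OF y' that le0, of l]
      rad_dim_0[OF x' that] rad_dim_0[OF y' that] by auto
  have "dominance_le G L (radical_layering G L d x) (radical_layering G L d y) \<longleftrightarrow>
    (\<forall>l\<le>L. \<forall>i\<in>verts G. d i - rad_dim d x (Suc l) i \<le> d i - rad_dim d y (Suc l) i)"
    unfolding dominance_le_def by (simp add: radical_layering_sum[OF x] radical_layering_sum[OF y])
  also have "\<dots> \<longleftrightarrow> (\<forall>l\<le>L. \<forall>i\<in>verts G. rad_dim d y (Suc l) i \<le> rad_dim d x (Suc l) i)"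
    using le by (simp add: le_diff_iff')
  also have "\<dots> \<longleftrightarrow> (\<forall>l. \<forall>i\<in>verts G. rad_dim d y l i \<le> rad_dim d x l i)"
  proof
    assume a: "\<forall>l\<le>L. \<forall>i\<in>verts G. rad_dim d y (Suc l) i \<le> rad_dim d x (Suc l) i"
    show "\<forall>l. \<forall>i\<in>verts G. rad_dim d y l i \<le> rad_dim d x l i"
    proof (intro allI ballI)
      fix l i assume i: "i \<in> verts G"
      show "rad_dim d y l i \<le> rad_dim d x l i"
      proof (cases l)
        case 0
        then show ?thesis using rad_dim_0[OF x' i] rad_dim_0[OF y' i] by simp
      next
        case (Suc k)
        then show ?thesis using a i rad_dim_vanish[OF y i, of l] by (cases "k \<le> L") auto
      qed
    qed
  qed simp
  finally show ?thesis .
qed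

lemma soc_dominance_iff:
  assumes x: "x \<in> rep_variety G L d" and y: "y \<in> rep_variety G L d"
  shows "dominance_le G L (socle_layering G L d x) (socle_layering G L d y) \<longleftrightarrow>
    (\<forall>l. \<forall>i\<in>verts G. soc_dim d x l i \<le> soc_dim d y l i)"
proof -
  have "dominance_le G L (socle_layering G L d x) (socle_layering G L d y) \<longleftrightarrow>
    (\<forall>l\<le>L. \<forall>i\<in>verts G. soc_dim d x (Suc l) i \<le> soc_dim d y (Suc l) i)"
    unfolding dominance_le_def by (simp add: socle_layering_sum[OF x] socle_layering_sum[OF y])
  also have "\<dots> \<longleftrightarrow> (\<forall>l. \<forall>i\<in>verts G. soc_dim d x l i \<le> soc_dim d y l i)"
  proof
    assume a: "\<forall>l\<le>L. \<forall>i\<in>verts G. soc_dim d x (Suc l) i \<le> soc_dim d y (Suc l) i"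
    show "\<forall>l. \<forall>i\<in>verts G. soc_dim d x l i \<le> soc_dim d y l i"
    proof (intro allI ballI)
      fix l i assume i: "i \<in> verts G"
      show "soc_dim d x l i \<le> soc_dim d y l i"
      proof (cases l)
        case 0
        then show ?thesis using soc_dim_0[OF i, of d x] by simp
      next
        case (Suc k)
        then show ?thesis using a i soc_dim_full[OF x, of l] soc_dim_full[OF y, of l] by (cases "k \<le> L") auto
      qed
    qed
  qed simp
  finally show ?thesis .
qed

lemma rad_eq_iff:
  assumes x: "x \<in> rep_variety G L d" and y: "y \<in> rep_variety G L d"
  shows "radical_layering G L d x = radical_layering G L d y \<longleftrightarrow>
    (\<forall>l. \<forall>i\<in>verts G. rad_dim d x l i = rad_dim d y l i)"
proof
  assume "radical_layering G L d x = radical_layering G L d y"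
  then have "dominance_le G L (radical_layering G L d x) (radical_layering G L d y)"
    "dominance_le G L (radical_layering G L d y) (radical_layering G L d x)"
    unfolding dominance_le_def by auto
  then show "\<forall>l. \<forall>i\<in>verts G. rad_dim d x l i = rad_dim d y l i"
    unfolding rad_dominance_iff[OF x y] rad_dominance_iff[OF y x] by (meson antisym)
next
  assume "\<forall>l. \<forall>i\<in>verts G. rad_dim d x l i = rad_dim d y l i"
  then show "radical_layering G L d x = radical_layering G L d y"
    unfolding radical_layering_eq[OF x] radical_layering_eq[OF y] by (auto simp: fun_eq_iff)
qed

lemma soc_eq_iff:
  assumes x: "x \<in> rep_variety G L d" and y: "y \<in> rep_variety G L d"
  shows "socle_layering G L d x = socle_layering G L d y \<longleftrightarrow>
    (\<forall>l. \<forall>i\<in>verts G. soc_dim d x l i = soc_dim d y l i)"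
proof
  assume "socle_layering G L d x = socle_layering G L d y"
  then have "dominance_le G L (socle_layering G L d x) (socle_layering G L d y)"
    "dominance_le G L (socle_layering G L d y) (socle_layering G L d x)"
    unfolding dominance_le_def by auto
  then show "\<forall>l. \<forall>i\<in>verts G. soc_dim d x l i = soc_dim d y l i"
    unfolding soc_dominance_iff[OF x y] soc_dominance_iff[OF y x] by (meson antisym)
next
  assume "\<forall>l. \<forall>i\<in>verts G. soc_dim d x l i = soc_dim d y l i"
  then show "socle_layering G L d x = socle_layering G L d y"
    unfolding socle_layering_eq[OF x] socle_layering_eq[OF y] by (auto simp: fun_eq_iff)
qed

end

section \<open>Irreducible subsets\<close>

text \<open>Irreducibility of a subspace, in terms of open sets of the ambient space: any two that meet \<open>S\<close> meet
  within \<open>S\<close>.  This form passes easily to closures and to open subsets.\<close>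

definition irreducible_in :: "'x topology \<Rightarrow> 'x set \<Rightarrow> bool" where
  "irreducible_in X S \<longleftrightarrow> S \<subseteq> topspace X \<and> S \<noteq> {} \<and>
     (\<forall>U V. openin X U \<and> openin X V \<and> U \<inter> S \<noteq> {} \<and> V \<inter> S \<noteq> {} \<longrightarrow> U \<inter> V \<inter> S \<noteq> {})"

lemma irreducible_inD:
  assumes "irreducible_in X S" "openin X U" "openin X V" "x \<in> U" "x \<in> S" "y \<in> V" "y \<in> S"
  obtains z where "z \<in> U" "z \<in> V" "z \<in> S"
  using assms unfolding irreducible_in_def by blast

lemma irreducible_space_iff:
  assumes S: "S \<subseteq> topspace X"
  shows "irreducible_space (subtopology X S) \<longleftrightarrow> irreducible_in X S"
proof
  have ts: "topspace (subtopology X S) = S" using S by auto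
  assume irr: "irreducible_space (subtopology X S)"
  show "irreducible_in X S"
    unfolding irreducible_in_def
  proof (intro conjI allI impI S)
    show "S \<noteq> {}" using irr ts unfolding irreducible_space_def by simp
    fix U V assume UV: "openin X U \<and> openin X V \<and> U \<inter> S \<noteq> {} \<and> V \<inter> S \<noteq> {}"
    have cl: "closedin (subtopology X S) (S - W)" if "openin X W" for W
    proof -
      have "closedin X (topspace X - W)" by (rule closedin_diff[OF closedin_topspace that])
      moreover have "S - W = (topspace X - W) \<inter> S" using S by auto
      ultimately show ?thesis unfolding closedin_subtopology by blast
    qed
    show "U \<inter> V \<inter> S \<noteq> {}"
    proof
      assume "U \<inter> V \<inter> S = {}"
      then have "(S - U) \<union> (S - V) = S" by auto
      moreover have "A = S \<or> B = S"
        if "closedin (subtopology X S) A" "closedin (subtopology X S) B" "A \<union> B = S" for A B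
        using irr that unfolding irreducible_space_def ts by auto
      ultimately have "S - U = S \<or> S - V = S" using cl UV by auto
      then show False using UV by auto
    qed
  qed
next
  have ts: "topspace (subtopology X S) = S" using S by auto
  assume irr: "irreducible_in X S"
  show "irreducible_space (subtopology X S)"
    unfolding irreducible_space_def ts
  proof (intro conjI allI impI)
    show "S \<noteq> {}" using irr unfolding irreducible_in_def by simp
    fix A B assume AB: "closedin (subtopology X S) A \<and> closedin (subtopology X S) B \<and> A \<union> B = S"
    obtain C D where CD: "closedin X C" "A = C \<inter> S" "closedin X D" "B = D \<inter> S"
      using AB unfolding closedin_subtopology by auto
    show "A = S \<or> B = S"
    proof (rule ccontr)
      assume "\<not> (A = S \<or> B = S)"
      then obtain a b where ab: "a \<in> S" "a \<notin> C" "b \<in> S" "b \<notin> D" using CD by auto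
      have "openin X (topspace X - C)" "openin X (topspace X - D)" using CD by auto
      moreover have "a \<in> topspace X - C" "b \<in> topspace X - D" using ab S by auto
      ultimately obtain z where "z \<in> topspace X - C" "z \<in> topspace X - D" "z \<in> S"
        using irreducible_inD[OF irr] ab(1,3) by blast
      then show False using AB CD by auto
    qed
  qed
qed

lemma open_meets_closure:
  assumes "openin X U" "S \<subseteq> topspace X"
  shows "U \<inter> (X closure_of S) \<noteq> {} \<longleftrightarrow> U \<inter> S \<noteq> {}"
  using openin_Int_closure_of_eq_empty[OF assms(1), of S] by blast

lemma irreducible_in_closure:
  assumes "irreducible_in X S"
  shows "irreducible_in X (X closure_of S)"
proof -
  have S: "S \<subseteq> topspace X" "S \<noteq> {}" using assms unfolding irreducible_in_def by auto
  have sub: "S \<subseteq> X closure_of S" using closure_of_subset[OF S(1)] .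
  show ?thesis
    unfolding irreducible_in_def
  proof (intro conjI allI impI)
    show "X closure_of S \<subseteq> topspace X" by (rule closure_of_subset_topspace)
    show "X closure_of S \<noteq> {}" using S sub by auto
    fix U V assume "openin X U \<and> openin X V \<and> U \<inter> (X closure_of S) \<noteq> {} \<and> V \<inter> (X closure_of S) \<noteq> {}"
    then have "U \<inter> V \<inter> S \<noteq> {}"
      using assms open_meets_closure[OF _ S(1)] unfolding irreducible_in_def by metis
    then show "U \<inter> V \<inter> (X closure_of S) \<noteq> {}" using sub by auto
  qed
qed

lemma irreducible_in_open:
  assumes irr: "irreducible_in X S" and W: "openin X W" "W \<inter> S \<noteq> {}"
  shows "irreducible_in X (S \<inter> W)"
  unfolding irreducible_in_def
proof (intro conjI allI impI)
  show "S \<inter> W \<subseteq> topspace X" "S \<inter> W \<noteq> {}" using irr W unfolding irreducible_in_def by auto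
  fix U V assume a: "openin X U \<and> openin X V \<and> U \<inter> (S \<inter> W) \<noteq> {} \<and> V \<inter> (S \<inter> W) \<noteq> {}"
  then have "openin X (U \<inter> W)" "openin X (V \<inter> W)" using W by auto
  moreover have "(U \<inter> W) \<inter> S \<noteq> {}" "(V \<inter> W) \<inter> S \<noteq> {}" using a by auto
  ultimately have "(U \<inter> W) \<inter> (V \<inter> W) \<inter> S \<noteq> {}" using irr unfolding irreducible_in_def by metis
  then show "U \<inter> V \<inter> (S \<inter> W) \<noteq> {}" by auto
qed

lemma irreducible_in_finite_cover:
  assumes irr: "irreducible_in X S" and "finite \<C>" "\<And>C. C \<in> \<C> \<Longrightarrow> closedin X C" "S \<subseteq> \<Union>\<C>"
  shows "\<exists>C\<in>\<C>. S \<subseteq> C"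
proof (rule ccontr)
  assume nc: "\<not> (\<exists>C\<in>\<C>. S \<subseteq> C)"
  have St: "S \<subseteq> topspace X" "S \<noteq> {}" using irr unfolding irreducible_in_def by auto
  have "\<D> \<subseteq> \<C> \<Longrightarrow> openin X (topspace X - \<Union>\<D>) \<and> (topspace X - \<Union>\<D>) \<inter> S \<noteq> {}" if "finite \<D>" for \<D>
    using that
  proof (induction \<D>)
    case empty
    then show ?case using St by auto
  next
    case (insert C \<D>)
    have C1: "openin X (topspace X - C)" using insert.prems assms(3) by auto
    have "\<not> S \<subseteq> C" using insert.prems nc by auto
    then have C2: "(topspace X - C) \<inter> S \<noteq> {}" using St(1) by auto
    have D: "openin X (topspace X - \<Union>\<D>)" "(topspace X - \<Union>\<D>) \<inter> S \<noteq> {}" using insert by auto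
    have eq: "topspace X - \<Union>(insert C \<D>) = (topspace X - C) \<inter> (topspace X - \<Union>\<D>)" by auto
    have "(topspace X - C) \<inter> (topspace X - \<Union>\<D>) \<inter> S \<noteq> {}"
      using irr C1 C2 D unfolding irreducible_in_def by metis
    then show ?case unfolding eq using C1 D(1) by (metis openin_Int)
  qed
  from this[OF assms(2)] assms(4) show False by blast
qed

text \<open>In an irreducible set every nonempty open subset is dense.\<close>

lemma generically_of_open:
  assumes irr: "irreducible_in X S" and W: "openin X W" "W \<inter> S \<noteq> {}" and P: "\<And>x. x \<in> W \<Longrightarrow> x \<in> S \<Longrightarrow> P x"
  shows "generically X S P"
  unfolding generically_def
proof (intro exI[of _ "W \<inter> S"] conjI ballI)
  have St: "S \<subseteq> topspace X" using irr unfolding irreducible_in_def by auto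
  show "openin (subtopology X S) (W \<inter> S)" unfolding openin_subtopology using W by blast
  show "subtopology X S closure_of (W \<inter> S) = topspace (subtopology X S)"
    unfolding dense_intersects_open
  proof (intro allI impI)
    fix T assume T: "openin (subtopology X S) T \<and> T \<noteq> {}"
    then obtain U where U: "openin X U" "T = U \<inter> S" unfolding openin_subtopology by auto
    then have "W \<inter> U \<inter> S \<noteq> {}" using irr W T unfolding irreducible_in_def by metis
    then show "W \<inter> S \<inter> T \<noteq> {}" using U by auto
  qed
qed (use P in auto)

section \<open>Regular functions, semicontinuity and curves\<close>

text \<open>Covers at once the polynomial functions in one variable and the regular functions on the
  representation space, for which determinants and adjugates have to be handled.  Functions are
  compared on \<open>D\<close> only, since matrix entries are given by the usual formulas only for matrices of the
  right shape.\<close>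

definition function_algebra :: "'x set \<Rightarrow> (('x \<Rightarrow> 'k::field) \<Rightarrow> bool) \<Rightarrow> bool" where
  "function_algebra D R \<longleftrightarrow> (\<forall>c. R (\<lambda>_. c)) \<and>
     (\<forall>f g. R f \<longrightarrow> R g \<longrightarrow> R (\<lambda>x. f x + g x) \<and> R (\<lambda>x. f x * g x)) \<and>
     (\<forall>f g. R f \<longrightarrow> (\<forall>x\<in>D. g x = f x) \<longrightarrow> R g)"

lemma function_algebraD:
  assumes "function_algebra D R"
  shows "R (\<lambda>_. c)" "R f \<Longrightarrow> R g \<Longrightarrow> R (\<lambda>x. f x + g x)" "R f \<Longrightarrow> R g \<Longrightarrow> R (\<lambda>x. f x * g x)"
    "R f \<Longrightarrow> (\<And>x. x \<in> D \<Longrightarrow> g x = f x) \<Longrightarrow> R g"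
  using assms unfolding function_algebra_def by auto

lemma function_algebra_sum:
  assumes R: "function_algebra D R" and "\<And>i. i \<in> I \<Longrightarrow> R (f i)"
  shows "R (\<lambda>x. \<Sum>i\<in>I. f i x)"
  using assms(2)
  by (induction I rule: infinite_finite_induct) (auto intro: function_algebraD[OF R])

lemma function_algebra_prod:
  assumes R: "function_algebra D R" and "\<And>i. i \<in> I \<Longrightarrow> R (f i)"
  shows "R (\<lambda>x. \<Prod>i\<in>I. f i x)"
  using assms(2)
  by (induction I rule: infinite_finite_induct) (auto intro: function_algebraD[OF R])

lemma function_algebra_mat_mult:
  assumes R: "function_algebra D R"
    and A: "\<And>x. x \<in> D \<Longrightarrow> A x \<in> carrier_mat m n" "\<And>i j. i < m \<Longrightarrow> j < n \<Longrightarrow> R (\<lambda>x. A x $$ (i, j))"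
    and B: "\<And>x. x \<in> D \<Longrightarrow> B x \<in> carrier_mat n k" "\<And>i j. i < n \<Longrightarrow> j < k \<Longrightarrow> R (\<lambda>x. B x $$ (i, j))"
    and ij: "i < m" "j < k"
  shows "R (\<lambda>x. (A x * B x) $$ (i, j))"
proof (rule function_algebraD(4)[OF R])
  show "R (\<lambda>x. \<Sum>s\<in>{0..<n}. A x $$ (i, s) * B x $$ (s, j))"
    using A(2) B(2) ij by (intro function_algebra_sum[OF R] function_algebraD(3)[OF R]) auto
  fix x assume "x \<in> D"
  then show "(A x * B x) $$ (i, j) = (\<Sum>s\<in>{0..<n}. A x $$ (i, s) * B x $$ (s, j))"
    using A(1)[of x] B(1)[of x] ij by (simp add: scalar_prod_def)
qed

lemma function_algebra_det:
  assumes R: "function_algebra D R"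
    and A: "\<And>x. x \<in> D \<Longrightarrow> A x \<in> carrier_mat n n" "\<And>i j. i < n \<Longrightarrow> j < n \<Longrightarrow> R (\<lambda>x. A x $$ (i, j))"
  shows "R (\<lambda>x. det (A x))"
proof (rule function_algebraD(4)[OF R])
  show "R (\<lambda>x. \<Sum>p\<in>{p. p permutes {0..<n}}. signof p * (\<Prod>i = 0..<n. A x $$ (i, p i)))"
  proof (intro function_algebra_sum[OF R] function_algebraD(1,3)[OF R] function_algebra_prod[OF R] A(2))
    fix p i assume "p \<in> {p. p permutes {0..<n}}" "i \<in> {0..<n}"
    then show "i < n" "p i < n" using permutes_in_image[of p "{0..<n}" i] by auto
  qed
qed (use A(1) in \<open>auto simp: det_def'\<close>)

text \<open>Up to sign the entries of the adjugate are minors.\<close>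

lemma function_algebra_adj:
  assumes R: "function_algebra D R"
    and A: "\<And>x. x \<in> D \<Longrightarrow> A x \<in> carrier_mat n n" "\<And>i j. i < n \<Longrightarrow> j < n \<Longrightarrow> R (\<lambda>x. A x $$ (i, j))"
    and ij: "i < n" "j < n"
  shows "R (\<lambda>x. adj_mat (A x) $$ (i, j))"
proof (rule function_algebraD(4)[OF R])
  \<comment> \<open>the matrix \<open>A x\<close> without row \<open>j\<close> and column \<open>i\<close>\<close>
  define B where "B x = mat (n - 1) (n - 1) (\<lambda>(i', j'). A x $$ (if i' < j then i' else Suc i', if j' < i then j' else Suc j'))" for x
  show "R (\<lambda>x. (-1) ^ (j + i) * det (B x))"
  proof (intro function_algebraD(1,3)[OF R] function_algebra_det[OF R])
    fix i' j' assume "i' < n - 1" "j' < n - 1"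
    then show "R (\<lambda>x. B x $$ (i', j'))" unfolding B_def by (auto intro!: A(2))
  qed (simp add: B_def)
  fix x assume "x \<in> D"
  note Ax = A(1)[OF this]
  have "mat_delete (A x) j i = B x" unfolding mat_delete_def B_def using Ax by auto
  then show "adj_mat (A x) $$ (i, j) = (-1) ^ (j + i) * det (B x)"
    unfolding adj_mat_def cofactor_def using Ax ij by simp
qed

definition poly_fun :: "('k::field \<Rightarrow> 'k) \<Rightarrow> bool" where
  "poly_fun f \<longleftrightarrow> (\<exists>p. \<forall>t. f t = poly p t)"

lemma function_algebra_poly: "function_algebra UNIV poly_fun"
  unfolding function_algebra_def
proof (intro conjI allI impI)
  show "poly_fun (\<lambda>_. c)" for c :: 'a unfolding poly_fun_def by (intro exI[of _ "[:c:]"]) simp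
  fix f g :: "'a \<Rightarrow> 'a"
  show "poly_fun f \<Longrightarrow> \<forall>x\<in>UNIV. g x = f x \<Longrightarrow> poly_fun g" unfolding poly_fun_def by auto
  assume "poly_fun f" "poly_fun g"
  then obtain p q where pq: "\<And>t. f t = poly p t" "\<And>t. g t = poly q t" unfolding poly_fun_def by auto
  show "poly_fun (\<lambda>x. f x + g x)" unfolding poly_fun_def pq by (intro exI[of _ "p + q"]) simp
  show "poly_fun (\<lambda>x. f x * g x)" unfolding poly_fun_def pq by (intro exI[of _ "p * q"]) simp
qed

lemma poly_fun_interpolation: "poly_fun (\<lambda>t. (1 - t) * a + t * b)"
  unfolding poly_fun_def by (intro exI[of _ "[:a, b - a:]"]) (simp add: algebra_simps)

lemma infinite_alg_closed: "infinite (UNIV :: 'k::alg_closed_field set)"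
proof
  assume fin: "finite (UNIV :: 'k set)"
  \<comment> \<open>over a finite field \<open>p + 1\<close> has no root\<close>
  define p :: "'k poly" where "p = (\<Prod>a\<in>UNIV. [:- a, 1:])"
  have root: "poly p t = 0" for t
    unfolding p_def poly_prod using fin by (simp add: prod_zero_iff)
  have deg: "degree p = card (UNIV :: 'k set)"
    unfolding p_def by (subst degree_prod_eq_sum_degree) auto
  have "degree (p + 1) = degree p"
    by (rule degree_add_eq_left) (use deg fin in \<open>simp add: card_gt_0_iff\<close>)
  then have "0 < degree (p + 1)" using deg fin by (simp add: card_gt_0_iff)
  then obtain t where "poly (p + 1) t = 0" using alg_closed_imp_poly_has_root by blast
  then show False using root by simp
qed

lemma poly_fun_nonzero_common:
  fixes f g :: "'k::alg_closed_field \<Rightarrow> 'k"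
  assumes f: "poly_fun f" "f a \<noteq> 0" and g: "poly_fun g" "g b \<noteq> 0" and fin: "finite B"
  shows "\<exists>t. t \<notin> B \<and> f t \<noteq> 0 \<and> g t \<noteq> 0"
proof -
  obtain p q where pq: "\<And>t. f t = poly p t" "\<And>t. g t = poly q t" using f g unfolding poly_fun_def by auto
  have "p \<noteq> 0" "q \<noteq> 0" using f(2) g(2) pq by auto
  then have "finite (B \<union> {t. poly p t = 0} \<union> {t. poly q t = 0})" using fin poly_roots_finite by auto
  then obtain t where "t \<notin> B \<union> {t. poly p t = 0} \<union> {t. poly q t = 0}"
    using ex_new_if_finite[OF infinite_alg_closed] by metis
  then show ?thesis using pq by auto
qed

context fin_digraph
begin

definition regular_fun :: "('a \<Rightarrow> nat) \<Rightarrow> (('b, 'k::field) rep \<Rightarrow> 'k) \<Rightarrow> bool" where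
  "regular_fun d f \<longleftrightarrow> (\<exists>g\<in>rep_polys G d. \<forall>x\<in>rep_space d. f x = g x)"

lemma function_algebra_regular: "function_algebra (rep_space d) (regular_fun d)"
  unfolding function_algebra_def
proof (intro conjI allI impI)
  show "regular_fun d (\<lambda>_. c)" for c :: 'c
    unfolding regular_fun_def by (intro bexI[of _ "\<lambda>_. c"]) (auto intro: rep_polys.const)
  fix f g :: "('b, 'c) rep \<Rightarrow> 'c"
  show "regular_fun d f \<Longrightarrow> \<forall>x\<in>rep_space d. g x = f x \<Longrightarrow> regular_fun d g"
    unfolding regular_fun_def by auto
  assume "regular_fun d f" "regular_fun d g"
  then obtain p q where pq: "p \<in> rep_polys G d" "q \<in> rep_polys G d"
    "\<forall>x\<in>rep_space d. f x = p x" "\<forall>x\<in>rep_space d. g x = q x" unfolding regular_fun_def by auto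
  show "regular_fun d (\<lambda>x. f x + g x)" unfolding regular_fun_def
    using pq by (intro bexI[of _ "\<lambda>x. p x + q x"] rep_polys.add) auto
  show "regular_fun d (\<lambda>x. f x * g x)" unfolding regular_fun_def
    using pq by (intro bexI[of _ "\<lambda>x. p x * q x"] rep_polys.mult) auto
qed

lemma regular_path_mat:
  assumes p: "(u, p) \<in> quiver_paths G" and rs: "r < d (path_end G (u, p))" "s < d u"
  shows "regular_fun d (\<lambda>x :: ('b, 'k::field) rep. path_mat d x (u, p) $$ (r, s))"
  using p rs
proof (induction p arbitrary: r s rule: rev_induct)
  case Nil
  then show ?case by (simp add: path_mat_Nil function_algebraD(1)[OF function_algebra_regular])
next
  case (snoc a p)
  then have pa: "(u, p) \<in> quiver_paths G" "a \<in> arcs G" "tail G a = path_end G (u, p)"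
    unfolding quiver_paths_snoc by auto
  have e: "path_end G (u, p @ [a]) = head G a" unfolding path_end_eq by simp
  show ?case unfolding path_mat_snoc
  proof (rule function_algebra_mat_mult[OF function_algebra_regular])
    show "r < d (head G a)" "s < d u" using snoc.prems(2,3) unfolding e by auto
    show "x a \<in> carrier_mat (d (head G a)) (d (path_end G (u, p)))" if "x \<in> rep_space d" for x :: "('b, 'k) rep"
      using rep_spaceD[OF that pa(2)] unfolding pa(3) .
    show "path_mat d x (u, p) \<in> carrier_mat (d (path_end G (u, p))) (d u)" if "x \<in> rep_space d" for x :: "('b, 'k) rep"
      by (rule path_mat_carrier[OF that pa(1)])
    show "regular_fun d (\<lambda>x :: ('b, 'k) rep. path_mat d x (u, p) $$ (i, j))"
      if "i < d (path_end G (u, p))" "j < d u" for i j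
      by (rule snoc.IH[OF pa(1) that])
    show "regular_fun d (\<lambda>x :: ('b, 'k) rep. x a $$ (i, j))" if "i < d (head G a)" "j < d (path_end G (u, p))" for i j
      unfolding regular_fun_def using rep_polys.coord[OF pa(2), of i d j] that pa(3)
      by (intro bexI[of _ "\<lambda>x. x a $$ (i, j)"]) auto
  qed
qed

lemma open_regular_nonzero:
  assumes "\<And>f. f \<in> H \<Longrightarrow> regular_fun d f"
  shows "openin (zariski G L d) {x \<in> rep_variety G L d. \<exists>f\<in>H. f x \<noteq> 0}"
proof -
  define F where "F = {g \<in> rep_polys G d. \<exists>f\<in>H. \<forall>x\<in>rep_space d. f x = g x}"
  have "{x \<in> rep_variety G L d. \<exists>f\<in>H. f x \<noteq> 0} = rep_variety G L d - {x \<in> rep_variety G L d. \<forall>f\<in>F. f x = 0}"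
  proof (rule Set.set_eqI)
    fix x
    have "(\<exists>f\<in>H. f x \<noteq> 0) \<longleftrightarrow> (\<exists>g\<in>F. g x \<noteq> 0)" if x: "x \<in> rep_variety G L d"
    proof
      assume "\<exists>f\<in>H. f x \<noteq> 0"
      then obtain f where f: "f \<in> H" "f x \<noteq> 0" by auto
      obtain g where g: "g \<in> rep_polys G d" "\<forall>x\<in>rep_space d. f x = g x"
        using assms[OF f(1)] unfolding regular_fun_def by blast
      have "g \<in> F" unfolding F_def using g f(1) by blast
      moreover have "g x \<noteq> 0" using f(2) g(2) rep_variety_space[OF x] by simp
      ultimately show "\<exists>g\<in>F. g x \<noteq> 0" by blast
    next
      assume "\<exists>g\<in>F. g x \<noteq> 0"
      then obtain f g where "f \<in> H" "\<forall>x\<in>rep_space d. f x = g x" "g x \<noteq> 0" unfolding F_def by blast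
      then show "\<exists>f\<in>H. f x \<noteq> 0" using rep_variety_space[OF x] by metis
    qed
    then show "x \<in> {x \<in> rep_variety G L d. \<exists>f\<in>H. f x \<noteq> 0} \<longleftrightarrow>
        x \<in> rep_variety G L d - {x \<in> rep_variety G L d. \<forall>f\<in>F. f x = 0}" by auto
  qed
  moreover have "F \<subseteq> rep_polys G d" unfolding F_def by auto
  ultimately show ?thesis unfolding openin_zariski by blast
qed

text \<open>Semicontinuity: by \<open>ldim_lspan_ge_iff\<close> the bound holds iff one of the regular functions
  \<open>det (B X)\<close> does not vanish, where the columns of \<open>X\<close> are \<open>c\<close> of the given vectors and \<open>B\<close> is constant.\<close>

lemma open_span_dim:
  assumes w: "\<And>k x. k \<in> I \<Longrightarrow> x \<in> rep_space d \<Longrightarrow> (w k x :: 'k::field vec) \<in> carrier_vec n"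
    and reg: "\<And>k r. k \<in> I \<Longrightarrow> r < n \<Longrightarrow> regular_fun d (\<lambda>x. w k x $ r)"
  shows "openin (zariski G L d) {x \<in> rep_variety G L d. c \<le> ldim n (lspan n {w k x | k. k \<in> I})}"
proof -
  define H where "H = {(\<lambda>x. det (B * mat n c (\<lambda>(i, j). w (s j) x $ i))) | B s.
     B \<in> carrier_mat c n \<and> (\<forall>j<c. s j \<in> I)}"
  have regH: "regular_fun d f" if fH: "f \<in> H" for f
  proof -
    obtain B s where Bs: "f = (\<lambda>x. det (B * mat n c (\<lambda>(i, j). w (s j) x $ i)))"
      "B \<in> carrier_mat c n" "\<forall>j<c. s j \<in> I" using fH unfolding H_def by auto
    show ?thesis unfolding Bs(1)
    proof (intro function_algebra_det[OF function_algebra_regular] function_algebra_mat_mult[OF function_algebra_regular])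
      fix i j assume "i < n" "j < c"
      then show "regular_fun d (\<lambda>x. mat n c (\<lambda>(i, j). w (s j) x $ i) $$ (i, j))" using reg Bs(3) by simp
    qed (use Bs(2) in \<open>auto intro: function_algebraD(1)[OF function_algebra_regular]\<close>)
  qed
  have "c \<le> ldim n (lspan n {w k x | k. k \<in> I}) \<longleftrightarrow> (\<exists>f\<in>H. f x \<noteq> 0)" if x: "x \<in> rep_variety G L d" for x
  proof -
    have sub: "{w k x | k. k \<in> I} \<subseteq> carrier_vec n" using w rep_variety_space[OF x] by auto
    show ?thesis unfolding ldim_lspan_ge_iff[OF sub]
    proof
      assume "\<exists>v B. (\<forall>r<c. v r \<in> {w k x | k. k \<in> I}) \<and> B \<in> carrier_mat c n \<and> det (B * mat n c (\<lambda>(i, j). v j $ i)) \<noteq> 0"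
      then obtain v B where vB: "\<forall>r<c. v r \<in> {w k x | k. k \<in> I}" "B \<in> carrier_mat c n"
        "det (B * mat n c (\<lambda>(i, j). v j $ i)) \<noteq> 0" by blast
      have "\<forall>r. \<exists>k. r < c \<longrightarrow> k \<in> I \<and> v r = w k x" using vB(1) by blast
      then obtain s where s: "\<forall>r<c. s r \<in> I \<and> v r = w (s r) x" by metis
      have "mat n c (\<lambda>(i, j). v j $ i) = mat n c (\<lambda>(i, j). w (s j) x $ i)" using s by (intro eq_matI) auto
      then have "det (B * mat n c (\<lambda>(i, j). w (s j) x $ i)) \<noteq> 0" using vB(3) by simp
      moreover have "(\<lambda>x. det (B * mat n c (\<lambda>(i, j). w (s j) x $ i))) \<in> H"
        unfolding H_def using vB(2) s by blast
      ultimately show "\<exists>f\<in>H. f x \<noteq> 0" by (rule bexI)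
    next
      assume "\<exists>f\<in>H. f x \<noteq> 0"
      then obtain B s where "B \<in> carrier_mat c n" "\<forall>j<c. s j \<in> I"
        "det (B * mat n c (\<lambda>(i, j). w (s j) x $ i)) \<noteq> 0" unfolding H_def by auto
      then show "\<exists>v B. (\<forall>r<c. v r \<in> {w k x | k. k \<in> I}) \<and> B \<in> carrier_mat c n \<and> det (B * mat n c (\<lambda>(i, j). v j $ i)) \<noteq> 0"
        by (intro exI[of _ "\<lambda>r. w (s r) x"] exI[of _ B]) auto
    qed
  qed
  then have "{x \<in> rep_variety G L d. c \<le> ldim n (lspan n {w k x | k. k \<in> I})} =
    {x \<in> rep_variety G L d. \<exists>f\<in>H. f x \<noteq> 0}" by auto
  then show ?thesis using open_regular_nonzero[of H d L, OF regH] by simp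
qed

lemma open_rad_dim: "openin (zariski G L d) {x :: ('b, 'k::field) rep \<in> rep_variety G L d. c \<le> rad_dim d x l i}"
proof -
  define I where "I = {(p, r). p \<in> quiver_paths G \<and> length (snd p) = l \<and> path_end G p = i \<and> r < d (fst p)}"
  define w :: "('a, 'b) qpath \<times> nat \<Rightarrow> ('b, 'k) rep \<Rightarrow> 'k vec"
    where "w k x = col (path_mat d x (fst k)) (snd k)" for k x
  have pm: "path_mat d x (fst k) \<in> carrier_mat (d i) (d (fst (fst k)))" if "k \<in> I" "x \<in> rep_space d" for k and x :: "('b, 'k) rep"
    using that(1) path_mat_carrier[OF that(2), of "fst (fst k)" "snd (fst k)"]
    unfolding I_def by (cases k) (simp add: case_prod_beta)
  have "openin (zariski G L d) {x \<in> rep_variety G L d. c \<le> ldim (d i) (lspan (d i) {w k x | k. k \<in> I})}"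
  proof (rule open_span_dim)
    show "w k x \<in> carrier_vec (d i)" if "k \<in> I" "x \<in> rep_space d" for k x
      using pm[OF that] unfolding w_def by (intro carrier_vecI) simp
    fix k r assume k: "k \<in> I" "r < d i"
    obtain q s where k1: "k = (q, s)" by (rule prod.exhaust)
    obtain u p where k2: "q = (u, p)" by (rule prod.exhaust)
    note kk = k1[unfolded k2]
    have p: "(u, p) \<in> quiver_paths G" "path_end G (u, p) = i" "s < d u" using k(1) unfolding I_def kk by auto
    show "regular_fun d (\<lambda>x. w k x $ r)"
    proof (rule function_algebraD(4)[OF function_algebra_regular])
      show "regular_fun d (\<lambda>x :: ('b, 'k) rep. path_mat d x (u, p) $$ (r, s))"
        by (rule regular_path_mat[OF p(1)]) (use p k(2) in auto)
      fix x :: "('b, 'k) rep" assume "x \<in> rep_space d"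
      from pm[OF k(1) this] show "w k x $ r = path_mat d x (u, p) $$ (r, s)"
        unfolding w_def kk using p(3) k(2) by simp
    qed
  qed
  moreover have "{w k x | k. k \<in> I} = {col (path_mat d x p) r | p r. p \<in> quiver_paths G \<and>
     length (snd p) = l \<and> path_end G p = i \<and> r < d (fst p)}" for x
    unfolding I_def w_def by force
  ultimately show ?thesis unfolding rad_dim_def rad_space_def by simp
qed

lemma mat_vec_eq_zero_iff:
  assumes "A \<in> carrier_mat m n"
  shows "A *\<^sub>v v = 0\<^sub>v m \<longleftrightarrow> (\<forall>r<m. row A r \<bullet> v = 0)"
proof
  assume eq: "A *\<^sub>v v = 0\<^sub>v m"
  show "\<forall>r<m. row A r \<bullet> v = 0"
  proof (intro allI impI)
    fix r assume r: "r < m"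
    then have "(A *\<^sub>v v) $ r = row A r \<bullet> v" using assms by simp
    then show "row A r \<bullet> v = 0" unfolding eq using r by simp
  qed
qed (use assms in \<open>auto intro!: eq_vecI\<close>)

lemma soc_space_annihilator:
  assumes x: "x \<in> rep_space d"
  shows "soc_space d x l i = annihilator (d i) {row (path_mat d x (i, p)) r | p r. (i, p) \<in> quiver_paths G \<and>
     length p = l \<and> r < d (path_end G (i, p))}" (is "_ = annihilator _ ?R")
proof -
  have eq: "path_mat d x (i, p) *\<^sub>v v = 0\<^sub>v (d (path_end G (i, p))) \<longleftrightarrow>
      (\<forall>r<d (path_end G (i, p)). row (path_mat d x (i, p)) r \<bullet> v = 0)"
    if "(i, p) \<in> quiver_paths G" for p v
    by (rule mat_vec_eq_zero_iff[OF path_mat_carrier[OF x that]])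
  have R: "(\<forall>g\<in>?R. g \<bullet> v = 0) \<longleftrightarrow> (\<forall>p. (i, p) \<in> quiver_paths G \<and> length p = l \<longrightarrow>
      (\<forall>r<d (path_end G (i, p)). row (path_mat d x (i, p)) r \<bullet> v = 0))" for v
    by blast
  show ?thesis unfolding soc_space_def annihilator_def R using eq by (intro Collect_cong) simp
qed

text \<open>The annihilator of \<open>J\<^sup>l\<close> at \<open>i\<close> is the common kernel of path matrices, so an upper bound on its dimension
  is a lower bound on the dimension of the span of their rows.\<close>

lemma open_soc_dim: "openin (zariski G L d) {x :: ('b, 'k::field) rep \<in> rep_variety G L d. soc_dim d x l i \<le> c}"
proof -
  define I where "I = {(p, r). (i, p) \<in> quiver_paths G \<and> length p = l \<and> r < d (path_end G (i, p))}"
  define w :: "'b list \<times> nat \<Rightarrow> ('b, 'k) rep \<Rightarrow> 'k vec"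
    where "w k x = row (path_mat d x (i, fst k)) (snd k)" for k x
  have pm: "path_mat d x (i, fst k) \<in> carrier_mat (d (path_end G (i, fst k))) (d i)" if "k \<in> I" "x \<in> rep_space d" for k and x :: "('b, 'k) rep"
    using that(1) path_mat_carrier[OF that(2), of i "fst k"] unfolding I_def by (cases k) simp
  have wc: "w k x \<in> carrier_vec (d i)" if "k \<in> I" "x \<in> rep_space d" for k x
    using pm[OF that] unfolding w_def by (intro carrier_vecI) simp
  have "openin (zariski G L d) {x \<in> rep_variety G L d. d i - c \<le> ldim (d i) (lspan (d i) {w k x | k. k \<in> I})}"
  proof (rule open_span_dim[OF wc])
    fix k r assume k: "k \<in> I" "r < d i"
    obtain p s where kk: "k = (p, s)" by force
    have p: "(i, p) \<in> quiver_paths G" "s < d (path_end G (i, p))" using k(1) unfolding I_def kk by auto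
    show "regular_fun d (\<lambda>x. w k x $ r)"
    proof (rule function_algebraD(4)[OF function_algebra_regular])
      show "regular_fun d (\<lambda>x :: ('b, 'k) rep. path_mat d x (i, p) $$ (s, r))"
        by (rule regular_path_mat[OF p(1)]) (use p k(2) in auto)
      fix x :: "('b, 'k) rep" assume "x \<in> rep_space d"
      from pm[OF k(1) this] show "w k x $ r = path_mat d x (i, p) $$ (s, r)"
        unfolding w_def kk using p(2) k(2) by simp
    qed
  qed
  moreover have "d i - c \<le> ldim (d i) (lspan (d i) {w k x | k. k \<in> I}) \<longleftrightarrow> soc_dim d x l i \<le> c"
    if "x \<in> rep_variety G L d" for x
  proof -
    have x: "x \<in> rep_space d" using that by (rule rep_variety_space)
    have eq: "{w k x | k. k \<in> I} = {row (path_mat d x (i, p)) r | p r. (i, p) \<in> quiver_paths G \<and>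
        length p = l \<and> r < d (path_end G (i, p))}"
      unfolding I_def w_def by force
    have sub: "{w k x | k. k \<in> I} \<subseteq> carrier_vec (d i)" using wc x by auto
    have "soc_dim d x l i = d i - ldim (d i) (lspan (d i) {w k x | k. k \<in> I})"
      unfolding soc_dim_def soc_space_annihilator[OF x] eq[symmetric] by (rule ldim_annihilator[OF sub])
    then show ?thesis using ldim_le[OF lspan_subspace[OF sub]] by auto
  qed
  then have "{x \<in> rep_variety G L d. d i - c \<le> ldim (d i) (lspan (d i) {w k x | k. k \<in> I})} =
    {x \<in> rep_variety G L d. soc_dim d x l i \<le> c}" by auto
  ultimately show ?thesis by simp
qed

text \<open>Polynomial curves replace morphisms from irreducible parameter spaces.  A nonzero
  polynomial in one variable has finitely many zeros, and the field is infinite; so two open sets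
  that a curve meets are met at a common parameter, even if finitely many parameters are excluded.\<close>

definition poly_curve :: "('a \<Rightarrow> nat) \<Rightarrow> ('k::field \<Rightarrow> ('b, 'k) rep) \<Rightarrow> bool" where
  "poly_curve d \<gamma> \<longleftrightarrow> (\<forall>a\<in>arcs G. \<forall>r<d (head G a). \<forall>s<d (tail G a). poly_fun (\<lambda>t. \<gamma> t a $$ (r, s)))"

lemma poly_curve_comp:
  assumes "poly_curve d \<gamma>" "f \<in> rep_polys G d"
  shows "poly_fun (\<lambda>t. f (\<gamma> t))"
  using assms(2)
proof induction
  case (coord a r s)
  then show ?case using assms(1) unfolding poly_curve_def by blast
qed (auto intro: function_algebraD[OF function_algebra_poly])

lemma poly_curve_meets:
  fixes \<gamma> :: "'k::alg_closed_field \<Rightarrow> ('b, 'k) rep"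
  assumes \<gamma>: "poly_curve d \<gamma>" and U: "openin (zariski G L d) U" "\<gamma> a \<in> U"
    and V: "openin (zariski G L d) V" "\<gamma> b \<in> V"
    and fin: "finite B" and mem: "\<And>t. t \<notin> B \<Longrightarrow> \<gamma> t \<in> rep_variety G L d"
  obtains t where "t \<notin> B" "\<gamma> t \<in> U" "\<gamma> t \<in> V"
proof -
  obtain E F where E: "E \<subseteq> rep_polys G d" "U = rep_variety G L d - {x \<in> rep_variety G L d. \<forall>f\<in>E. f x = 0}"
    and F: "F \<subseteq> rep_polys G d" "V = rep_variety G L d - {x \<in> rep_variety G L d. \<forall>f\<in>F. f x = 0}"
    using U(1) V(1) unfolding openin_zariski by auto
  obtain f g where fg: "f \<in> E" "f (\<gamma> a) \<noteq> 0" "g \<in> F" "g (\<gamma> b) \<noteq> 0" using U(2) V(2) E F by auto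
  have "poly_fun (\<lambda>t. f (\<gamma> t))" "poly_fun (\<lambda>t. g (\<gamma> t))" using poly_curve_comp[OF \<gamma>] fg E F by auto
  then obtain t where "t \<notin> B" "f (\<gamma> t) \<noteq> 0" "g (\<gamma> t) \<noteq> 0"
    using poly_fun_nonzero_common[of "\<lambda>t. f (\<gamma> t)" a "\<lambda>t. g (\<gamma> t)" b B] fg fin by auto
  then show thesis using that[of t] mem[of t] fg E F by auto
qed

lemma irreducible_in_curves:
  assumes S: "S \<subseteq> rep_variety G L d" "S \<noteq> {}"
    and curve: "\<And>x y. x \<in> S \<Longrightarrow> y \<in> S \<Longrightarrow> \<exists>\<gamma> a b B. poly_curve d \<gamma> \<and> \<gamma> a = x \<and> \<gamma> b = y \<and>
      finite B \<and> (\<forall>t. t \<notin> B \<longrightarrow> \<gamma> t \<in> S)"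
  shows "irreducible_in (zariski G L d) (S :: ('b, 'k::alg_closed_field) rep set)"
  unfolding irreducible_in_def topspace_zariski
proof (intro conjI allI impI S)
  fix U V assume UV: "openin (zariski G L d) U \<and> openin (zariski G L d) V \<and> U \<inter> S \<noteq> {} \<and> V \<inter> S \<noteq> {}"
  then obtain x y where xy: "x \<in> U" "x \<in> S" "y \<in> V" "y \<in> S" by auto
  obtain \<gamma> a b B where \<gamma>: "poly_curve d \<gamma>" "\<gamma> a = x" "\<gamma> b = y" "finite B" "\<And>t. t \<notin> B \<Longrightarrow> \<gamma> t \<in> S"
    using curve[OF xy(2,4)] by blast
  obtain t where "t \<notin> B" "\<gamma> t \<in> U" "\<gamma> t \<in> V"
  proof (rule poly_curve_meets[OF \<gamma>(1)])
    show "openin (zariski G L d) U" "openin (zariski G L d) V" using UV by auto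
    show "\<gamma> a \<in> U" "\<gamma> b \<in> V" using xy \<gamma> by auto
    show "finite B" by (rule \<gamma>(4))
    show "\<gamma> t \<in> rep_variety G L d" if "t \<notin> B" for t using \<gamma>(5)[OF that] S by auto
  qed
  then show "U \<inter> V \<inter> S \<noteq> {}" using \<gamma>(5)[of t] by auto
qed

end

section \<open>Irreducibility of the strata\<close>

definition line_mat :: "'k::field mat \<Rightarrow> 'k mat \<Rightarrow> 'k \<Rightarrow> 'k mat" where
  "line_mat A B t = (1 - t) \<cdot>\<^sub>m A + t \<cdot>\<^sub>m B"

lemma line_mat_carrier:
  "A \<in> carrier_mat m n \<Longrightarrow> B \<in> carrier_mat m n \<Longrightarrow> line_mat A B t \<in> carrier_mat m n"
  unfolding line_mat_def by auto

lemma line_mat_ends: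
  assumes "A \<in> carrier_mat m n" "B \<in> carrier_mat m n"
  shows "line_mat A B 0 = A" "line_mat A B 1 = B"
  using assms unfolding line_mat_def by (auto intro!: eq_matI)

lemma line_mat_poly:
  assumes "A \<in> carrier_mat m n" "B \<in> carrier_mat m n" "i < m" "j < n"
  shows "poly_fun (\<lambda>t. line_mat A B t $$ (i, j))"
proof -
  have "line_mat A B t $$ (i, j) = (1 - t) * A $$ (i, j) + t * B $$ (i, j)" for t
    using assms unfolding line_mat_def by auto
  then show ?thesis using poly_fun_interpolation by simp
qed

lemma line_mat_in_subspace:
  assumes A: "A \<in> carrier_mat m n" and B: "B \<in> carrier_mat m n" and v: "v \<in> carrier_vec n"
    and W: "lin_subspace m W" "A *\<^sub>v v \<in> W" "B *\<^sub>v v \<in> W"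
  shows "line_mat A B t *\<^sub>v v \<in> W"
proof -
  have s: "(c \<cdot>\<^sub>m C) *\<^sub>v v = c \<cdot>\<^sub>v (C *\<^sub>v v)" if "C \<in> carrier_mat m n" for c C
    using that v by (intro eq_vecI) auto
  have "line_mat A B t *\<^sub>v v = (1 - t) \<cdot>\<^sub>v (A *\<^sub>v v) + t \<cdot>\<^sub>v (B *\<^sub>v v)"
    unfolding line_mat_def s[OF A, symmetric] s[OF B, symmetric]
    by (rule add_mult_distrib_mat_vec[OF _ _ v]) (use A B in auto)
  then show ?thesis using lin_subspaceD(3,4)[OF W(1)] W(2,3) by simp
qed

context fin_digraph
begin

lemma rep_space_ext:
  assumes "x \<in> rep_space d" "y \<in> rep_space d" "\<And>a. a \<in> arcs G \<Longrightarrow> x a = y a"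
  shows "x = y"
  using assms unfolding rep_space_def by (rule PiE_ext)

text \<open>For the dimensions \<open>e\<close> of a radical or annihilator filtration, this set contains the corresponding
  stratum as an open subset.  Unlike the stratum it has an evident parametrisation, by frames at
  the vertices and by block matrices.\<close>

definition filtered_reps :: "('a \<Rightarrow> nat) \<Rightarrow> (nat \<Rightarrow> 'a \<Rightarrow> nat) \<Rightarrow> ('b, 'k::field) rep set" where
  "filtered_reps d e = {x \<in> rep_space d. \<exists>g. (\<forall>i\<in>verts G. frame (d i) (g i)) \<and>
     shifts d x (\<lambda>l i. mat_image (g i) (coord_space (d i) (e l i)))}"

lemma filtered_repsI:
  assumes x: "x \<in> rep_space d" and E: "shifts d x E" "\<And>l i. i \<in> verts G \<Longrightarrow> lin_subspace (d i) (E l i)"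
    "\<And>l i. i \<in> verts G \<Longrightarrow> E (Suc l) i \<subseteq> E l i" "\<And>l i. i \<in> verts G \<Longrightarrow> L < l \<Longrightarrow> E l i = {0\<^sub>v (d i)}"
    and e: "\<And>l i. i \<in> verts G \<Longrightarrow> ldim (d i) (E l i) = e l i"
  shows "x \<in> filtered_reps d e"
proof -
  have "\<exists>P. frame (d i) P \<and> (\<forall>l. E l i = mat_image P (coord_space (d i) (e l i)))" if i: "i \<in> verts G" for i
  proof -
    obtain P where P: "frame (d i) P" "\<And>l. l \<le> L \<Longrightarrow> E l i = mat_image P (coord_space (d i) (ldim (d i) (E l i)))"
      using chain_frame[of L "d i" "\<lambda>l. E l i"] E(2,3)[OF i] by blast
    have "E l i = mat_image P (coord_space (d i) (e l i))" for l
    proof (cases "l \<le> L")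
      case True
      then show ?thesis using P(2) e[OF i] by simp
    next
      case False
      then have z: "E l i = {0\<^sub>v (d i)}" using E(4)[OF i] by simp
      then have "e l i = 0" using e[OF i, of l] ldim_zero by metis
      moreover have "P *\<^sub>v 0\<^sub>v (d i) = 0\<^sub>v (d i)" using frame_carrier[OF P(1)] by (intro eq_vecI) auto
      ultimately show ?thesis unfolding z by (simp add: coord_space_zero)
    qed
    then show ?thesis using P(1) by blast
  qed
  then obtain g where g: "\<And>i. i \<in> verts G \<Longrightarrow> frame (d i) (g i)"
    "\<And>i l. i \<in> verts G \<Longrightarrow> E l i = mat_image (g i) (coord_space (d i) (e l i))" by metis
  have "shifts d x (\<lambda>l i. mat_image (g i) (coord_space (d i) (e l i)))"
    unfolding shifts_def
  proof (intro allI ballI)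
    fix l a v assume a: "a \<in> arcs G" and v: "v \<in> mat_image (g (tail G a)) (coord_space (d (tail G a)) (e l (tail G a)))"
    then have "v \<in> E l (tail G a)" using g(2)[of "tail G a" l] a by auto
    then have "x a *\<^sub>v v \<in> E (Suc l) (head G a)" using E(1) a unfolding shifts_def by blast
    then show "x a *\<^sub>v v \<in> mat_image (g (head G a)) (coord_space (d (head G a)) (e (Suc l) (head G a)))"
      using g(2)[of "head G a" "Suc l"] a by auto
  qed
  then show ?thesis unfolding filtered_reps_def using x g(1) by blast
qed

definition flag_filtration ::
  "('a \<Rightarrow> nat) \<Rightarrow> nat \<Rightarrow> (nat \<Rightarrow> 'a \<Rightarrow> nat) \<Rightarrow> ('b, 'k::field) rep \<Rightarrow> (nat \<Rightarrow> 'a \<Rightarrow> 'k vec set) \<Rightarrow> bool" where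
  "flag_filtration d L e x E \<longleftrightarrow> shifts d x E \<and> (\<forall>i\<in>verts G. E 0 i = carrier_vec (d i) \<and>
     (\<forall>l. lin_subspace (d i) (E l i) \<and> ldim (d i) (E l i) = e l i \<and> (L < l \<longrightarrow> E l i = {0\<^sub>v (d i)})))"

lemma flag_filtrationD:
  assumes "flag_filtration d L e x E"
  shows "shifts d x E" "\<And>l i. i \<in> verts G \<Longrightarrow> lin_subspace (d i) (E l i)"
    "\<And>i. i \<in> verts G \<Longrightarrow> E 0 i = carrier_vec (d i)" "\<And>i l. i \<in> verts G \<Longrightarrow> L < l \<Longrightarrow> E l i = {0\<^sub>v (d i)}"
    "\<And>l i. i \<in> verts G \<Longrightarrow> ldim (d i) (E l i) = e l i"
  using assms unfolding flag_filtration_def by blast+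

lemma filtered_reps_filtration:
  assumes x: "x \<in> filtered_reps d e" and e: "\<And>i. i \<in> verts G \<Longrightarrow> e 0 i = d i" "\<And>i l. i \<in> verts G \<Longrightarrow> L < l \<Longrightarrow> e l i = 0"
    and le: "\<And>i l. i \<in> verts G \<Longrightarrow> e l i \<le> d i"
  shows "\<exists>E. flag_filtration d L e x E"
proof -
  obtain g where g: "\<And>i. i \<in> verts G \<Longrightarrow> frame (d i) (g i)"
    "shifts d x (\<lambda>l i. mat_image (g i) (coord_space (d i) (e l i)))" using x unfolding filtered_reps_def by auto
  have "flag_filtration d L e x (\<lambda>l i. mat_image (g i) (coord_space (d i) (e l i)))"
    unfolding flag_filtration_def
  proof (intro conjI ballI allI impI g(2))
    fix l i assume i: "i \<in> verts G"
    note gc = frame_carrier[OF g(1)[OF i]]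
    show "lin_subspace (d i) (mat_image (g i) (coord_space (d i) (e l i)))"
      by (rule lin_subspace_image[OF gc lin_subspace_coord])
    show "mat_image (g i) (coord_space (d i) (e 0 i)) = carrier_vec (d i)"
      unfolding e(1)[OF i] coord_space_full by (rule frame_image_full[OF g(1)[OF i]])
    show "ldim (d i) (mat_image (g i) (coord_space (d i) (e l i))) = e l i"
      by (rule ldim_frame[OF g(1)[OF i] le[OF i]])
    assume l: "L < l"
    have "g i *\<^sub>v 0\<^sub>v (d i) = 0\<^sub>v (d i)" using gc by (intro eq_vecI) auto
    then show "mat_image (g i) (coord_space (d i) (e l i)) = {0\<^sub>v (d i)}"
      unfolding e(2)[OF i l] coord_space_zero by simp
  qed
  then show ?thesis by blast
qed

lemma filtered_reps_variety:
  assumes e: "\<And>i. i \<in> verts G \<Longrightarrow> e 0 i = d i" "\<And>i l. i \<in> verts G \<Longrightarrow> L < l \<Longrightarrow> e l i = 0"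
    and le: "\<And>i l. i \<in> verts G \<Longrightarrow> e l i \<le> d i"
  shows "filtered_reps d e \<subseteq> rep_variety G L d"
proof
  fix x assume x: "x \<in> filtered_reps d e"
  obtain E where "flag_filtration d L e x E" using filtered_reps_filtration[OF x e le] by blast
  note E = flag_filtrationD[OF this]
  show "x \<in> rep_variety G L d"
  proof (rule shifts_rep_variety[OF _ E(1-3)])
    show "x \<in> rep_space d" using x unfolding filtered_reps_def by simp
    show "E (L + 1) i = {0\<^sub>v (d i)}" if "i \<in> verts G" for i by (rule E(4)[OF that]) simp
  qed
qed

definition standard_block :: "('a \<Rightarrow> nat) \<Rightarrow> (nat \<Rightarrow> 'a \<Rightarrow> nat) \<Rightarrow> 'b \<Rightarrow> 'k::field mat \<Rightarrow> bool" where
  "standard_block d e a H \<longleftrightarrow> H \<in> carrier_mat (d (head G a)) (d (tail G a)) \<and>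
    (\<forall>l. \<forall>v \<in> coord_space (d (tail G a)) (e l (tail G a)). H *\<^sub>v v \<in> coord_space (d (head G a)) (e (Suc l) (head G a)))"

text \<open>Conjugation by the frames carries the filtration to coordinate subspaces.  The adjugate, which differs
  from the inverse by a scalar that \<open>H\<close> absorbs, keeps the right hand side polynomial in \<open>g\<close>.\<close>

lemma filtered_rep_standard:
  assumes x: "x \<in> rep_space d" and g: "\<And>i. i \<in> verts G \<Longrightarrow> frame (d i) (g i)"
    and sh: "shifts d x (\<lambda>l i. mat_image (g i) (coord_space (d i) (e l i)))"
    and a: "a \<in> arcs G"
  shows "\<exists>H. standard_block d e a H \<and> x a = g (head G a) * H * adj_mat (g (tail G a))"
proof -
  define u j where "u = tail G a" and "j = head G a"
  have uj: "u \<in> verts G" "j \<in> verts G" unfolding u_def j_def using a by auto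
  note gu = frame_carrier[OF g[OF uj(1)]] and gj = frame_carrier[OF g[OF uj(2)]]
  have xa: "x a \<in> carrier_mat (d j) (d u)" using rep_spaceD[OF x a] unfolding u_def j_def .
  have det: "det (g u) \<noteq> 0" using g[OF uj(1)] unfolding frame_def by simp
  obtain Q where Q: "frame (d j) Q" "g j * Q = 1\<^sub>m (d j)" "Q * g j = 1\<^sub>m (d j)" using frame_inverse[OF g[OF uj(2)]] .
  note Qc = frame_carrier[OF Q(1)]
  have adj: "adj_mat (g u) \<in> carrier_mat (d u) (d u)" "g u * adj_mat (g u) = det (g u) \<cdot>\<^sub>m 1\<^sub>m (d u)"
    using adj_mat[OF gu] by auto
  define K where "K = Q * (x a * g u)"
  have xg: "x a * g u \<in> carrier_mat (d j) (d u)" using xa gu by simp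
  have Kc: "K \<in> carrier_mat (d j) (d u)" unfolding K_def using Qc xg by simp
  define H where "H = (1 / det (g u)) \<cdot>\<^sub>m K"
  have Hc: "H \<in> carrier_mat (d j) (d u)" unfolding H_def using Kc by simp
  have gK: "g j * K = x a * g u"
    unfolding K_def assoc_mult_mat[OF gj Qc xg, symmetric] Q(2) by (rule left_mult_one_mat[OF xg])
  have "g j * H * adj_mat (g u) = (1 / det (g u)) \<cdot>\<^sub>m (x a * g u) * adj_mat (g u)"
    unfolding H_def mult_smult_distrib[OF gj Kc] gK ..
  also have "\<dots> = (1 / det (g u)) \<cdot>\<^sub>m (x a * (g u * adj_mat (g u)))"
    unfolding mult_smult_assoc_mat[OF xg adj(1)] assoc_mult_mat[OF xa gu adj(1)] ..
  also have "\<dots> = (1 / det (g u)) \<cdot>\<^sub>m (det (g u) \<cdot>\<^sub>m x a)"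
    unfolding adj(2) using mult_smult_distrib[OF xa one_carrier_mat] xa by simp
  also have "\<dots> = x a" using det xa by (intro eq_matI) auto
  finally have eq: "x a = g j * H * adj_mat (g u)" by simp
  have "H *\<^sub>v v \<in> coord_space (d j) (e (Suc l) j)" if v: "v \<in> coord_space (d u) (e l u)" for l v
  proof -
    have vc: "v \<in> carrier_vec (d u)" using v unfolding coord_space_def by simp
    have "x a *\<^sub>v (g u *\<^sub>v v) \<in> mat_image (g j) (coord_space (d j) (e (Suc l) j))"
      using sh a v unfolding shifts_def u_def j_def by blast
    then obtain w where w: "w \<in> coord_space (d j) (e (Suc l) j)" "x a *\<^sub>v (g u *\<^sub>v v) = g j *\<^sub>v w" by auto
    have wc: "w \<in> carrier_vec (d j)" using w unfolding coord_space_def by simp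
    have "K *\<^sub>v v = Q *\<^sub>v (x a *\<^sub>v (g u *\<^sub>v v))"
      unfolding K_def using assoc_mult_mat_vec[OF Qc xg vc] assoc_mult_mat_vec[OF xa gu vc] by simp
    also have "\<dots> = w" unfolding w(2) using assoc_mult_mat_vec[OF Qc gj wc] Q(3) wc by simp
    finally have "H *\<^sub>v v = (1 / det (g u)) \<cdot>\<^sub>v w" unfolding H_def using Kc vc by (intro eq_vecI) auto
    then show ?thesis using lin_subspaceD(4)[OF lin_subspace_coord w(1)] by simp
  qed
  then have "standard_block d e a H" using Hc unfolding standard_block_def u_def j_def by blast
  then show ?thesis using eq unfolding u_def j_def by blast
qed

text \<open>Two representations given by frames \<open>g\<close>, \<open>h\<close> and blocks \<open>A\<close>, \<open>B\<close> are joined by interpolating frames and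
  blocks linearly.  The curve can leave the set only at the finitely many parameters at which one of
  the interpolated frames is singular.\<close>

lemma irreducible_filtered_reps:
  assumes e: "\<And>i. i \<in> verts G \<Longrightarrow> e 0 i = d i" "\<And>i l. i \<in> verts G \<Longrightarrow> L < l \<Longrightarrow> e l i = 0"
    and le: "\<And>i l. i \<in> verts G \<Longrightarrow> e l i \<le> d i"
    and ne: "filtered_reps d e \<noteq> ({} :: ('b, 'k::alg_closed_field) rep set)"
  shows "irreducible_in (zariski G L d) (filtered_reps d e :: ('b, 'k) rep set)"
proof (rule irreducible_in_curves)
  show "filtered_reps d e \<subseteq> rep_variety G L d"
    by (rule filtered_reps_variety[where e = e and d = d and L = L, OF e le])
  show "filtered_reps d e \<noteq> ({} :: ('b, 'k) rep set)" by (rule ne)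
  fix x y :: "('b, 'k) rep" assume x: "x \<in> filtered_reps d e" and y: "y \<in> filtered_reps d e"
  have xs: "x \<in> rep_space d" and ys: "y \<in> rep_space d" using x y unfolding filtered_reps_def by auto
  obtain g where g: "\<And>i. i \<in> verts G \<Longrightarrow> frame (d i) (g i)"
    "shifts d x (\<lambda>l i. mat_image (g i) (coord_space (d i) (e l i)))" using x unfolding filtered_reps_def by auto
  obtain h where h: "\<And>i. i \<in> verts G \<Longrightarrow> frame (d i) (h i)"
    "shifts d y (\<lambda>l i. mat_image (h i) (coord_space (d i) (e l i)))" using y unfolding filtered_reps_def by auto
  have "\<forall>a\<in>arcs G. \<exists>H. standard_block d e a H \<and> x a = g (head G a) * H * adj_mat (g (tail G a))"
    by (intro ballI filtered_rep_standard[OF xs g(1) g(2)])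
  then obtain A where A: "\<And>a. a \<in> arcs G \<Longrightarrow> standard_block d e a (A a) \<and> x a = g (head G a) * A a * adj_mat (g (tail G a))"
    unfolding bchoice_iff by blast
  have "\<forall>a\<in>arcs G. \<exists>H. standard_block d e a H \<and> y a = h (head G a) * H * adj_mat (h (tail G a))"
    by (intro ballI filtered_rep_standard[OF ys h(1) h(2)])
  then obtain B where B: "\<And>a. a \<in> arcs G \<Longrightarrow> standard_block d e a (B a) \<and> y a = h (head G a) * B a * adj_mat (h (tail G a))"
    unfolding bchoice_iff by blast
  define P where "P t i = line_mat (g i) (h i) t" for t i
  define C where "C t a = line_mat (A a) (B a) t" for t a
  define \<gamma> where "\<gamma> t = (\<lambda>a\<in>arcs G. P t (head G a) * C t a * adj_mat (P t (tail G a)))" for t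
  have Pc: "P t i \<in> carrier_mat (d i) (d i)" if "i \<in> verts G" for t i
    unfolding P_def by (rule line_mat_carrier[OF frame_carrier[OF g(1)[OF that]] frame_carrier[OF h(1)[OF that]]])
  have ABc: "A a \<in> carrier_mat (d (head G a)) (d (tail G a))" "B a \<in> carrier_mat (d (head G a)) (d (tail G a))"
    if "a \<in> arcs G" for a using A[OF that] B[OF that] unfolding standard_block_def by auto
  have Cc: "C t a \<in> carrier_mat (d (head G a)) (d (tail G a))" if "a \<in> arcs G" for t a
    unfolding C_def by (rule line_mat_carrier[OF ABc[OF that]])
  have adjc: "adj_mat (P t i) \<in> carrier_mat (d i) (d i)" if "i \<in> verts G" for t i
    using adj_mat(1)[OF Pc[OF that]] .
  have ends: "P 0 i = g i" "P 1 i = h i" if "i \<in> verts G" for i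
    unfolding P_def using line_mat_ends[OF frame_carrier[OF g(1)[OF that]] frame_carrier[OF h(1)[OF that]]] by auto
  have \<gamma>s: "\<gamma> t \<in> rep_space d" for t unfolding rep_space_def \<gamma>_def
  proof (rule PiE_I)
    fix a assume a: "a \<in> arcs G"
    then have "P t (head G a) * C t a * adj_mat (P t (tail G a)) \<in> carrier_mat (d (head G a)) (d (tail G a))"
      by (intro mult_carrier_mat[OF mult_carrier_mat[OF Pc Cc] adjc]) auto
    then show "(\<lambda>a\<in>arcs G. P t (head G a) * C t a * adj_mat (P t (tail G a))) a \<in> carrier_mat (d (head G a)) (d (tail G a))"
      using a by simp
  qed simp
  have "\<gamma> 0 = x"
  proof (rule rep_space_ext[OF \<gamma>s xs])
    show "\<gamma> 0 a = x a" if "a \<in> arcs G" for a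
      unfolding \<gamma>_def C_def using that A[OF that] ends line_mat_ends[OF ABc[OF that]] by simp
  qed
  moreover have "\<gamma> 1 = y"
  proof (rule rep_space_ext[OF \<gamma>s ys])
    show "\<gamma> 1 a = y a" if "a \<in> arcs G" for a
      unfolding \<gamma>_def C_def using that B[OF that] ends line_mat_ends[OF ABc[OF that]] by simp
  qed
  moreover have "poly_curve d \<gamma>"
    unfolding poly_curve_def
  proof (intro ballI allI impI)
    fix a r s assume a: "a \<in> arcs G" and rs: "r < d (head G a)" "s < d (tail G a)"
    have v: "tail G a \<in> verts G" "head G a \<in> verts G" using a by auto
    have Pp: "poly_fun (\<lambda>t. P t i $$ (r, s))" if "i \<in> verts G" "r < d i" "s < d i" for i r s
      unfolding P_def by (rule line_mat_poly[OF frame_carrier[OF g(1)[OF that(1)]] frame_carrier[OF h(1)[OF that(1)]] that(2,3)])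
    have Cp: "poly_fun (\<lambda>t. C t a $$ (r, s))" if "r < d (head G a)" "s < d (tail G a)" for r s
      unfolding C_def by (rule line_mat_poly[OF ABc[OF a] that])
    have "poly_fun (\<lambda>t. (P t (head G a) * C t a * adj_mat (P t (tail G a))) $$ (r, s))"
      by (rule function_algebra_mat_mult[OF function_algebra_poly mult_carrier_mat[OF Pc[OF v(2)] Cc[OF a]] _ adjc[OF v(1)] _ rs],
          rule function_algebra_mat_mult[OF function_algebra_poly Pc[OF v(2)] Pp[OF v(2)] Cc[OF a] Cp],
          assumption+, rule function_algebra_adj[OF function_algebra_poly Pc[OF v(1)] Pp[OF v(1)]])
    then show "poly_fun (\<lambda>t. \<gamma> t a $$ (r, s))" unfolding \<gamma>_def using a by simp
  qed
  moreover have "finite (\<Union>i\<in>verts G. {t. det (P t i) = 0})"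
  proof (rule finite_UN_I[OF finite_verts])
    fix i assume i: "i \<in> verts G"
    have "poly_fun (\<lambda>t. det (P t i))"
      by (rule function_algebra_det[OF function_algebra_poly Pc[OF i]])
        (simp add: P_def line_mat_poly[OF frame_carrier[OF g(1)[OF i]] frame_carrier[OF h(1)[OF i]]])
    then obtain p where p: "\<And>t. det (P t i) = poly p t" unfolding poly_fun_def by auto
    have "poly p 0 \<noteq> 0" using g(1)[OF i] unfolding p[symmetric] ends[OF i] frame_def by simp
    then show "finite {t. det (P t i) = 0}" unfolding p by (intro poly_roots_finite) auto
  qed
  moreover have "\<gamma> t \<in> filtered_reps d e" if t: "t \<notin> (\<Union>i\<in>verts G. {t. det (P t i) = 0})" for t
  proof -
    have Pf: "frame (d i) (P t i)" if "i \<in> verts G" for i using t that Pc[OF that] unfolding frame_def by auto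
    have "shifts d (\<gamma> t) (\<lambda>l i. mat_image (P t i) (coord_space (d i) (e l i)))"
      unfolding shifts_def
    proof (intro allI ballI)
      fix l a w assume a: "a \<in> arcs G" and "w \<in> mat_image (P t (tail G a)) (coord_space (d (tail G a)) (e l (tail G a)))"
      then obtain v where v: "v \<in> coord_space (d (tail G a)) (e l (tail G a))" "w = P t (tail G a) *\<^sub>v v" by auto
      have ut: "tail G a \<in> verts G" "head G a \<in> verts G" using a by auto
      have vc: "v \<in> carrier_vec (d (tail G a))" using v(1) unfolding coord_space_def by simp
      note Pu = Pc[OF ut(1), of t] and Pj = Pc[OF ut(2), of t] and Ca = Cc[OF a, of t] and ad = adjc[OF ut(1), of t]
      have Cv: "C t a *\<^sub>v v \<in> coord_space (d (head G a)) (e (Suc l) (head G a))" unfolding C_def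
        by (rule line_mat_in_subspace[OF ABc[OF a] vc lin_subspace_coord])
          (use A[OF a] B[OF a] v(1) in \<open>auto simp: standard_block_def\<close>)
      define c where "c = det (P t (tail G a))"
      have "adj_mat (P t (tail G a)) *\<^sub>v w = (adj_mat (P t (tail G a)) * P t (tail G a)) *\<^sub>v v"
        unfolding v(2) by (rule assoc_mult_mat_vec[OF ad Pu vc, symmetric])
      also have "\<dots> = c \<cdot>\<^sub>v v" unfolding adj_mat(3)[OF Pu] c_def using vc by (intro eq_vecI) auto
      finally have adw: "adj_mat (P t (tail G a)) *\<^sub>v w = c \<cdot>\<^sub>v v" .
      have wc: "w \<in> carrier_vec (d (tail G a))" unfolding v(2) using Pu vc by simp
      have "\<gamma> t a *\<^sub>v w = (P t (head G a) * C t a) *\<^sub>v (c \<cdot>\<^sub>v v)"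
        unfolding \<gamma>_def using a assoc_mult_mat_vec[OF mult_carrier_mat[OF Pj Ca] ad wc] adw by simp
      also have "\<dots> = P t (head G a) *\<^sub>v (C t a *\<^sub>v (c \<cdot>\<^sub>v v))"
        by (rule assoc_mult_mat_vec[OF Pj Ca]) (use vc in simp)
      also have "C t a *\<^sub>v (c \<cdot>\<^sub>v v) = c \<cdot>\<^sub>v (C t a *\<^sub>v v)" by (rule mult_mat_vec[OF Ca vc])
      finally show "\<gamma> t a *\<^sub>v w \<in> mat_image (P t (head G a)) (coord_space (d (head G a)) (e (Suc l) (head G a)))"
        using lin_subspaceD(4)[OF lin_subspace_coord Cv] by blast
    qed
    then show ?thesis unfolding filtered_reps_def using \<gamma>s Pf by blast
  qed
  ultimately show "\<exists>\<gamma> a b B. poly_curve d \<gamma> \<and> \<gamma> a = x \<and> \<gamma> b = y \<and> finite B \<and> (\<forall>t. t \<notin> B \<longrightarrow> \<gamma> t \<in> filtered_reps d e)"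
    by blast
qed

lemma open_finite_conj:
  assumes "finite K" "\<And>k. k \<in> K \<Longrightarrow> openin X {x \<in> topspace X. P k x}"
  shows "openin X {x \<in> topspace X. \<forall>k\<in>K. P k x}"
  using assms
proof (induction K)
  case (insert k K)
  have "{x \<in> topspace X. \<forall>k\<in>insert k K. P k x} = {x \<in> topspace X. P k x} \<inter> {x \<in> topspace X. \<forall>k\<in>K. P k x}" by auto
  moreover have "openin X {x \<in> topspace X. P k x}" by (rule insert.prems) simp
  moreover have "openin X {x \<in> topspace X. \<forall>k\<in>K. P k x}" by (rule insert.IH, rule insert.prems) simp
  ultimately show ?case by (simp only: openin_Int)
qed simp

lemma open_rad_ge:
  fixes y :: "('b, 'k::field) rep"
  assumes y: "y \<in> rep_variety G L d"
  shows "openin (zariski G L d) {x :: ('b, 'k) rep \<in> rep_variety G L d. \<forall>l. \<forall>i\<in>verts G. rad_dim d y l i \<le> rad_dim d x l i}"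
proof -
  have "openin (zariski G L d) {x :: ('b, 'k) rep \<in> topspace (zariski G L d). \<forall>k\<in>{..L} \<times> verts G. rad_dim d y (fst k) (snd k) \<le> rad_dim d x (fst k) (snd k)}"
    by (rule open_finite_conj) (use finite_verts open_rad_dim in \<open>auto simp: topspace_zariski\<close>)
  moreover have "(\<forall>k\<in>{..L} \<times> verts G. rad_dim d y (fst k) (snd k) \<le> rad_dim d x (fst k) (snd k)) \<longleftrightarrow>
    (\<forall>l. \<forall>i\<in>verts G. rad_dim d y l i \<le> rad_dim d x l i)" (is "?A x \<longleftrightarrow> ?B x") for x :: "('b, 'k) rep"
  proof
    assume A: "?A x"
    have "rad_dim d y l i \<le> rad_dim d x l i" if i: "i \<in> verts G" for l i
      using A i rad_dim_vanish[OF y i, of l] by (cases "l \<le> L") auto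
    then show "?B x" by blast
  qed auto
  ultimately show ?thesis unfolding topspace_zariski by simp
qed

lemma open_soc_le:
  fixes y :: "('b, 'k::field) rep"
  assumes y: "y \<in> rep_variety G L d"
  shows "openin (zariski G L d) {x :: ('b, 'k) rep \<in> rep_variety G L d. \<forall>l. \<forall>i\<in>verts G. soc_dim d x l i \<le> soc_dim d y l i}"
proof -
  have "openin (zariski G L d) {x :: ('b, 'k) rep \<in> topspace (zariski G L d). \<forall>k\<in>{..L} \<times> verts G. soc_dim d x (fst k) (snd k) \<le> soc_dim d y (fst k) (snd k)}"
    by (rule open_finite_conj) (use finite_verts open_soc_dim in \<open>auto simp: topspace_zariski\<close>)
  moreover have "(\<forall>k\<in>{..L} \<times> verts G. soc_dim d x (fst k) (snd k) \<le> soc_dim d y (fst k) (snd k)) \<longleftrightarrow>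
    (\<forall>l. \<forall>i\<in>verts G. soc_dim d x l i \<le> soc_dim d y l i)" (is "?A x \<longleftrightarrow> ?B x")
    if x: "x \<in> rep_variety G L d" for x :: "('b, 'k) rep"
  proof
    assume A: "?A x"
    have "soc_dim d x l i \<le> soc_dim d y l i" if i: "i \<in> verts G" for l i
      using A i soc_dim_full[OF y, of l i] soc_dim_full[OF x, of l i] by (cases "l \<le> L") auto
    then show "?B x" by blast
  qed auto
  then have "{x :: ('b, 'k) rep \<in> rep_variety G L d. ?A x} = {x :: ('b, 'k) rep \<in> rep_variety G L d. ?B x}" by (intro Collect_cong) blast
  ultimately show ?thesis unfolding topspace_zariski by simp
qed

text \<open>The radical filtration is contained in every filtration witnessing membership in \<open>filtered_reps\<close>, so there
  the radicals have at most the prescribed dimensions; the stratum is the part where they have at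
  least these dimensions, which is an open condition.\<close>

lemma irreducible_rad_stratum:
  assumes y: "(y :: ('b, 'k::alg_closed_field) rep) \<in> rep_variety G L d"
  shows "irreducible_in (zariski G L d) (rad_stratum G L d (radical_layering G L d y) :: ('b, 'k) rep set)"
proof -
  define e where "e = rad_dim d y"
  define W :: "('b, 'k) rep set" where "W = {x \<in> rep_variety G L d. \<forall>l. \<forall>i\<in>verts G. e l i \<le> rad_dim d x l i}"
  note y' = rep_variety_space[OF y]
  have e: "\<And>i. i \<in> verts G \<Longrightarrow> e 0 i = d i" "\<And>i l. i \<in> verts G \<Longrightarrow> L < l \<Longrightarrow> e l i = 0"
    "\<And>i l. i \<in> verts G \<Longrightarrow> e l i \<le> d i"
    unfolding e_def using rad_dim_0[OF y'] rad_dim_vanish[OF y] rad_dim_mono[OF y' _ le0] by metis+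
  have in_filt: "x \<in> filtered_reps d e" if x: "x \<in> rep_variety G L d" "\<forall>l. \<forall>i\<in>verts G. rad_dim d x l i = e l i" for x :: "('b, 'k) rep"
  proof (rule filtered_repsI[OF rep_variety_space[OF x(1)] rad_space_shifts[OF rep_variety_space[OF x(1)]]])
    show "\<And>l i. i \<in> verts G \<Longrightarrow> lin_subspace (d i) (rad_space d x l i)"
      by (rule rad_space_subspace[OF rep_variety_space[OF x(1)]])
    show "\<And>l i. i \<in> verts G \<Longrightarrow> rad_space d x (Suc l) i \<subseteq> rad_space d x l i"
      by (rule rad_space_mono[OF rep_variety_space[OF x(1)]]) auto
    show "\<And>l i. i \<in> verts G \<Longrightarrow> L < l \<Longrightarrow> rad_space d x l i = {0\<^sub>v (d i)}"
      by (rule rad_space_vanish[OF x(1)])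
    show "\<And>l i. i \<in> verts G \<Longrightarrow> ldim (d i) (rad_space d x l i) = e l i" using x(2) unfolding rad_dim_def by simp
  qed
  have eq: "rad_stratum G L d (radical_layering G L d y) = filtered_reps d e \<inter> W"
  proof
    show "rad_stratum G L d (radical_layering G L d y) \<subseteq> filtered_reps d e \<inter> W"
    proof
      fix x :: "('b, 'k) rep" assume "x \<in> rad_stratum G L d (radical_layering G L d y)"
      then have x: "x \<in> rep_variety G L d" "radical_layering G L d x = radical_layering G L d y"
        unfolding rad_stratum_def by auto
      then have "\<forall>l. \<forall>i\<in>verts G. rad_dim d x l i = e l i" unfolding rad_eq_iff[OF x(1) y] e_def by simp
      then show "x \<in> filtered_reps d e \<inter> W" using in_filt[OF x(1)] x(1) unfolding W_def by simp
    qed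
    show "filtered_reps d e \<inter> W \<subseteq> rad_stratum G L d (radical_layering G L d y)"
    proof
      fix x :: "('b, 'k) rep" assume x: "x \<in> filtered_reps d e \<inter> W"
      then have xf: "x \<in> filtered_reps d e" and xV: "x \<in> rep_variety G L d" and
        ge: "\<forall>l. \<forall>i\<in>verts G. e l i \<le> rad_dim d x l i" unfolding W_def by auto
      note x' = rep_variety_space[OF xV]
      obtain E where "flag_filtration d L e x E" using filtered_reps_filtration[OF xf e] by blast
      note E = flag_filtrationD[OF this]
      have "rad_dim d x l i \<le> e l i" if i: "i \<in> verts G" for l i
        using ldim_mono[OF rad_space_subspace[OF x'] E(2)[OF i] shifts_rad_space[OF x' E(1-3) i]]
        unfolding E(5)[OF i] rad_dim_def .
      then have "\<forall>l. \<forall>i\<in>verts G. rad_dim d x l i = rad_dim d y l i" using ge unfolding e_def by (meson antisym)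
      then show "x \<in> rad_stratum G L d (radical_layering G L d y)"
        unfolding rad_stratum_def using rad_eq_iff[OF xV y] xV by simp
    qed
  qed
  have yW: "y \<in> filtered_reps d e" "y \<in> W" using in_filt[OF y] y unfolding W_def e_def by auto
  have irr: "irreducible_in (zariski G L d) (filtered_reps d e :: ('b, 'k) rep set)"
    by (rule irreducible_filtered_reps[where e = e and d = d and L = L, OF e]) (use yW in auto)
  have op: "openin (zariski G L d) W" unfolding W_def e_def by (rule open_rad_ge[OF y])
  show ?thesis unfolding eq by (rule irreducible_in_open[OF irr op]) (use yW in blast)
qed

text \<open>As before, with the annihilator filtration, which contains every witnessing filtration; it has to
  be read backwards in order to decrease.\<close>

lemma irreducible_soc_stratum:
  assumes y: "(y :: ('b, 'k::alg_closed_field) rep) \<in> rep_variety G L d"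
  shows "irreducible_in (zariski G L d) (soc_stratum G L d (socle_layering G L d y) :: ('b, 'k) rep set)"
proof -
  define e where "e l i = soc_dim d y (L + 1 - l) i" for l i
  define W :: "('b, 'k) rep set" where "W = {x \<in> rep_variety G L d. \<forall>l. \<forall>i\<in>verts G. soc_dim d x l i \<le> soc_dim d y l i}"
  note y' = rep_variety_space[OF y]
  have e: "\<And>i. i \<in> verts G \<Longrightarrow> e 0 i = d i" "\<And>i l. i \<in> verts G \<Longrightarrow> L < l \<Longrightarrow> e l i = 0"
    "\<And>i l. i \<in> verts G \<Longrightarrow> e l i \<le> d i"
    unfolding e_def using soc_dim_0 soc_dim_full[OF y] ldim_le[OF soc_space_subspace[OF y']]
    by (auto simp: soc_dim_def)
  have in_filt: "x \<in> filtered_reps d e" if x: "x \<in> rep_variety G L d" "\<forall>l. \<forall>i\<in>verts G. soc_dim d x l i = soc_dim d y l i" for x :: "('b, 'k) rep"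
  proof (rule filtered_repsI[OF rep_variety_space[OF x(1)], where E = "\<lambda>l. soc_space d x (L + 1 - l)" and L = L])
    note x' = rep_variety_space[OF x(1)]
    show "shifts d x (\<lambda>l. soc_space d x (L + 1 - l))"
      unfolding shifts_def
    proof (intro allI ballI)
      fix l a v assume a: "a \<in> arcs G" and v: "v \<in> soc_space d x (L + 1 - l) (tail G a)"
      show "x a *\<^sub>v v \<in> soc_space d x (L + 1 - Suc l) (head G a)"
      proof (cases "l \<le> L")
        case True
        then have "L + 1 - l = Suc (L + 1 - Suc l)" by simp
        then show ?thesis using soc_space_step[OF x' a] v by simp
      next
        case False
        then have z: "L + 1 - l = 0" "L + 1 - Suc l = 0" by auto
        have "v = 0\<^sub>v (d (tail G a))" using v a unfolding z(1) by (simp add: soc_space_0)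
        then have "x a *\<^sub>v v = 0\<^sub>v (d (head G a))" using rep_spaceD[OF x' a] by (intro eq_vecI) auto
        then show ?thesis using lin_subspaceD(2)[OF soc_space_subspace[OF x']] by simp
      qed
    qed
    show "\<And>l i. i \<in> verts G \<Longrightarrow> lin_subspace (d i) (soc_space d x (L + 1 - l) i)"
      by (rule soc_space_subspace[OF x'])
    show "\<And>l i. i \<in> verts G \<Longrightarrow> soc_space d x (L + 1 - Suc l) i \<subseteq> soc_space d x (L + 1 - l) i"
      by (rule soc_space_mono[OF x']) auto
    show "\<And>l i. i \<in> verts G \<Longrightarrow> L < l \<Longrightarrow> soc_space d x (L + 1 - l) i = {0\<^sub>v (d i)}"
      by (simp add: soc_space_0)
    show "\<And>l i. i \<in> verts G \<Longrightarrow> ldim (d i) (soc_space d x (L + 1 - l) i) = e l i"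
      using x(2) unfolding soc_dim_def e_def by simp
  qed
  have eq: "soc_stratum G L d (socle_layering G L d y) = filtered_reps d e \<inter> W"
  proof
    show "soc_stratum G L d (socle_layering G L d y) \<subseteq> filtered_reps d e \<inter> W"
    proof
      fix x :: "('b, 'k) rep" assume "x \<in> soc_stratum G L d (socle_layering G L d y)"
      then have x: "x \<in> rep_variety G L d" "socle_layering G L d x = socle_layering G L d y"
        unfolding soc_stratum_def by auto
      then have "\<forall>l. \<forall>i\<in>verts G. soc_dim d x l i = soc_dim d y l i" unfolding soc_eq_iff[OF x(1) y] by simp
      then show "x \<in> filtered_reps d e \<inter> W" using in_filt[OF x(1)] x(1) unfolding W_def by simp
    qed
    show "filtered_reps d e \<inter> W \<subseteq> soc_stratum G L d (socle_layering G L d y)"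
    proof
      fix x :: "('b, 'k) rep" assume x: "x \<in> filtered_reps d e \<inter> W"
      then have xf: "x \<in> filtered_reps d e" and xV: "x \<in> rep_variety G L d" and
        le: "\<forall>l. \<forall>i\<in>verts G. soc_dim d x l i \<le> soc_dim d y l i" unfolding W_def by auto
      note x' = rep_variety_space[OF xV]
      obtain E where "flag_filtration d L e x E" using filtered_reps_filtration[OF xf e] by blast
      note E = flag_filtrationD[OF this]
      have "soc_dim d y l i \<le> soc_dim d x l i" if i: "i \<in> verts G" for l i
      proof (cases "l \<le> L + 1")
        case True
        have "E (L + 1 - l) i \<subseteq> soc_space d x (L + 1 - (L + 1 - l)) i"
          by (rule shifts_soc_space[OF x' E(1,2) E(4) i]) auto
        then have "E (L + 1 - l) i \<subseteq> soc_space d x l i" using True by simp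
        from ldim_mono[OF E(2)[OF i] soc_space_subspace[OF x'] this]
        show ?thesis unfolding E(5)[OF i] e_def soc_dim_def using True by simp
      next
        case False
        then show ?thesis using soc_dim_full[OF y, of l i] soc_dim_full[OF xV, of l i] by simp
      qed
      then have "\<forall>l. \<forall>i\<in>verts G. soc_dim d x l i = soc_dim d y l i" using le by (meson antisym)
      then show "x \<in> soc_stratum G L d (socle_layering G L d y)"
        unfolding soc_stratum_def using soc_eq_iff[OF xV y] xV by simp
    qed
  qed
  have yW: "y \<in> filtered_reps d e" "y \<in> W" using in_filt[OF y] y unfolding W_def by auto
  have irr: "irreducible_in (zariski G L d) (filtered_reps d e :: ('b, 'k) rep set)"
    by (rule irreducible_filtered_reps[where e = e and d = d and L = L, OF e]) (use yW in auto)
  have op: "openin (zariski G L d) W" unfolding W_def by (rule open_soc_le[OF y])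
  show ?thesis unfolding eq by (rule irreducible_in_open[OF irr op]) (use yW in blast)
qed

section \<open>Deforming the arrows into one vertex\<close>

lemma no_oriented_cycles_acyclic:
  assumes "no_oriented_cycles G"
  shows "acyclic (arcs_ends G)"
proof (rule acyclicI, rule allI, rule notI)
  fix u assume "(u, u) \<in> (arcs_ends G)\<^sup>+"
  then obtain p where "awalk u p u" "p \<noteq> []" using reachable1_awalk by blast
  then show False using assms unfolding no_oriented_cycles_def by blast
qed

lemma arc_in_arcs_ends: "a \<in> arcs G \<Longrightarrow> (tail G a, head G a) \<in> arcs_ends G"
  unfolding arcs_ends_def arc_to_ends_def by auto

lemma rad_space_in_soc_space:
  assumes x: "x \<in> rep_variety G L d" and i: "i \<in> verts G" and l: "l \<le> L + 1"
  shows "rad_space d x l i \<subseteq> soc_space d x (L + 1 - l) i"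
  by (rule shifts_soc_space[OF rep_variety_space[OF x] rad_space_shifts[OF rep_variety_space[OF x]]
        rad_space_subspace[OF rep_variety_space[OF x]] rad_space_vanish[OF x] i l]) auto

text \<open>The deformation step.  The arrows into \<open>i\<close> are the only ones that are changed.  As \<open>i\<close> lies on no oriented
  cycle, they start at vertices that are not reachable from \<open>i\<close>; there the module and hence its radicals
  remain those of \<open>N\<close> along the deformation, so that the isomorphisms with the radicals of \<open>M\<close> stay
  available.  At \<open>i\<close> itself only the annihilator filtrations of \<open>M\<close> and \<open>N\<close> can be compared, which is
  enough to stay in the variety.\<close>

lemma deform_one_vertex:
  fixes N M :: "('b, 'k::alg_closed_field) rep"
  assumes ac: "acyclic (arcs_ends G)"
    and N: "N \<in> rep_variety G L d" and M: "M \<in> rep_variety G L d" and i: "i \<in> verts G"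
    and rad: "\<And>a l. a \<in> arcs G \<Longrightarrow> head G a = i \<Longrightarrow> rad_dim d N l (tail G a) = rad_dim d M l (tail G a)"
    and soc: "\<And>l. soc_dim d M l i \<le> soc_dim d N l i"
    and W: "openin (zariski G L d) W" "N \<in> W" "\<And>x l. x \<in> W \<Longrightarrow> rad_dim d x l i \<le> rad_dim d N l i"
  shows "rad_dim d M l i \<le> rad_dim d N l i"
proof (cases l)
  case 0
  then show ?thesis by (simp add: rad_dim_0[OF rep_variety_space[OF N] i] rad_dim_0[OF rep_variety_space[OF M] i])
next
  case (Suc k)
  note N' = rep_variety_space[OF N] and M' = rep_variety_space[OF M]
  define below where "below j \<longleftrightarrow> (i, j) \<in> (arcs_ends G)\<^sup>*" for j
  have below_i: "below i" unfolding below_def by simp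
  have below_step: "below (head G a)" if "a \<in> arcs G" "below (tail G a)" for a
    using that arc_in_arcs_ends[OF that(1)] unfolding below_def by (meson rtrancl.rtrancl_into_rtrancl)
  have not_into: "\<not> below (tail G a)" if "a \<in> arcs G" "head G a = i" for a
  proof
    assume "below (tail G a)"
    then have "(i, i) \<in> (arcs_ends G)\<^sup>+"
      using arc_in_arcs_ends[OF that(1)] unfolding below_def that(2) by (rule rtrancl_into_trancl1)
    then show False using ac unfolding acyclic_def by blast
  qed

  \<comment> \<open>an isomorphism of the radical filtrations of \<open>N\<close> and \<open>M\<close> where the radical dimensions agree\<close>
  have "\<exists>T. frame (d h) T \<and> (\<forall>m\<le>L + 1. mat_image T (rad_space d N m h) = rad_space d M m h)"
    if h: "h \<in> verts G" "\<And>m. rad_dim d N m h = rad_dim d M m h" for h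
  proof -
    obtain T where T: "frame (d h) T" "\<And>m. m \<le> L + 1 \<Longrightarrow> mat_image T (rad_space d N m h) \<subseteq> rad_space d M m h"
    proof (rule chain_embedding[of "L + 1" "d h" "\<lambda>m. rad_space d N m h" "\<lambda>m. rad_space d M m h"])
      show "rad_space d N (Suc m) h \<subseteq> rad_space d N m h" for m by (rule rad_space_mono[OF N' h(1)]) simp
      show "rad_space d M (Suc m) h \<subseteq> rad_space d M m h" for m by (rule rad_space_mono[OF M' h(1)]) simp
      show "ldim (d h) (rad_space d N m h) \<le> ldim (d h) (rad_space d M m h)" for m
        using h(2)[of m] unfolding rad_dim_def by simp
    qed (auto intro: rad_space_subspace N' M')
    have "mat_image T (rad_space d N m h) = rad_space d M m h" if "m \<le> L + 1" for m
      by (rule ldim_eq_imp_eq[OF lin_subspace_image[OF frame_carrier[OF T(1)] rad_space_subspace[OF N']]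
            rad_space_subspace[OF M'] T(2)[OF that]])
        (use h(2)[of m] in \<open>simp add: ldim_frame_image[OF T(1) rad_space_subspace[OF N']] rad_dim_def\<close>)
    then show ?thesis using T(1) by blast
  qed
  then have "\<forall>a\<in>{a \<in> arcs G. head G a = i}. \<exists>T. frame (d (tail G a)) T \<and>
      (\<forall>m\<le>L + 1. mat_image T (rad_space d N m (tail G a)) = rad_space d M m (tail G a))"
    using rad by (metis (mono_tags, lifting) mem_Collect_eq tail_in_verts)
  then obtain \<phi> where all_\<phi>: "\<forall>a\<in>{a \<in> arcs G. head G a = i}. frame (d (tail G a)) (\<phi> a) \<and>
      (\<forall>m\<le>L + 1. mat_image (\<phi> a) (rad_space d N m (tail G a)) = rad_space d M m (tail G a))"
    unfolding bchoice_iff by (rule exE)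
  have \<phi>: "frame (d (tail G a)) (\<phi> a)"
    "m \<le> L + 1 \<Longrightarrow> mat_image (\<phi> a) (rad_space d N m (tail G a)) = rad_space d M m (tail G a)"
    if "a \<in> arcs G" "head G a = i" for a m using all_\<phi> that by blast+

  \<comment> \<open>annihilator filtrations are indexed backwards so that they decrease\<close>
  obtain \<theta> where \<theta>: "frame (d i) \<theta>"
    "\<And>m. m \<le> L + 1 \<Longrightarrow> mat_image \<theta> (soc_space d M (L + 1 - m) i) \<subseteq> soc_space d N (L + 1 - m) i"
  proof (rule chain_embedding[of "L + 1" "d i" "\<lambda>m. soc_space d M (L + 1 - m) i" "\<lambda>m. soc_space d N (L + 1 - m) i"])
    show "soc_space d N (L + 1 - Suc m) i \<subseteq> soc_space d N (L + 1 - m) i" for m by (rule soc_space_mono[OF N']) simp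
    show "soc_space d M (L + 1 - Suc m) i \<subseteq> soc_space d M (L + 1 - m) i" for m by (rule soc_space_mono[OF M']) simp
    show "ldim (d i) (soc_space d M (L + 1 - m) i) \<le> ldim (d i) (soc_space d N (L + 1 - m) i)" for m
      using soc[of "L + 1 - m"] unfolding soc_dim_def by simp
  qed (auto intro: soc_space_subspace N' M')

  define y where "y a = \<theta> * (M a * \<phi> a)" for a
  have Na: "N a \<in> carrier_mat (d (head G a)) (d (tail G a))" if "a \<in> arcs G" for a using rep_spaceD[OF N' that] .
  have Ma: "M a \<in> carrier_mat (d (head G a)) (d (tail G a))" if "a \<in> arcs G" for a using rep_spaceD[OF M' that] .
  have yc: "y a \<in> carrier_mat (d (head G a)) (d (tail G a))" if a: "a \<in> arcs G" "head G a = i" for a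
    unfolding y_def using frame_carrier[OF \<theta>(1)] Ma[OF a(1)] frame_carrier[OF \<phi>(1)[OF a]] a(2) by auto
  have yv: "y a *\<^sub>v v = \<theta> *\<^sub>v (M a *\<^sub>v (\<phi> a *\<^sub>v v))" if a: "a \<in> arcs G" "head G a = i" and v: "v \<in> carrier_vec (d (tail G a))" for a v
  proof -
    note c = frame_carrier[OF \<theta>(1)] Ma[OF a(1), unfolded a(2)] frame_carrier[OF \<phi>(1)[OF a]]
    show ?thesis unfolding y_def assoc_mult_mat_vec[OF c(1) mult_carrier_mat[OF c(2,3)] v] assoc_mult_mat_vec[OF c(2,3) v] ..
  qed
  define \<gamma> where "\<gamma> t = (\<lambda>a\<in>arcs G. if head G a = i then line_mat (N a) (y a) t else N a)" for t
  have \<gamma>s: "\<gamma> t \<in> rep_space d" for t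
    unfolding rep_space_def \<gamma>_def by (rule PiE_I) (auto intro: line_mat_carrier Na yc)
  have "\<gamma> 0 = N"
    by (rule rep_space_ext[OF \<gamma>s N']) (auto simp: \<gamma>_def line_mat_ends[OF Na yc])
  moreover have curve: "poly_curve d \<gamma>"
    unfolding poly_curve_def
  proof (intro ballI allI impI)
    fix a r s assume a: "a \<in> arcs G" and rs: "r < d (head G a)" "s < d (tail G a)"
    show "poly_fun (\<lambda>t. \<gamma> t a $$ (r, s))"
    proof (cases "head G a = i")
      case True
      then show ?thesis using line_mat_poly[OF Na[OF a] yc[OF a True] rs] a unfolding \<gamma>_def by simp
    next
      case False
      then show ?thesis using function_algebraD(1)[OF function_algebra_poly, of "N a $$ (r, s)"] a unfolding \<gamma>_def by simp
    qed
  qed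
  moreover have \<gamma>V: "\<gamma> t \<in> rep_variety G L d" for t
  proof -
    \<comment> \<open>\<open>N\<close> shifts this mixture of its two filtrations because \<open>J\<^sup>l N\<close> is annihilated by \<open>J\<^bsup>L+1-l\<^esup>\<close>\<close>
    define E where "E l j = (if below j then soc_space d N (L + 1 - l) j else rad_space d N l j)" for l j
    have E_sub: "lin_subspace (d j) (E l j)" for l j
      unfolding E_def using soc_space_subspace[OF N'] rad_space_subspace[OF N'] by simp
    have N_shift: "N a *\<^sub>v v \<in> E (Suc l) (head G a)" if a: "a \<in> arcs G" and v: "v \<in> E l (tail G a)" for a l v
    proof (cases "below (tail G a)")
      case True
      note bh = below_step[OF a True]
      show ?thesis
      proof (cases "l \<le> L")
        case le: True
        then have "L + 1 - l = Suc (L + 1 - Suc l)" by simp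
        then show ?thesis using soc_space_step[OF N' a] v True bh unfolding E_def by simp
      next
        case False
        then have z: "L + 1 - l = 0" by auto
        have "v = 0\<^sub>v (d (tail G a))" using v True a unfolding E_def z by (simp add: soc_space_0)
        then have "N a *\<^sub>v v = 0\<^sub>v (d (head G a))" using Na[OF a] by (intro eq_vecI) auto
        then show ?thesis using lin_subspaceD(2)[OF E_sub] by simp
      qed
    next
      case False
      then have r: "N a *\<^sub>v v \<in> rad_space d N (Suc l) (head G a)"
        using rad_space_step[OF N' a] v unfolding E_def by simp
      show ?thesis
      proof (cases "below (head G a)")
        case True
        have hv: "head G a \<in> verts G" using a by simp
        show ?thesis
        proof (cases "Suc l \<le> L + 1")
          case le: True
          show ?thesis using r rad_space_in_soc_space[OF N hv le] True unfolding E_def by auto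
        next
          case False
          then have "N a *\<^sub>v v = 0\<^sub>v (d (head G a))" using r rad_space_vanish[OF N hv, of "Suc l"] by simp
          then show ?thesis using lin_subspaceD(2)[OF E_sub] by simp
        qed
      next
        case nb: False
        then show ?thesis using r unfolding E_def by simp
      qed
    qed
    have y_shift: "y a *\<^sub>v v \<in> E (Suc l) (head G a)"
      if a: "a \<in> arcs G" "head G a = i" and v: "v \<in> E l (tail G a)" for a l v
    proof -
      have v': "v \<in> rad_space d N l (tail G a)" using v not_into[OF a] unfolding E_def by simp
      have vc: "v \<in> carrier_vec (d (tail G a))" using lin_subspaceD(5)[OF rad_space_subspace[OF N'] v'] .
      show ?thesis
      proof (cases "l \<le> L")
        case True
        have "\<phi> a *\<^sub>v v \<in> rad_space d M l (tail G a)" using \<phi>(2)[OF a, of l] v' True by auto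
        then have "M a *\<^sub>v (\<phi> a *\<^sub>v v) \<in> rad_space d M (Suc l) i" using rad_space_step[OF M' a(1)] a(2) by auto
        then have "M a *\<^sub>v (\<phi> a *\<^sub>v v) \<in> soc_space d M (L + 1 - Suc l) i"
          using rad_space_in_soc_space[OF M i, of "Suc l"] True by auto
        then have "\<theta> *\<^sub>v (M a *\<^sub>v (\<phi> a *\<^sub>v v)) \<in> soc_space d N (L + 1 - Suc l) i"
          using \<theta>(2)[of "Suc l"] True by auto
        then show ?thesis unfolding yv[OF a vc] E_def using below_i a(2) by simp
      next
        case False
        then have "v = 0\<^sub>v (d (tail G a))" using v' rad_space_vanish[OF N, of "tail G a" l] a(1) by simp
        then have "y a *\<^sub>v v = 0\<^sub>v (d (head G a))" using yc[OF a] by (intro eq_vecI) auto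
        then show ?thesis using lin_subspaceD(2)[OF E_sub] by simp
      qed
    qed
    show ?thesis
    proof (rule shifts_rep_variety[OF \<gamma>s])
      show "shifts d (\<gamma> t) E" unfolding shifts_def
      proof (intro allI ballI)
        fix l a v assume a: "a \<in> arcs G" and v: "v \<in> E l (tail G a)"
        have vc: "v \<in> carrier_vec (d (tail G a))" using lin_subspaceD(5)[OF E_sub v] .
        show "\<gamma> t a *\<^sub>v v \<in> E (Suc l) (head G a)"
        proof (cases "head G a = i")
          case True
          then show ?thesis
            using line_mat_in_subspace[OF Na[OF a] yc[OF a True] vc E_sub N_shift[OF a v] y_shift[OF a True v]] a
            unfolding \<gamma>_def by simp
        next
          case False
          then show ?thesis using N_shift[OF a v] a unfolding \<gamma>_def by simp
        qed
      qed
      show "lin_subspace (d j) (E l j)" for l j by (rule E_sub)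
      show "E 0 j = carrier_vec (d j)" if "j \<in> verts G" for j
        unfolding E_def using rad_space_0[OF N' that] soc_space_full[OF N, of "L + 1" j] by simp
      show "E (L + 1) j = {0\<^sub>v (d j)}" if "j \<in> verts G" for j
        unfolding E_def using rad_space_vanish[OF N that, of "L + 1"] soc_space_0[OF that, of d N] by simp
    qed
  qed
  moreover have "rad_dim d M l i \<le> rad_dim d (\<gamma> 1) l i"
  proof -
    have \<gamma>1: "\<gamma> 1 a = (if head G a = i then y a else N a)" if "a \<in> arcs G" for a
      unfolding \<gamma>_def using that line_mat_ends[OF Na[OF that] yc[OF that]] by simp
    have above: "rad_space d N m u \<subseteq> rad_space d (\<gamma> 1) m u" if "u \<in> verts G" "\<not> below u" for m u
      using that
    proof (induction m arbitrary: u)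
      case 0
      then show ?case using rad_space_0[OF N'] rad_space_0[OF \<gamma>s] by simp
    next
      case (Suc m)
      show ?case
      proof (rule rad_space_Suc_least[OF N' rad_space_subspace[OF \<gamma>s]])
        fix a v assume a: "a \<in> arcs G" "head G a = u" and v: "v \<in> rad_space d N m (tail G a)"
        have "\<not> below (tail G a)" using below_step[OF a(1)] a(2) Suc.prems(2) by blast
        then have "v \<in> rad_space d (\<gamma> 1) m (tail G a)" using Suc.IH[of "tail G a"] a(1) v by auto
        moreover have "\<gamma> 1 a = N a" using \<gamma>1[OF a(1)] a(2) Suc.prems(2) below_i by auto
        ultimately show "N a *\<^sub>v v \<in> rad_space d (\<gamma> 1) (Suc m) u"
          using rad_space_step[OF \<gamma>s a(1)] a(2) by metis
      qed
    qed
    have transport: "rad_space d M (Suc k) i \<subseteq> {v \<in> carrier_vec (d i). \<theta> *\<^sub>v v \<in> rad_space d (\<gamma> 1) (Suc k) i}"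
    proof (rule rad_space_Suc_least[OF M' lin_subspace_vimage[OF frame_carrier[OF \<theta>(1)] rad_space_subspace[OF \<gamma>s]]])
      fix a v assume a: "a \<in> arcs G" "head G a = i" and v: "v \<in> rad_space d M k (tail G a)"
      have tv: "tail G a \<in> verts G" using a by simp
      have Mv: "M a *\<^sub>v v \<in> carrier_vec (d i)"
        using Ma[OF a(1)] lin_subspaceD(5)[OF rad_space_subspace[OF M'] v] a(2) by auto
      moreover have "\<theta> *\<^sub>v (M a *\<^sub>v v) \<in> rad_space d (\<gamma> 1) (Suc k) i"
      proof (cases "k \<le> L + 1")
        case True
        then obtain w where w: "w \<in> rad_space d N k (tail G a)" "v = \<phi> a *\<^sub>v w" using \<phi>(2)[OF a True] v by auto
        have wc: "w \<in> carrier_vec (d (tail G a))" using lin_subspaceD(5)[OF rad_space_subspace[OF N'] w(1)] .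
        have "w \<in> rad_space d (\<gamma> 1) k (tail G a)" using above[OF tv not_into[OF a]] w(1) by auto
        then have "\<gamma> 1 a *\<^sub>v w \<in> rad_space d (\<gamma> 1) (Suc k) i" using rad_space_step[OF \<gamma>s a(1)] a(2) by metis
        then show ?thesis using \<gamma>1[OF a(1)] a(2) yv[OF a wc] w(2) by simp
      next
        case False
        then have "v = 0\<^sub>v (d (tail G a))" using v rad_space_vanish[OF M tv, of k] by simp
        then have "M a *\<^sub>v v = 0\<^sub>v (d i)" using Ma[OF a(1)] a(2) by (intro eq_vecI) auto
        moreover have "\<theta> *\<^sub>v 0\<^sub>v (d i) = 0\<^sub>v (d i)" using frame_carrier[OF \<theta>(1)] by (intro eq_vecI) auto
        ultimately have "\<theta> *\<^sub>v (M a *\<^sub>v v) = 0\<^sub>v (d i)" by simp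
        then show ?thesis using lin_subspaceD(2)[OF rad_space_subspace[OF \<gamma>s]] by simp
      qed
      ultimately show "M a *\<^sub>v v \<in> {v \<in> carrier_vec (d i). \<theta> *\<^sub>v v \<in> rad_space d (\<gamma> 1) (Suc k) i}" by simp
    qed
    have "mat_image \<theta> (rad_space d M (Suc k) i) \<subseteq> rad_space d (\<gamma> 1) (Suc k) i" using transport by auto
    from ldim_mono[OF lin_subspace_image[OF frame_carrier[OF \<theta>(1)] rad_space_subspace[OF M']] rad_space_subspace[OF \<gamma>s] this]
    show ?thesis unfolding rad_dim_def Suc ldim_frame_image[OF \<theta>(1) rad_space_subspace[OF M']] .
  qed
  then have y_open: "\<gamma> 1 \<in> {x \<in> rep_variety G L d. rad_dim d M l i \<le> rad_dim d x l i}" using \<gamma>V by simp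
  have N_open: "\<gamma> 0 \<in> W" using \<open>\<gamma> 0 = N\<close> W(2) by simp
  obtain t where "\<gamma> t \<in> W" "\<gamma> t \<in> {x \<in> rep_variety G L d. rad_dim d M l i \<le> rad_dim d x l i}"
    using poly_curve_meets[OF curve W(1) N_open open_rad_dim y_open finite.emptyI \<gamma>V] by blast
  then show ?thesis using W(3)[of "\<gamma> t" l] by simp
qed

text \<open>An acyclic relation on a finite set is well-founded, which gives an induction along the arrows; at
  each vertex the reverse of the assumed inequality comes from the deformation step.\<close>

lemma rad_dims_rigid:
  fixes N M :: "('b, 'k::alg_closed_field) rep"
  assumes ac: "acyclic (arcs_ends G)"
    and N: "N \<in> rep_variety G L d" and M: "M \<in> rep_variety G L d"
    and rad: "\<And>l i. i \<in> verts G \<Longrightarrow> rad_dim d N l i \<le> rad_dim d M l i"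
    and soc: "\<And>l i. i \<in> verts G \<Longrightarrow> soc_dim d M l i \<le> soc_dim d N l i"
    and W: "openin (zariski G L d) W" "N \<in> W" "\<And>x l i. x \<in> W \<Longrightarrow> i \<in> verts G \<Longrightarrow> rad_dim d x l i \<le> rad_dim d N l i"
    and i: "i \<in> verts G"
  shows "rad_dim d M l i = rad_dim d N l i"
proof -
  have "finite (arcs_ends G)" unfolding arcs_ends_def by simp
  then have wf: "wf (arcs_ends G)" using ac by (rule finite_acyclic_wf)
  have "i \<in> verts G \<longrightarrow> (\<forall>l. rad_dim d M l i = rad_dim d N l i)" for i
    using wf
  proof (induction i)
    case (less i)
    show ?case
    proof (intro impI allI antisym)
      fix l assume i: "i \<in> verts G"
      show "rad_dim d N l i \<le> rad_dim d M l i" by (rule rad[OF i])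
      show "rad_dim d M l i \<le> rad_dim d N l i"
      proof (rule deform_one_vertex[OF ac N M i _ soc[OF i] W(1,2)])
        fix a l assume a: "a \<in> arcs G" "head G a = i"
        then have "(tail G a, i) \<in> arcs_ends G" using arc_in_arcs_ends by blast
        then show "rad_dim d N l (tail G a) = rad_dim d M l (tail G a)" using less a(1) by simp
      qed (rule W(3)[OF _ i])
    qed
  qed
  then show ?thesis using i by blast
qed

section \<open>Components and minimal pairs\<close>

lemma rad_stratum_iff:
  assumes "y \<in> rep_variety G L d"
  shows "x \<in> rad_stratum G L d (radical_layering G L d y) \<longleftrightarrow>
    x \<in> rep_variety G L d \<and> (\<forall>l. \<forall>i\<in>verts G. rad_dim d x l i = rad_dim d y l i)"
  using rad_eq_iff[OF _ assms] unfolding rad_stratum_def by auto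

lemma rad_stratum_subset: "rad_stratum G L d S \<subseteq> topspace (zariski G L d)"
  unfolding rad_stratum_def topspace_zariski by auto

lemma irreducible_rad_stratum_mem:
  assumes "x \<in> (rad_stratum G L d S :: ('b, 'k::alg_closed_field) rep set)"
  shows "irreducible_in (zariski G L d) (rad_stratum G L d S :: ('b, 'k::alg_closed_field) rep set)"
  using assms irreducible_rad_stratum[of x L d] unfolding rad_stratum_def by auto

lemma open_layerings_le:
  assumes "(y :: ('b, 'k::field) rep) \<in> rep_variety G L d"
  shows "openin (zariski G L d) {x :: ('b, 'k::field) rep \<in> rep_variety G L d.
    dominance_le G L (radical_layering G L d x) (radical_layering G L d y) \<and>
    dominance_le G L (socle_layering G L d x) (socle_layering G L d y)}"
proof -
  have "{x :: ('b, 'k) rep \<in> rep_variety G L d.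
    dominance_le G L (radical_layering G L d x) (radical_layering G L d y) \<and>
    dominance_le G L (socle_layering G L d x) (socle_layering G L d y)} =
    {x \<in> rep_variety G L d. \<forall>l. \<forall>i\<in>verts G. rad_dim d y l i \<le> rad_dim d x l i} \<inter>
    {x \<in> rep_variety G L d. \<forall>l. \<forall>i\<in>verts G. soc_dim d x l i \<le> soc_dim d y l i}"
    using rad_dominance_iff[OF _ assms] soc_dominance_iff[OF _ assms] by auto
  then show ?thesis using open_rad_ge[OF assms] open_soc_le[OF assms] by (simp only: openin_Int)
qed

lemma dominance_le_refl: "dominance_le G L S S"
  unfolding dominance_le_def by simp

text \<open>By semicontinuity the modules that lie below the pair in both entries form an open set, and by
  minimality their layerings are those of the pair.\<close>

lemma minimal_pair_open:
  assumes min: "minimal_rad_soc TYPE('k::field) G L d S S'"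
  obtains W :: "('b, 'k::field) rep set" and y where "openin (zariski G L d) W" "y \<in> W"
    "\<forall>x\<in>W. x \<in> rep_variety G L d \<and> radical_layering G L d x = S \<and> socle_layering G L d x = S'"
proof -
  obtain y :: "('b, 'k) rep" where y: "y \<in> rep_variety G L d" "radical_layering G L d y = S" "socle_layering G L d y = S'"
    using min unfolding minimal_rad_soc_def rad_soc_def by auto
  define W where "W = {x :: ('b, 'k) rep \<in> rep_variety G L d.
    dominance_le G L (radical_layering G L d x) S \<and> dominance_le G L (socle_layering G L d x) S'}"
  show thesis
  proof (rule that)
    show "openin (zariski G L d) W" using open_layerings_le[OF y(1)] unfolding W_def y(2,3) .
    show "y \<in> W" unfolding W_def using y dominance_le_refl by auto
    show "\<forall>x\<in>W. x \<in> rep_variety G L d \<and> radical_layering G L d x = S \<and> socle_layering G L d x = S'"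
    proof
      fix x assume xW: "x \<in> W"
      have x: "x \<in> rep_variety G L d" "dominance_le G L (radical_layering G L d x) S" "dominance_le G L (socle_layering G L d x) S'"
        using xW unfolding W_def by auto
      have "(radical_layering G L d x, socle_layering G L d x) \<in> rad_soc TYPE('k) G L d"
        using x(1) unfolding rad_soc_def by auto
      then show "x \<in> rep_variety G L d \<and> radical_layering G L d x = S \<and> socle_layering G L d x = S'"
        using min x unfolding minimal_rad_soc_def by blast
    qed
  qed
qed

text \<open>The open set \<open>W\<close> of modules over the minimal pair lies in the stratum.  An irreducible set \<open>D\<close> containing the
  stratum cannot have a point outside the closure, as \<open>W\<close> and the complement of the closure would
  be disjoint open sets meeting \<open>D\<close>.\<close>

lemma minimal_imp_component:
  assumes min: "minimal_rad_soc TYPE('k::alg_closed_field) G L d S S'"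
  shows "irreducible_component (zariski G L d)
    (zariski G L d closure_of (rad_stratum G L d S :: ('b, 'k::alg_closed_field) rep set))"
proof -
  let ?Z = "zariski G L d :: ('b, 'k) rep topology"
  let ?R = "rad_stratum G L d S :: ('b, 'k) rep set"
  obtain W :: "('b, 'k) rep set" and y where W: "openin ?Z W" "y \<in> W"
    "\<forall>x\<in>W. x \<in> rep_variety G L d \<and> radical_layering G L d x = S \<and> socle_layering G L d x = S'"
    using minimal_pair_open[OF min] .
  have WR: "W \<subseteq> ?R" using W(3) unfolding rad_stratum_def by auto
  then have irr: "irreducible_in ?Z ?R" using irreducible_rad_stratum_mem W(2) by blast
  have clR: "?R \<subseteq> ?Z closure_of ?R" by (rule closure_of_subset[OF rad_stratum_subset])
  show ?thesis
    unfolding irreducible_component_def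
  proof (intro conjI allI impI)
    show "?Z closure_of ?R \<subseteq> topspace ?Z" by (rule closure_of_subset_topspace)
    then show "irreducible_space (subtopology ?Z (?Z closure_of ?R))"
      using irreducible_in_closure[OF irr] irreducible_space_iff by blast
    fix D assume D: "D \<subseteq> topspace ?Z" "irreducible_space (subtopology ?Z D) \<and> ?Z closure_of ?R \<subseteq> D"
    then have irrD: "irreducible_in ?Z D" using irreducible_space_iff by blast
    have yD: "y \<in> D" using W(2) WR clR D(2) by blast
    have "D \<subseteq> ?Z closure_of ?R"
    proof
      fix x assume x: "x \<in> D"
      show "x \<in> ?Z closure_of ?R"
      proof (rule ccontr)
        assume nx: "x \<notin> ?Z closure_of ?R"
        have op: "openin ?Z (topspace ?Z - ?Z closure_of ?R)"
          by (rule openin_diff[OF openin_topspace closedin_closure_of])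
        have xin: "x \<in> topspace ?Z - ?Z closure_of ?R" using x D(1) nx by auto
        obtain z where "z \<in> W" "z \<in> topspace ?Z - ?Z closure_of ?R"
          by (rule irreducible_inD[OF irrD W(1) op W(2) yD xin x])
        then show False using WR clR by blast
      qed
    qed
    then show "D = ?Z closure_of ?R" using D(2) by blast
  qed
qed

lemma component_maximal:
  assumes "irreducible_component X C" "D \<subseteq> topspace X" "irreducible_space (subtopology X D)" "C \<subseteq> D"
  shows "D = C"
  using assms unfolding irreducible_component_def by simp

text \<open>The finitely many closures of strata cover the variety.  Those not containing the given stratum cannot
  cover it by irreducibility, and the others are equal to the given component by maximality.\<close>

lemma component_neighbourhood:
  assumes comp: "irreducible_component (zariski G L d)
    (zariski G L d closure_of (rad_stratum G L d S :: ('b, 'k::alg_closed_field) rep set))"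
  obtains W N where "openin (zariski G L d) W" "N \<in> W" "N \<in> (rad_stratum G L d S :: ('b, 'k::alg_closed_field) rep set)"
    "W \<subseteq> zariski G L d closure_of (rad_stratum G L d S :: ('b, 'k::alg_closed_field) rep set)"
proof -
  let ?Z = "zariski G L d :: ('b, 'k) rep topology"
  let ?R = "\<lambda>S. rad_stratum G L d S :: ('b, 'k) rep set"
  have "irreducible_in ?Z (?Z closure_of ?R S)"
    using comp irreducible_space_iff unfolding irreducible_component_def by blast
  then have "?R S \<noteq> {}" unfolding irreducible_in_def by auto
  then have irr: "irreducible_in ?Z (?R S)" using irreducible_rad_stratum_mem by blast
  define \<C> where "\<C> = {?Z closure_of ?R T | T. T \<in> Seqs G L d \<and> \<not> ?R S \<subseteq> ?Z closure_of ?R T}"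
  have fin: "finite \<C>"
  proof (rule finite_subset)
    show "\<C> \<subseteq> (\<lambda>T. ?Z closure_of ?R T) ` Seqs G L d" unfolding \<C>_def by auto
  qed (rule finite_imageI[OF finite_Seqs])
  have closed: "closedin ?Z C" if "C \<in> \<C>" for C using that unfolding \<C>_def by auto
  have "\<not> ?R S \<subseteq> \<Union>\<C>"
    using irreducible_in_finite_cover[OF irr fin closed] unfolding \<C>_def by blast
  then obtain N where N: "N \<in> ?R S" "N \<notin> \<Union>\<C>" by auto
  define W where "W = topspace ?Z - \<Union>\<C>"
  show thesis
  proof (rule that)
    have "closedin ?Z (\<Union>\<C>)" using fin closed by (rule closedin_Union)
    then show "openin ?Z W" unfolding W_def by (rule openin_diff[OF openin_topspace])
    show "N \<in> W" unfolding W_def using N rad_stratum_subset by blast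
    show "N \<in> ?R S" by (rule N(1))
    show "W \<subseteq> ?Z closure_of ?R S"
    proof
      fix x assume x: "x \<in> W"
      then have xV: "x \<in> rep_variety G L d" unfolding W_def topspace_zariski by auto
      define T where "T = radical_layering G L d x"
      have xT: "x \<in> ?R T" unfolding T_def rad_stratum_def using xV by simp
      have cT: "?R T \<subseteq> ?Z closure_of ?R T" by (rule closure_of_subset[OF rad_stratum_subset])
      have "?Z closure_of ?R T \<notin> \<C>" using x xT cT unfolding W_def by blast
      then have "?R S \<subseteq> ?Z closure_of ?R T"
        unfolding \<C>_def T_def using radical_layering_Seqs[OF xV] by blast
      then have sub: "?Z closure_of ?R S \<subseteq> ?Z closure_of ?R T" by (rule closure_of_minimal) simp
      have "irreducible_space (subtopology ?Z (?Z closure_of ?R T))"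
        using irreducible_in_closure[OF irreducible_rad_stratum_mem[OF xT]] irreducible_space_iff[OF closure_of_subset_topspace] by blast
      then have "?Z closure_of ?R T = ?Z closure_of ?R S"
        using component_maximal[OF comp closure_of_subset_topspace _ sub] by simp
      then show "x \<in> ?Z closure_of ?R S" using xT cT by blast
    qed
  qed
qed

text \<open>Having larger radicals is an open condition, so it would hold at some point of the stratum.\<close>

lemma closure_rad_dim_le:
  assumes y: "y \<in> rad_stratum G L d S"
    and x: "x \<in> zariski G L d closure_of (rad_stratum G L d S :: ('b, 'k::field) rep set)" and i: "i \<in> verts G"
  shows "rad_dim d x l i \<le> rad_dim d y l i"
proof (rule ccontr)
  assume "\<not> rad_dim d x l i \<le> rad_dim d y l i"
  then have lt: "Suc (rad_dim d y l i) \<le> rad_dim d x l i" by simp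
  have yV: "y \<in> rep_variety G L d" and yS: "radical_layering G L d y = S" using y unfolding rad_stratum_def by auto
  define U where "U = {z :: ('b, 'k) rep \<in> rep_variety G L d. Suc (rad_dim d y l i) \<le> rad_dim d z l i}"
  have op: "openin (zariski G L d) U" unfolding U_def by (rule open_rad_dim)
  have "x \<in> rep_variety G L d" using x closure_of_subset_topspace[of "zariski G L d"] unfolding topspace_zariski by blast
  then have "x \<in> U" unfolding U_def using lt by simp
  then have "U \<inter> rad_stratum G L d S \<noteq> {}" using open_meets_closure[OF op rad_stratum_subset] x by blast
  then obtain z where z: "z \<in> U" "z \<in> rad_stratum G L d S" by auto
  then have "rad_dim d z l i = rad_dim d y l i" using rad_stratum_iff[OF yV] i unfolding yS by blast
  then show False using z(1) unfolding U_def by simp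
qed

lemma component_imp_minimal:
  assumes ac: "no_oriented_cycles G"
    and comp: "irreducible_component (zariski G L d)
      (zariski G L d closure_of (rad_stratum G L d S :: ('b, 'k::alg_closed_field) rep set))"
  shows "\<exists>S'. minimal_rad_soc TYPE('k::alg_closed_field) G L d S S'"
proof -
  let ?Z = "zariski G L d :: ('b, 'k) rep topology"
  let ?R = "rad_stratum G L d S :: ('b, 'k) rep set"
  obtain W N0 where W: "openin ?Z W" "N0 \<in> W" "N0 \<in> ?R" "W \<subseteq> ?Z closure_of ?R"
    by (rule component_neighbourhood[OF comp])
  have irr: "irreducible_in ?Z ?R" by (rule irreducible_rad_stratum_mem[OF W(3)])
  \<comment> \<open>minimising the total size of the annihilators over \<open>W\<close> and the stratum minimises each of them over
    the stratum, since two nonempty open conditions are satisfied simultaneously\<close>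
  define size where "size x = (\<Sum>l\<le>L. \<Sum>i\<in>verts G. soc_dim d x l i)" for x :: "('b, 'k) rep"
  obtain N where N: "N \<in> W" "N \<in> ?R" and least: "\<And>x. x \<in> W \<Longrightarrow> x \<in> ?R \<Longrightarrow> size N \<le> size x"
    using exists_least_iff[of "\<lambda>n. \<exists>x. x \<in> W \<and> x \<in> ?R \<and> size x = n"] W(2,3) by (metis not_le)
  have NV: "N \<in> rep_variety G L d" and NS: "radical_layering G L d N = S" using N(2) unfolding rad_stratum_def by auto
  have soc_least: "soc_dim d N l i \<le> soc_dim d y l i" if y: "y \<in> ?R" and i: "i \<in> verts G" for y l i
  proof (cases "l \<le> L")
    case True
    have yV: "y \<in> rep_variety G L d" using y unfolding rad_stratum_def by auto
    let ?U = "\<lambda>w. {x \<in> rep_variety G L d. \<forall>l. \<forall>i\<in>verts G. soc_dim d x l i \<le> soc_dim d w l i}"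
    have op: "openin ?Z (?U N \<inter> W)" using open_soc_le[OF NV] W(1) by (rule openin_Int)
    have Nin: "N \<in> ?U N \<inter> W" using N(1) NV by auto
    have yin: "y \<in> ?U y" using yV by auto
    obtain z where z: "z \<in> ?U N \<inter> W" "z \<in> ?U y" "z \<in> ?R"
      by (rule irreducible_inD[OF irr op open_soc_le[OF yV] Nin N(2) yin y])
    have zN: "soc_dim d z l i \<le> soc_dim d N l i" if "i \<in> verts G" for l i using z(1) that by auto
    have "soc_dim d N l i = soc_dim d z l i"
    proof (rule ccontr)
      assume "soc_dim d N l i \<noteq> soc_dim d z l i"
      then have lt: "soc_dim d z l i < soc_dim d N l i" using zN[OF i, of l] by simp
      have "size z < size N" unfolding size_def
      proof (rule sum_strict_mono_ex1)
        show "\<forall>l\<in>{..L}. (\<Sum>i\<in>verts G. soc_dim d z l i) \<le> (\<Sum>i\<in>verts G. soc_dim d N l i)"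
          by (intro ballI sum_mono zN)
        have "(\<Sum>i\<in>verts G. soc_dim d z l i) < (\<Sum>i\<in>verts G. soc_dim d N l i)"
          by (rule sum_strict_mono_ex1[OF finite_verts]) (use zN lt i in auto)
        then show "\<exists>l\<in>{..L}. (\<Sum>i\<in>verts G. soc_dim d z l i) < (\<Sum>i\<in>verts G. soc_dim d N l i)" using True by blast
      qed simp
      then show False using least[of z] z by simp
    qed
    then show ?thesis using z(2) i by auto
  next
    case False
    then show ?thesis using soc_dim_full[OF NV, of l i] soc_dim_full[of y L d l i] y unfolding rad_stratum_def by simp
  qed
  have "minimal_rad_soc TYPE('k) G L d S (socle_layering G L d N)"
    unfolding minimal_rad_soc_def
  proof (intro conjI allI impI)
    show "(S, socle_layering G L d N) \<in> rad_soc TYPE('k) G L d" unfolding rad_soc_def using NV NS by auto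
    fix T T' assume T: "(T, T') \<in> rad_soc TYPE('k) G L d \<and> dominance_le G L T S \<and> dominance_le G L T' (socle_layering G L d N)"
    then obtain M :: "('b, 'k) rep" where M: "M \<in> rep_variety G L d" "radical_layering G L d M = T" "socle_layering G L d M = T'"
      unfolding rad_soc_def by auto
    have rad: "rad_dim d N l i \<le> rad_dim d M l i" if "i \<in> verts G" for l i
      using T that unfolding M(2)[symmetric] NS[symmetric] rad_dominance_iff[OF M(1) NV] by blast
    have soc: "soc_dim d M l i \<le> soc_dim d N l i" if "i \<in> verts G" for l i
      using T that unfolding M(3)[symmetric] soc_dominance_iff[OF M(1) NV] by blast
    have near: "rad_dim d x l i \<le> rad_dim d N l i" if "x \<in> W" "i \<in> verts G" for x l i
      by (rule closure_rad_dim_le[OF N(2) subsetD[OF W(4) that(1)] that(2)])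
    have "rad_dim d M l i = rad_dim d N l i" if "i \<in> verts G" for l i
      using rad_dims_rigid[OF no_oriented_cycles_acyclic[OF ac] NV M(1) rad soc W(1) N(1) near that] .
    then have TS: "T = S" unfolding M(2)[symmetric] NS[symmetric] rad_eq_iff[OF M(1) NV] by blast
    then have "M \<in> ?R" using M unfolding rad_stratum_def by auto
    then have "T' = socle_layering G L d N"
      unfolding M(3)[symmetric] soc_eq_iff[OF M(1) NV] using soc_least soc by (meson antisym)
    then show "(T, T') = (S, socle_layering G L d N)" using TS by simp
  qed
  then show ?thesis by blast
qed

lemma minimal_pair_generic:
  assumes min: "minimal_rad_soc TYPE('k::alg_closed_field) G L d S S'"
  shows "generically (zariski G L d) (rad_stratum G L d S :: ('b, 'k::alg_closed_field) rep set) (\<lambda>x. socle_layering G L d x = S')"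
    and "generically (zariski G L d) (soc_stratum G L d S' :: ('b, 'k::alg_closed_field) rep set) (\<lambda>x. radical_layering G L d x = S)"
proof -
  obtain W :: "('b, 'k) rep set" and y where W: "openin (zariski G L d) W" "y \<in> W"
    "\<forall>x\<in>W. x \<in> rep_variety G L d \<and> radical_layering G L d x = S \<and> socle_layering G L d x = S'"
    using minimal_pair_open[OF min] .
  have yR: "y \<in> rad_stratum G L d S" and yS: "y \<in> soc_stratum G L d S'"
    using bspec[OF W(3) W(2)] unfolding rad_stratum_def soc_stratum_def by auto
  show "generically (zariski G L d) (rad_stratum G L d S :: ('b, 'k) rep set) (\<lambda>x. socle_layering G L d x = S')"
    by (rule generically_of_open[OF irreducible_rad_stratum_mem[OF yR] W(1)]) (use W(2,3) yR in auto)
  have "irreducible_in (zariski G L d) (soc_stratum G L d S' :: ('b, 'k) rep set)"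
    using irreducible_soc_stratum[of y L d] bspec[OF W(3) W(2)] by simp
  then show "generically (zariski G L d) (soc_stratum G L d S' :: ('b, 'k) rep set) (\<lambda>x. radical_layering G L d x = S)"
    by (rule generically_of_open[OF _ W(1)]) (use W(2,3) yS in auto)
qed

text \<open>The modules over the two minimal pairs are nonempty open subsets of the same irreducible socle stratum.\<close>

lemma minimal_pair_socle_determines:
  assumes S: "minimal_rad_soc TYPE('k::alg_closed_field) G L d S S'" and T: "minimal_rad_soc TYPE('k::alg_closed_field) G L d T S'"
  shows "T = S"
proof -
  obtain W :: "('b, 'k) rep set" and y where W: "openin (zariski G L d) W" "y \<in> W"
    "\<forall>x\<in>W. x \<in> rep_variety G L d \<and> radical_layering G L d x = S \<and> socle_layering G L d x = S'"
    using minimal_pair_open[OF S] .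
  obtain V :: "('b, 'k) rep set" and z where V: "openin (zariski G L d) V" "z \<in> V"
    "\<forall>x\<in>V. x \<in> rep_variety G L d \<and> radical_layering G L d x = T \<and> socle_layering G L d x = S'"
    using minimal_pair_open[OF T] .
  have irr: "irreducible_in (zariski G L d) (soc_stratum G L d S' :: ('b, 'k) rep set)"
    using irreducible_soc_stratum[of y L d] bspec[OF W(3) W(2)] by simp
  have "y \<in> soc_stratum G L d S'" "z \<in> soc_stratum G L d S'"
    using bspec[OF W(3) W(2)] bspec[OF V(3) V(2)] unfolding soc_stratum_def by auto
  then obtain x where "x \<in> W" "x \<in> V" using irreducible_inD[OF irr W(1) V(1) W(2) _ V(2)] by metis
  then show ?thesis using W(3) V(3) by metis
qed

end

theorem mainTheorem1:
  fixes Q :: "('v, 'a) quiver" and L :: nat and d :: "'v \<Rightarrow> nat"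
    and S :: "'v semisimple_seq"
  assumes "fin_digraph Q" and "no_oriented_cycles Q" and "L \<ge> 1"
    and "S \<in> Seqs Q L d"
  shows "(irreducible_component (zariski Q L d)
            (zariski Q L d closure_of (rad_stratum Q L d S :: ('a, 'k::alg_closed_field) rep set))
          \<longleftrightarrow> (\<exists>S'. minimal_rad_soc TYPE('k) Q L d S S')) \<and>
         (\<forall>S'. minimal_rad_soc TYPE('k) Q L d S S' \<longrightarrow>
            generically (zariski Q L d) (rad_stratum Q L d S :: ('a, 'k) rep set)
              (\<lambda>x. socle_layering Q L d x = S') \<and>
            generically (zariski Q L d) (soc_stratum Q L d S' :: ('a, 'k) rep set)
              (\<lambda>x. radical_layering Q L d x = S) \<and>
            (\<forall>T. minimal_rad_soc TYPE('k) Q L d T S' \<longrightarrow> T = S))"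
proof -
  interpret fin_digraph Q by (rule assms(1))
  show ?thesis
    using component_imp_minimal[OF assms(2)] minimal_imp_component minimal_pair_generic
      minimal_pair_socle_determines by blast
qed

end
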